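(* Let $1/q$ be a prime power and $\Bbbk=\mathbb{F}_{1/q}$. Let $\alpha=(\alpha_1,\dots,\alpha_k)$, $\beta=(\beta_1,\dots,\beta_l)$ be weak compositions of $n$, $M\in\mathbb{N}^{k\times l}$ with row sums $\alpha$ and column sums $\beta$, and $(T,T')$ a pair of semistandard tableaux of the same shape $\lambda\vdash n$ with contents $\alpha$ and $\beta$. Then $$\frac{(1-q)^{-n}}{\prod_{i,j}[M_{i,j}]_q!}\,p_M(T,T')=\frac{q^{n^2-n-n(\alpha)-n(\beta)}(1-q)^{-n}}{[n]_q!}\,|\Omega^{T,T'}_M|=\frac{(1-q)^{-\lambda_1}}{\prod_{i\ge1}[\lambda_i-\lambda_{i+1}]_q!}\mathrm{wt}_q(T)\mathrm{wt}_q(T')\,\tilde p_M(T,T').$$ Consequently, since $\sum_{(T,T')}p_M(T,T')=1$ and $\sum_M\tilde p_M(T,T')=1$, summing gives $$\sum_{M}\frac{(1-q)^{-n}}{\prod_{i,j}[M_{i,j}]_q!}=\sum_{\lambda\vdash n}\sum_{(T,T')}\frac{(1-q)^{-\lambda_1}}{\prod_{i}[\lambda_i-\lambda_{i+1}]_q!}\mathrm{wt}_q(T)\mathrm{wt}_q(T'),$$ the sums being over all $M\in\mathbb{N}^{k\times l}$ with row sums $\alpha$ and column sums $\beta$, and over all pairs of semistandard tableaux of shape $\lambda$ with contents $\alpha,\beta$.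
   Context: $n(\alpha)=\sum\binom{\alpha_i}{2}$; $[m]_q!=\prod_{r\le m}(1+\cdots+q^{r-1})$, $\binom{m}{r}_q=[m]_q!/([r]_q![m-r]_q!)$. $\mathrm{Fl}_\alpha$: chains $0=F_0\subseteq\cdots\subseteq F_k=\Bbbk^n$, $\dim F_i=\alpha_1+\cdots+\alpha_i$. Relative position of $(F,F')\in\mathrm{Fl}_\alpha\times\mathrm{Fl}_\beta$: the $M$ with $\dim(F_i\cap F'_j)=\sum_{i'\le i,j'\le j}M_{i',j'}$. $N$ is strictly compatible with $F$ if $N(F_i)\subseteq F_{i-1}$ for all $i\ge1$; then $N$ is nilpotent and $\mathrm{JF}(N;F)$ is the semistandard tableau whose entries $\le i$ form the shape $\mathrm{JF}(N|_{F_i})$, where for nilpotent $N$, $\mathrm{JF}(N)$ is the partition with $\lambda_1+\cdots+\lambda_i=\dim\ker N^i$. $\Omega_{\alpha,\beta}$ is the set of triples $(F,F',N)$ with $F\in\mathrm{Fl}_\alpha$, $F'\in\mathrm{Fl}_\beta$, $N\in\mathfrak{gl}_n(\Bbbk)$ strictly compatible with both; $\Omega_M$ its subset with $(F,F')$ of relative position $M$; superscript $T,T'$ restricts to $\mathrm{JF}(N;F)=T$, $\mathrm{JF}(N;F')=T'$. Then $p_M(T,T')=|\Omega^{T,T'}_M|/|\Omega_M|$ and $\tilde p_M(T,T')=|\Omega^{T,T'}_M|/|\Omega^{T,T'}_{\alpha,\beta}|$. For a semistandard tableau $T$, $T^{(j)}$ is the shape of the entries $\le j$ and $\mathrm{wt}_q(T)=\prod_{i,j\ge1}\binom{T^{(j)}_i-T^{(j)}_{i+1}}{T^{(j)}_i-T^{(j-1)}_i}_q$.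 *)

theory Defs
  imports Complex_Main "HOL-Library.Function_Algebras"
begin

definition qint :: "real \<Rightarrow> nat \<Rightarrow> real" where
  "qint q r = (\<Sum>s<r. q ^ s)"

definition qfact :: "real \<Rightarrow> nat \<Rightarrow> real" where
  "qfact q m = (\<Prod>r\<in>{1..m}. qint q r)"

definition qbinom :: "real \<Rightarrow> nat \<Rightarrow> nat \<Rightarrow> real" where
  "qbinom q m r = qfact q m / (qfact q r * qfact q (m - r))"

definition nstat :: "nat list \<Rightarrow> nat" where
  "nstat \<alpha> = (\<Sum>i<length \<alpha>. (\<alpha> ! i) choose 2)"

interpretation fv: vector_space "\<lambda>(c::'a::field) (v::nat \<Rightarrow> 'a). (\<lambda>i. c * v i)"
  by unfold_locales (auto simp: fun_eq_iff algebra_simps)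

definition Vn :: "nat \<Rightarrow> (nat \<Rightarrow> 'a::field) set" where
  "Vn n = {v. \<forall>i\<ge>n. v i = 0}"

definition gln :: "nat \<Rightarrow> (nat \<Rightarrow> nat \<Rightarrow> 'a::field) set" where
  "gln n = {A. \<forall>i j. (n \<le> i \<or> n \<le> j) \<longrightarrow> A i j = 0}"

definition mv :: "nat \<Rightarrow> (nat \<Rightarrow> nat \<Rightarrow> 'a::field) \<Rightarrow> (nat \<Rightarrow> 'a) \<Rightarrow> (nat \<Rightarrow> 'a)" where
  "mv n A v = (\<lambda>i. if i < n then (\<Sum>j<n. A i j * v j) else 0)"

definition flag :: "nat \<Rightarrow> nat list \<Rightarrow> (nat \<Rightarrow> 'a::field) set list \<Rightarrow> bool" where
  "flag n \<alpha> F \<longleftrightarrow> length F = Suc (length \<alpha>) \<and>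
     (\<forall>i\<le>length \<alpha>. fv.subspace (F ! i) \<and> F ! i \<subseteq> Vn n \<and>
         fv.dim (F ! i) = (\<Sum>t<i. \<alpha> ! t)) \<and>
     (\<forall>i<length \<alpha>. F ! i \<subseteq> F ! Suc i) \<and>
     F ! 0 = {0} \<and> F ! length \<alpha> = Vn n"

definition relpos :: "(nat \<Rightarrow> 'a::field) set list \<Rightarrow> (nat \<Rightarrow> 'a) set list \<Rightarrow> (nat \<Rightarrow> nat \<Rightarrow> nat) \<Rightarrow> bool" where
  "relpos F F' M \<longleftrightarrow> (\<forall>i<length F. \<forall>j<length F'.
      fv.dim (F ! i \<inter> F' ! j) = (\<Sum>i'<i. \<Sum>j'<j. M i' j'))"

definition strict_compat :: "nat \<Rightarrow> (nat \<Rightarrow> nat \<Rightarrow> 'a::field) \<Rightarrow> (nat \<Rightarrow> 'a) set list \<Rightarrow> bool" where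
  "strict_compat n N F \<longleftrightarrow> (\<forall>i. 1 \<le> i \<and> i < length F \<longrightarrow> mv n N ` (F ! i) \<subseteq> F ! (i - 1))"

text \<open>JF(N|_W): the partition lambda with lambda_1+...+lambda_i = dim ker (N|_W)^i;
  parts are 0-indexed: jfpart n N W r = lambda_(r+1).\<close>
definition jfpart :: "nat \<Rightarrow> (nat \<Rightarrow> nat \<Rightarrow> 'a::field) \<Rightarrow> (nat \<Rightarrow> 'a) set \<Rightarrow> nat \<Rightarrow> nat" where
  "jfpart n N W r = fv.dim {v \<in> W. (mv n N ^^ Suc r) v = 0} - fv.dim {v \<in> W. (mv n N ^^ r) v = 0}"

definition is_partition :: "nat \<Rightarrow> (nat \<Rightarrow> nat) \<Rightarrow> bool" where
  "is_partition n lam \<longleftrightarrow> (\<forall>i. lam (Suc i) \<le> lam i) \<and> (\<forall>i\<ge>n. lam i = 0) \<and> (\<Sum>i<n. lam i) = n"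

text \<open>A tableau is a filling T r c (row r, column c, 0-indexed), with value 0 outside the shape.
  Semistandard of shape lam and content alpha (entries 1..k).\<close>
definition ssyt :: "nat list \<Rightarrow> (nat \<Rightarrow> nat) \<Rightarrow> (nat \<Rightarrow> nat \<Rightarrow> nat) \<Rightarrow> bool" where
  "ssyt \<alpha> lam T \<longleftrightarrow>
     (\<forall>r c. T r c \<noteq> 0 \<longleftrightarrow> c < lam r) \<and>
     (\<forall>r c. T r c \<le> length \<alpha>) \<and>
     (\<forall>r c. Suc c < lam r \<longrightarrow> T r c \<le> T r (Suc c)) \<and>
     (\<forall>r c. c < lam (Suc r) \<longrightarrow> T r c < T (Suc r) c) \<and>
     (\<forall>i<length \<alpha>. card {(r, c). T r c = Suc i} = \<alpha> ! i)"

definition tshape :: "(nat \<Rightarrow> nat \<Rightarrow> nat) \<Rightarrow> nat \<Rightarrow> nat \<Rightarrow> nat" where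
  "tshape T j r = card {c. T r c \<noteq> 0 \<and> T r c \<le> j}"

text \<open>wt_q(T) = prod_{i,j>=1} qbinom(T^(j)_i - T^(j)_(i+1), T^(j)_i - T^(j-1)_i); all factors
  with j > k or i > n equal 1.\<close>
definition wtq :: "real \<Rightarrow> nat \<Rightarrow> nat \<Rightarrow> (nat \<Rightarrow> nat \<Rightarrow> nat) \<Rightarrow> real" where
  "wtq q n k T = (\<Prod>j\<in>{1..k}. \<Prod>r<n.
      qbinom q (tshape T j r - tshape T j (Suc r)) (tshape T j r - tshape T (j - 1) r))"

definition jf_tab :: "nat \<Rightarrow> (nat \<Rightarrow> nat \<Rightarrow> 'a::field) \<Rightarrow> (nat \<Rightarrow> 'a) set list \<Rightarrow> (nat \<Rightarrow> nat \<Rightarrow> nat) \<Rightarrow> bool" where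
  "jf_tab n N F T \<longleftrightarrow> (\<forall>i<length F. \<forall>r. tshape T i r = jfpart n N (F ! i) r)"

definition Omega :: "nat \<Rightarrow> nat list \<Rightarrow> nat list \<Rightarrow>
    ((nat \<Rightarrow> 'a::field) set list \<times> (nat \<Rightarrow> 'a) set list \<times> (nat \<Rightarrow> nat \<Rightarrow> 'a)) set" where
  "Omega n \<alpha> \<beta> = {(F, F', N). flag n \<alpha> F \<and> flag n \<beta> F' \<and> N \<in> gln n \<and>
       strict_compat n N F \<and> strict_compat n N F'}"

definition OmegaM :: "nat \<Rightarrow> nat list \<Rightarrow> nat list \<Rightarrow> (nat \<Rightarrow> nat \<Rightarrow> nat) \<Rightarrow>
    ((nat \<Rightarrow> 'a::field) set list \<times> (nat \<Rightarrow> 'a) set list \<times> (nat \<Rightarrow> nat \<Rightarrow> 'a)) set" where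
  "OmegaM n \<alpha> \<beta> M = {(F, F', N) \<in> Omega n \<alpha> \<beta>. relpos F F' M}"

definition OmegaT :: "nat \<Rightarrow> nat list \<Rightarrow> nat list \<Rightarrow> (nat \<Rightarrow> nat \<Rightarrow> nat) \<Rightarrow> (nat \<Rightarrow> nat \<Rightarrow> nat) \<Rightarrow>
    ((nat \<Rightarrow> 'a::field) set list \<times> (nat \<Rightarrow> 'a) set list \<times> (nat \<Rightarrow> nat \<Rightarrow> 'a)) set" where
  "OmegaT n \<alpha> \<beta> T T' = {(F, F', N) \<in> Omega n \<alpha> \<beta>. jf_tab n N F T \<and> jf_tab n N F' T'}"

definition OmegaMT :: "nat \<Rightarrow> nat list \<Rightarrow> nat list \<Rightarrow> (nat \<Rightarrow> nat \<Rightarrow> nat) \<Rightarrow>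
    (nat \<Rightarrow> nat \<Rightarrow> nat) \<Rightarrow> (nat \<Rightarrow> nat \<Rightarrow> nat) \<Rightarrow>
    ((nat \<Rightarrow> 'a::field) set list \<times> (nat \<Rightarrow> 'a) set list \<times> (nat \<Rightarrow> nat \<Rightarrow> 'a)) set" where
  "OmegaMT n \<alpha> \<beta> M T T' = OmegaM n \<alpha> \<beta> M \<inter> OmegaT n \<alpha> \<beta> T T'"

definition pM :: "'a::{field,finite} itself \<Rightarrow> nat \<Rightarrow> nat list \<Rightarrow> nat list \<Rightarrow> (nat \<Rightarrow> nat \<Rightarrow> nat) \<Rightarrow>
    (nat \<Rightarrow> nat \<Rightarrow> nat) \<Rightarrow> (nat \<Rightarrow> nat \<Rightarrow> nat) \<Rightarrow> real" where
  "pM _ n \<alpha> \<beta> M T T' = real (card (OmegaMT n \<alpha> \<beta> M T T' :: (_ \<times> _ \<times> (nat \<Rightarrow> nat \<Rightarrow> 'a)) set))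
       / real (card (OmegaM n \<alpha> \<beta> M :: (_ \<times> _ \<times> (nat \<Rightarrow> nat \<Rightarrow> 'a)) set))"

definition ptM :: "'a::{field,finite} itself \<Rightarrow> nat \<Rightarrow> nat list \<Rightarrow> nat list \<Rightarrow> (nat \<Rightarrow> nat \<Rightarrow> nat) \<Rightarrow>
    (nat \<Rightarrow> nat \<Rightarrow> nat) \<Rightarrow> (nat \<Rightarrow> nat \<Rightarrow> nat) \<Rightarrow> real" where
  "ptM _ n \<alpha> \<beta> M T T' = real (card (OmegaMT n \<alpha> \<beta> M T T' :: (_ \<times> _ \<times> (nat \<Rightarrow> nat \<Rightarrow> 'a)) set))
       / real (card (OmegaT n \<alpha> \<beta> T T' :: (_ \<times> _ \<times> (nat \<Rightarrow> nat \<Rightarrow> 'a)) set))"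

definition contingency :: "nat list \<Rightarrow> nat list \<Rightarrow> (nat \<Rightarrow> nat \<Rightarrow> nat) set" where
  "contingency \<alpha> \<beta> = {M. (\<forall>i j. (length \<alpha> \<le> i \<or> length \<beta> \<le> j) \<longrightarrow> M i j = 0) \<and>
      (\<forall>i<length \<alpha>. (\<Sum>j<length \<beta>. M i j) = \<alpha> ! i) \<and>
      (\<forall>j<length \<beta>. (\<Sum>i<length \<alpha>. M i j) = \<beta> ! j)}"

end

theory Submission
  imports Defs "HOL-Library.FuncSet" "HOL-Library.Cardinality"
begin

text \<open>
  Both equalities follow from closed formulas for \<open>|\<Omega>\<^sub>M|\<close> and \<open>|\<Omega>\<^sup>T\<^sup>,\<^sup>T\<^sup>'|\<close>, and the summation formula from
  counting all of \<open>\<Omega>\<close> in two ways. For \<open>\<Omega>\<^sub>M\<close> one fixes \<open>F\<close> and removes the last step of \<open>F'\<close>: its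
  second largest member \<open>W\<close> is a subspace meeting the members of \<open>F\<close> in prescribed dimensions, and
  \<open>N\<close> is an extension of its restriction to \<open>W\<close>. For \<open>\<Omega>\<^sup>T\<^sup>,\<^sup>T\<^sup>'\<close> one sums over \<open>N\<close> of type \<open>\<lambda>\<close>. The
  number of such \<open>N\<close> is found by restricting \<open>N\<close> to the kernel of its last nonzero power. For fixed
  \<open>N\<close> the two flags are independent, and the choices for the second largest member of a flag are again
  the subspaces meeting a given flag, that of the \<open>ker N\<^sup>r + im N\<close>, in prescribed dimensions.
\<close>

subsection \<open>$q$-numbers\<close>

text \<open>Since \<open>q\<close> is the inverse of the field size \<open>Q\<close>, raw counts
  involve powers of \<open>Q\<close>, whereas the statement is written in
  \<open>q\<close>-factorials. Every count is therefore given as a product, a cardinality times a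
  power of \<open>q\<close>: that power absorbs the leading power of \<open>Q\<close>, and such
  identities multiply along fibrations without any division. The exponents then have to cancel, and
  most auxiliary identities serve this. The ambient space of sequences is infinite, so subspaces are
  required to be finite, and a linear map on a subspace is an extensional function that has a linear
  extension to the whole space; maps between finite subspaces form finite sets and restrict without
  a change of type, as the inductions on shrinking subspaces require. Both weights in the theorem
  turn out to be one and the same constant times the cardinality that is the denominator of the
  corresponding quotient \<open>p\<close>. These cardinalities are nonzero, so multiplying by
  \<open>p\<close> leaves the constant times the size of the intersection.\<close>

lemma qint_mult: "qint q r * (1 - q) = 1 - q ^ r"
  by (simp add: qint_def one_diff_power_eq mult.commute)

lemma qint_pos: "0 < q \<Longrightarrow> 0 < r \<Longrightarrow> 0 < qint q r"
  unfolding qint_def by (rule sum_pos) auto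

lemma qfact_0 [simp]: "qfact q 0 = 1"
  by (simp add: qfact_def)

lemma qfact_Suc: "qfact q (Suc m) = qfact q m * qint q (Suc m)"
  by (simp add: qfact_def)

lemma qfact_pos: "0 < q \<Longrightarrow> 0 < qfact q m"
  unfolding qfact_def by (rule prod_pos) (auto intro: qint_pos)

lemma qfact_nonzero: "0 < q \<Longrightarrow> qfact q m \<noteq> 0"
  using qfact_pos[of q m] by simp

lemma qbinom_0 [simp]: "0 < q \<Longrightarrow> qbinom q m 0 = 1"
  by (simp add: qbinom_def qfact_nonzero)

lemma qbinom_pos: "0 < q \<Longrightarrow> 0 < qbinom q m r"
  by (simp add: qbinom_def qfact_pos)

text \<open>The absorption identity. It matches the double count of pairs of a subspace and a vector
  in \<open>card_above\<close>.\<close>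

lemma qbinom_Suc_Suc:
  assumes "0 < q"
  shows "qbinom q (Suc m) (Suc r) * qint q (Suc r) = qbinom q m r * qint q (Suc m)"
proof -
  have "qint q (Suc r) \<noteq> 0" using qint_pos[OF assms, of "Suc r"] by simp
  thus ?thesis by (simp add: qbinom_def qfact_Suc)
qed

lemma choose_two_add: "(a + b) choose 2 = (a choose 2) + (b choose 2) + a * b"
  by (induction a) (simp_all add: numeral_2_eq_2)

lemma square_eq_choose_two: "n ^ 2 = n + 2 * (n choose 2)"
  by (induction n) (simp_all add: numeral_2_eq_2 power2_eq_square)

subsection \<open>Dimension in vector spaces over a finite field\<close>

lemma field_card_gt_1: "1 < CARD('a::{field,finite})"
proof -
  have "card {0, 1 :: 'a} \<le> CARD('a)" by (rule card_mono) auto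
  thus ?thesis by simp
qed

locale finite_field_space = vector_space scale
  for scale :: "'a::{field,finite} \<Rightarrow> 'b::ab_group_add \<Rightarrow> 'b" (infixr "*s" 75) +
  fixes q :: real
  assumes q_eq: "q = 1 / real CARD('a)"
begin

lemma q_pos: "0 < q"
  using field_card_gt_1[where 'a='a] by (simp add: q_eq)

lemma q_less_1: "q < 1"
  using field_card_gt_1[where 'a='a] by (simp add: q_eq)

lemma card_power_mult_q: "real (CARD('a) ^ n) * q ^ n = 1"
  using field_card_gt_1[where 'a='a] by (simp add: q_eq power_divide)

definition fsub :: "'b set \<Rightarrow> bool"
  where "fsub S \<longleftrightarrow> subspace S \<and> finite S"

lemma fsubD: "fsub S \<Longrightarrow> subspace S" "fsub S \<Longrightarrow> finite S"
  by (auto simp: fsub_def)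

lemma fsub_subset: "fsub T \<Longrightarrow> subspace S \<Longrightarrow> S \<subseteq> T \<Longrightarrow> fsub S"
  by (auto simp: fsub_def intro: finite_subset)

lemma fsub_Int: "fsub S \<Longrightarrow> subspace T \<Longrightarrow> fsub (S \<inter> T)"
  by (auto simp: fsub_def subspace_inter)

lemma fsub_0 [simp]: "fsub {0}"
  by (simp add: fsub_def)

lemma zero_in_fsub: "fsub S \<Longrightarrow> 0 \<in> S"
  using subspace_0 fsubD by blast

lemma card_span_insert:
  assumes "finite (span B)" "b \<notin> span B"
  shows "finite (span (insert b B)) \<and> card (span (insert b B)) = CARD('a) * card (span B)"
proof -
  let ?f = "\<lambda>(k, x). k *s b + x"
  have eq: "span (insert b B) = ?f ` (UNIV \<times> span B)"
  proof (intro equalityI subsetI)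
    fix x assume "x \<in> span (insert b B)"
    then obtain k where "x - k *s b \<in> span B" by (auto simp: span_insert)
    thus "x \<in> ?f ` (UNIV \<times> span B)" by (intro image_eqI[of _ _ "(k, x - k *s b)"]) auto
  next
    fix y assume "y \<in> ?f ` (UNIV \<times> span B)"
    then obtain k x where "y = k *s b + x" "x \<in> span B" by auto
    thus "y \<in> span (insert b B)" unfolding span_insert by (intro CollectI exI[of _ k]) simp
  qed
  have inj: "inj_on ?f (UNIV \<times> span B)"
  proof (rule inj_onI, clarify)
    fix k x k' x' assume x: "x \<in> span B" "x' \<in> span B" and e: "k *s b + x = k' *s b + x'"
    have "(k - k') *s b = x' - x"
      using e by (simp add: scale_left_diff_distrib algebra_simps)
    hence *: "(k - k') *s b \<in> span B" using x span_diff by simp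
    have "k = k'"
    proof (rule ccontr)
      assume "k \<noteq> k'"
      hence "b = inverse (k - k') *s ((k - k') *s b)" by simp
      thus False using span_scale[OF *, of "inverse (k - k')"] assms(2) by simp
    qed
    thus "k = k' \<and> x = x'" using e by simp
  qed
  show ?thesis using assms(1) by (simp add: eq card_image[OF inj] card_cartesian_product)
qed

lemma fsub_span_insert:
  assumes "fsub A" shows "fsub (span (insert v A))"
proof (cases "v \<in> A")
  case True
  thus ?thesis using assms by (simp add: fsub_def insert_absorb span_eq_iff[THEN iffD2])
next
  case False
  have "span A = A" using assms by (simp add: fsub_def)
  hence "finite (span (insert v A))"
    by (metis False assms card_span_insert fsub_def)
  thus ?thesis by (simp add: fsub_def)
qed

lemma card_span_independent:
  "finite B \<Longrightarrow> independent B \<Longrightarrow> finite (span B) \<and> card (span B) = CARD('a) ^ card B"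
proof (induction B rule: finite_induct)
  case (insert b B)
  hence "independent B" "b \<notin> span B" by (auto simp: independent_insert)
  thus ?case using insert card_span_insert[of B b] by simp
qed simp

text \<open>Cardinality determines dimension, so the dimension formulas below are proved by counting
  elements and comparing exponents.\<close>

lemma card_fsub:
  assumes "fsub S" shows "card S = CARD('a) ^ dim S"
proof -
  obtain B where B: "B \<subseteq> S" "independent B" "S \<subseteq> span B" "card B = dim S"
    using basis_exists by blast
  have "span B = S" using B assms by (intro span_subspace) (auto simp: fsub_def)
  moreover have "finite B" using B assms finite_subset by (auto simp: fsub_def)
  ultimately show ?thesis using card_span_independent[of B] B by simp
qed

lemma card_fsub_mult_q: "fsub S \<Longrightarrow> real (card S) * q ^ dim S = 1"
  using card_power_mult_q by (simp add: card_fsub)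

lemma card_power_eq_iff [simp]: "CARD('a) ^ m = CARD('a) ^ n \<longleftrightarrow> m = n"
  using field_card_gt_1[where 'a='a] by simp

lemma card_power_le_iff [simp]: "CARD('a) ^ m \<le> CARD('a) ^ n \<longleftrightarrow> m \<le> n"
  using field_card_gt_1[where 'a='a] by simp

lemma dim_mono: "fsub T \<Longrightarrow> subspace S \<Longrightarrow> S \<subseteq> T \<Longrightarrow> dim S \<le> dim T"
  using card_mono[of T S] card_fsub[of S] card_fsub[of T] fsub_subset[of T S] by (simp add: fsubD)

lemma fsub_dim_eqI: "fsub T \<Longrightarrow> subspace S \<Longrightarrow> S \<subseteq> T \<Longrightarrow> dim S = dim T \<Longrightarrow> S = T"
  using card_subset_eq[of T S] card_fsub[of S] card_fsub[of T] fsub_subset[of T S] by (simp add: fsubD)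

lemma dim_zero [simp]: "dim {0} = 0"
  using dim_span_eq_card_independent[OF independent_empty] dim_span[of "{0}"] dim_span[of "{}"] by simp

lemma fsub_dim_0: "fsub S \<Longrightarrow> dim S = 0 \<Longrightarrow> S = {0}"
  using fsub_dim_eqI[of S "{0}"] by (auto simp: zero_in_fsub)

lemma dim_span_insert:
  assumes "fsub A" "v \<notin> A" shows "dim (span (insert v A)) = Suc (dim A)"
proof -
  have s: "span A = A" using assms by (simp add: fsub_def)
  have "CARD('a) ^ dim (span (insert v A)) = CARD('a) ^ Suc (dim A)"
    using card_span_insert[of A v] assms s card_fsub[OF assms(1)]
      card_fsub[OF fsub_span_insert[OF assms(1)]] by (simp add: fsub_def)
  thus ?thesis by (simp only: card_power_eq_iff)
qed

lemma span_insert_fsub: "fsub A \<Longrightarrow> span (insert v A) = {x. \<exists>k. x - k *s v \<in> A}"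
  by (simp add: span_insert fsub_def span_eq_iff[THEN iffD2])

lemma span_insert_least: "subspace W \<Longrightarrow> A \<subseteq> W \<Longrightarrow> v \<in> W \<Longrightarrow> span (insert v A) \<subseteq> W"
  by (simp add: span_minimal)

section \<open>Linear maps and the dimension formula\<close>

definition lin :: "('b \<Rightarrow> 'b) \<Rightarrow> bool"
  where "lin f \<longleftrightarrow> (\<forall>x y. f (x + y) = f x + f y) \<and> (\<forall>c x. f (c *s x) = c *s f x)"

lemma lin_iff_linear: "lin f \<longleftrightarrow> Vector_Spaces.linear scale scale f"
  by (auto simp: lin_def Vector_Spaces.linear_iff vector_space_axioms)

lemma lin_add: "lin f \<Longrightarrow> f (x + y) = f x + f y"
  by (simp add: lin_def)

lemma lin_scale: "lin f \<Longrightarrow> f (c *s x) = c *s f x"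
  by (simp add: lin_def)

lemma lin_0 [simp]: "lin f \<Longrightarrow> f 0 = 0"
  using lin_scale[of f 0 0] by simp

lemma lin_diff: "lin f \<Longrightarrow> f (x - y) = f x - f y"
  using lin_add[of f "x - y" y] by (simp add: algebra_simps)

lemma lin_id [simp]: "lin (\<lambda>x. x)"
  by (simp add: lin_def)

lemma lin_zero_map [simp]: "lin (\<lambda>x. 0)"
  by (simp add: lin_def)

lemma lin_funpow: "lin f \<Longrightarrow> lin (f ^^ r)"
  by (induction r) (auto simp: lin_def)

lemma subspace_preimage: "lin f \<Longrightarrow> subspace A \<Longrightarrow> subspace D \<Longrightarrow> subspace {a \<in> A. f a \<in> D}"
  by (rule subspaceI) (auto simp: lin_add lin_scale subspace_0 subspace_add subspace_scale)

lemma subspace_ker: "lin f \<Longrightarrow> subspace A \<Longrightarrow> subspace {a \<in> A. f a = 0}"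
  using subspace_preimage[of f A "{0}"] by simp

lemma fsub_ker: "lin f \<Longrightarrow> fsub A \<Longrightarrow> fsub {a \<in> A. f a = 0}"
  by (rule fsub_subset) (auto intro: subspace_ker simp: fsubD)

lemma subspace_image_sum:
  assumes "lin f" "subspace A" "subspace D" shows "subspace {f a + d | a d. a \<in> A \<and> d \<in> D}"
proof (rule subspaceI)
  show "0 \<in> {f a + d | a d. a \<in> A \<and> d \<in> D}"
    using assms by (intro CollectI exI[of _ 0]) (simp add: subspace_0)
next
  fix x y assume "x \<in> {f a + d | a d. a \<in> A \<and> d \<in> D}" "y \<in> {f a + d | a d. a \<in> A \<and> d \<in> D}"
  then obtain a d a' d' where *: "x = f a + d" "y = f a' + d'" "a \<in> A" "d \<in> D" "a' \<in> A" "d' \<in> D"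
    by blast
  show "x + y \<in> {f a + d | a d. a \<in> A \<and> d \<in> D}"
    using assms * by (intro CollectI exI[of _ "a + a'"] exI[of _ "d + d'"])
      (simp add: lin_add subspace_add algebra_simps)
next
  fix c x assume "x \<in> {f a + d | a d. a \<in> A \<and> d \<in> D}"
  then obtain a d where *: "x = f a + d" "a \<in> A" "d \<in> D" by blast
  show "c *s x \<in> {f a + d | a d. a \<in> A \<and> d \<in> D}"
    using assms * by (intro CollectI exI[of _ "c *s a"] exI[of _ "c *s d"])
      (simp add: lin_scale subspace_scale scale_right_distrib)
qed

text \<open>A common generalisation of the rank-nullity theorem (\<open>D = {0}\<close>) and of the dimension formula
  for sums (\<open>f = id\<close>).\<close>

lemma dim_image_sum:
  assumes f: "lin f" and A: "fsub A" and D: "fsub D"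
  shows "fsub {f a + d | a d. a \<in> A \<and> d \<in> D}"
    and "dim {f a + d | a d. a \<in> A \<and> d \<in> D} + dim {a \<in> A. f a \<in> D} = dim A + dim D"
proof -
  let ?S = "{f a + d | a d. a \<in> A \<and> d \<in> D}" and ?K = "{a \<in> A. f a \<in> D}"
  let ?g = "\<lambda>(a, d). f a + d"
  have S: "?S = ?g ` (A \<times> D)" by auto
  show fS: "fsub ?S"
  proof -
    have "finite ?S" using A D by (simp only: S) (simp add: fsubD)
    thus ?thesis using A D subspace_image_sum[OF f] by (simp add: fsub_def)
  qed
  have K: "fsub ?K"
    using A D f by (intro fsub_subset[OF A]) (auto simp: fsubD intro!: subspace_preimage)
  have fib: "card {p \<in> A \<times> D. ?g p = s} = card ?K" if sS: "s \<in> ?S" for s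
  proof -
    obtain a0 d0 where s: "s = f a0 + d0" "a0 \<in> A" "d0 \<in> D" using sS by blast
    \<comment> \<open>The fibre over \<open>s\<close> is a coset of \<open>?K\<close>: two
      decompositions of \<open>s\<close> differ by some \<open>a\<close> in \<open>A\<close> with
      \<open>f a\<close> in \<open>D\<close>.\<close>
    have "bij_betw (\<lambda>a. (a0 + a, d0 - f a)) ?K {p \<in> A \<times> D. ?g p = s}"
    proof (rule bij_betwI[where g = "\<lambda>p. fst p - a0"])
      show "(\<lambda>a. (a0 + a, d0 - f a)) \<in> ?K \<rightarrow> {p \<in> A \<times> D. ?g p = s}"
        using A D f s by (auto simp: lin_add fsubD intro!: subspace_add subspace_diff)
      show "(\<lambda>p. fst p - a0) \<in> {p \<in> A \<times> D. ?g p = s} \<rightarrow> ?K"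
      proof
        fix p assume p: "p \<in> {p \<in> A \<times> D. ?g p = s}"
        obtain a d where ad: "p = (a, d)" by (cases p)
        have *: "a \<in> A" "d \<in> D" "f a + d = s" using p ad by auto
        have "f (a - a0) = d0 - d" using * s by (simp add: lin_diff[OF f] algebra_simps)
        thus "fst p - a0 \<in> ?K"
          using * s A D ad by (auto simp: fsubD intro!: subspace_diff)
      qed
    qed (use s f in \<open>auto simp: lin_diff algebra_simps\<close>)
    thus ?thesis by (simp add: bij_betw_same_card)
  qed
  have "card (A \<times> D) = (\<Sum>s\<in>?S. card {p \<in> A \<times> D. ?g p = s})"
    unfolding S using sum.image_gen[of "A \<times> D" "\<lambda>_. 1::nat" ?g] A D by (simp add: fsubD)
  also have "\<dots> = card ?S * card ?K" using fib by simp
  finally have "card A * card D = card ?S * card ?K" by (simp add: card_cartesian_product)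
  hence "CARD('a) ^ (dim ?S + dim ?K) = CARD('a) ^ (dim A + dim D)"
    by (simp add: card_fsub[OF A] card_fsub[OF D] card_fsub[OF fS] card_fsub[OF K] power_add
        del: card_power_eq_iff)
  thus "dim ?S + dim ?K = dim A + dim D" by (simp only: card_power_eq_iff)
qed

lemma dim_sum:
  assumes "fsub A" "fsub D"
  shows "fsub {a + d | a d. a \<in> A \<and> d \<in> D}"
    "dim {a + d | a d. a \<in> A \<and> d \<in> D} + dim (A \<inter> D) = dim A + dim D"
proof -
  have "{a \<in> A. a \<in> D} = A \<inter> D" by auto
  thus "fsub {a + d | a d. a \<in> A \<and> d \<in> D}"
    "dim {a + d | a d. a \<in> A \<and> d \<in> D} + dim (A \<inter> D) = dim A + dim D"
    using dim_image_sum[OF lin_id assms] by simp_all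
qed

text \<open>The map from \<open>A\<close> to \<open>C / D\<close> induced by \<open>f\<close> has
  kernel \<open>{a \<in> A. f a \<in> D}\<close>. Applied to kernels of powers, this gives the
  interlacing of the shapes along a flag; applied to intersections of two flags, it makes the
  entries of the relative position nonnegative.\<close>

lemma dim_quotient_le:
  assumes f: "lin f" and A: "fsub A" and C: "fsub C" and D: "subspace D"
    and sub: "f ` A \<subseteq> C" "D \<subseteq> C"
  shows "dim A + dim D \<le> dim C + dim {a \<in> A. f a \<in> D}"
proof -
  have D': "fsub D" using fsub_subset[OF C D sub(2)] .
  have "{f a + d | a d. a \<in> A \<and> d \<in> D} \<subseteq> C"
    using sub C by (auto simp: fsubD intro!: subspace_add)
  hence "dim {f a + d | a d. a \<in> A \<and> d \<in> D} \<le> dim C"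
    using dim_image_sum(1)[OF f A D'] C by (intro dim_mono) (auto simp: fsubD)
  thus ?thesis using dim_image_sum(2)[OF f A D'] by linarith
qed

end

subsection \<open>Counting subspaces\<close>

text \<open>The factor \<open>a\<close> is there because fibre sizes are only available in the form
  of a cardinality times a power of \<open>q\<close> and perhaps \<open>q\<close>-factorials.
  Finiteness of the fibres is a separate hypothesis, as infinite sets have \<open>card\<close>
  zero.\<close>

lemma card_by_fibers:
  fixes a b :: real
  assumes "finite Y" "f ` X \<subseteq> Y"
    and "\<And>y. y \<in> Y \<Longrightarrow> finite {x \<in> X. f x = y}"
    and "\<And>y. y \<in> Y \<Longrightarrow> real (card {x \<in> X. f x = y}) * a = b"
  shows "finite X" and "real (card X) * a = real (card Y) * b"
proof -
  have "X = (\<Union>y\<in>Y. {x \<in> X. f x = y})" using assms(2) by auto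
  moreover have "finite (\<Union>y\<in>Y. {x \<in> X. f x = y})" using assms by blast
  ultimately show X: "finite X" by simp
  have "card X = (\<Sum>y\<in>Y. card {x \<in> X. f x = y})"
    using sum.group[OF X assms(1,2), of "\<lambda>_. 1::nat"] by simp
  hence "real (card X) * a = (\<Sum>y\<in>Y. real (card {x \<in> X. f x = y}) * a)"
    by (simp add: sum_distrib_right)
  also have "\<dots> = real (card Y) * b" using assms(4) by simp
  finally show "real (card X) * a = real (card Y) * b" .
qed

text \<open>A positive fibre size already makes the fibres finite, because infinite sets have
  \<open>card\<close> zero.\<close>

lemma card_by_fibers_nat:
  assumes "finite Y" "f ` X \<subseteq> Y" "0 < c"
    and "\<And>y. y \<in> Y \<Longrightarrow> card {x \<in> X. f x = y} = c"
  shows "finite X" and "card X = card Y * c"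
proof -
  have fin: "finite {x \<in> X. f x = y}" if "y \<in> Y" for y
    using assms(3,4) that card_ge_0_finite by metis
  show "finite X"
    by (rule card_by_fibers(1)[OF assms(1,2), where a = 1 and b = "real c"]) (use fin assms(4) in auto)
  have "real (card X) * 1 = real (card Y) * real c"
    by (rule card_by_fibers(2)[OF assms(1,2)]) (use fin assms(4) in auto)
  thus "card X = card Y * c" by (metis mult.right_neutral of_nat_eq_iff of_nat_mult)
qed

section \<open>Subspaces with prescribed intersections\<close>

context finite_field_space
begin

lemma card_mult_q [simp]: "real CARD('a) * q = 1"
  using field_card_gt_1[where 'a='a] by (simp add: q_eq)

lemma card_power_diff:
  assumes "b \<le> c"
  shows "(real CARD('a) ^ c - real CARD('a) ^ b) * q ^ c = 1 - q ^ (c - b)"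
proof -
  have 1: "real CARD('a) ^ n * q ^ n = 1" for n by (simp flip: power_mult_distrib)
  have "q ^ c = q ^ b * q ^ (c - b)" using assms by (simp flip: power_add)
  hence "real CARD('a) ^ b * q ^ c = q ^ (c - b)" using 1[of b] by (metis mult.assoc mult.left_neutral)
  thus ?thesis using 1[of c] by (simp add: left_diff_distrib)
qed

text \<open>For \<open>A \<subseteq> B\<close> these correspond to the \<open>w\<close>-dimensional
  subspaces of \<open>C / A\<close> that meet \<open>B / A\<close> only in zero.\<close>

definition above :: "'b set \<Rightarrow> 'b set \<Rightarrow> 'b set \<Rightarrow> nat \<Rightarrow> 'b set set"
  where "above A B C w = {W. subspace W \<and> A \<subseteq> W \<and> W \<subseteq> C \<and> W \<inter> B = A \<and> dim W = dim A + w}"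

lemma finite_above: "finite C \<Longrightarrow> finite (above A B C w)"
  by (rule finite_subset[of _ "Pow C"]) (auto simp: above_def)

text \<open>Prescribing a vector \<open>v\<close> of \<open>W\<close> outside \<open>B\<close>
  amounts to dividing by one more line, which gives the same problem with \<open>w\<close> lowered
  by one.\<close>

lemma above_insert:
  assumes C: "fsub C" and sub: "subspace A" "subspace B" "A \<subseteq> B" "B \<subseteq> C" and v: "v \<in> C - B"
  shows "above (span (insert v A)) (span (insert v B)) C w = {W \<in> above A B C (Suc w). v \<in> W}"
proof -
  have A: "fsub A" and B: "fsub B" using C sub fsub_subset by (meson order_trans)+
  have dA: "dim (span (insert v A)) = Suc (dim A)" using A sub v by (intro dim_span_insert) auto
  note sA = span_insert_fsub[OF A, of v] and sB = span_insert_fsub[OF B, of v]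
  show ?thesis
  proof (intro equalityI subsetI)
    fix W assume W: "W \<in> above (span (insert v A)) (span (insert v B)) C w"
    hence sW: "subspace W" and AW: "span (insert v A) \<subseteq> W" and WC: "W \<subseteq> C"
      and WB: "W \<inter> span (insert v B) = span (insert v A)" and dW: "dim W = dim A + Suc w"
      using dA by (auto simp: above_def)
    have vW: "v \<in> W" "A \<subseteq> W" using AW span_superset[of "insert v A"] by auto
    have "W \<inter> B \<subseteq> A"
    proof
      fix x assume x: "x \<in> W \<inter> B"
      hence "x \<in> W \<inter> span (insert v B)" using span_superset[of "insert v B"] by auto
      then obtain k where k: "x - k *s v \<in> A" using WB sA by auto
      have "x - (x - k *s v) \<in> B"
        by (rule subspace_diff) (use x k sub in auto)
      hence kv: "k *s v \<in> B" by simp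
      have "k = 0"
      proof (rule ccontr)
        assume "k \<noteq> 0"
        hence "v = inverse k *s (k *s v)" by simp
        thus False using v subspace_scale[OF sub(2) kv, of "inverse k"] by simp
      qed
      thus "x \<in> A" using k by simp
    qed
    thus "W \<in> {W \<in> above A B C (Suc w). v \<in> W}"
      using sW WC dW vW sub by (auto simp: above_def)
  next
    fix W assume "W \<in> {W \<in> above A B C (Suc w). v \<in> W}"
    hence sW: "subspace W" and AW: "A \<subseteq> W" and WC: "W \<subseteq> C" and WB: "W \<inter> B = A"
      and dW: "dim W = Suc (dim A) + w" and vW: "v \<in> W" by (auto simp: above_def)
    have AW': "span (insert v A) \<subseteq> W" using span_insert_least[OF sW AW vW] .
    have "W \<inter> span (insert v B) \<subseteq> span (insert v A)"
    proof
      fix x assume x: "x \<in> W \<inter> span (insert v B)"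
      then obtain k where k: "x - k *s v \<in> B" using sB by auto
      have "x - k *s v \<in> W" using x sW vW by (auto intro!: subspace_diff subspace_scale)
      hence "x - k *s v \<in> A" using k WB by auto
      thus "x \<in> span (insert v A)" using sA by auto
    qed
    moreover have "span (insert v A) \<subseteq> span (insert v B)" using sub by (intro span_mono) auto
    ultimately show "W \<in> above (span (insert v A)) (span (insert v B)) C w"
      using sW WC AW' dW dA by (auto simp: above_def)
  qed
qed

text \<open>Pairs \<open>(W, v)\<close> with \<open>v \<in> W - A\<close> are counted twice; such
  \<open>v\<close> lie outside \<open>B\<close> because \<open>W \<inter> B = A\<close>. Over
  \<open>Q = 1/q\<close> the number is \<open>Q ^ (w * (dim B - dim A))\<close> times a Gaussian
  binomial in \<open>Q\<close>, and rewriting the latter in \<open>q\<close> brings in the rest of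
  the exponent.\<close>

lemma card_above:
  assumes C: "fsub C" and "subspace A" "subspace B" "A \<subseteq> B" "B \<subseteq> C" "dim B + w \<le> dim C"
  shows "real (card (above A B C w)) * q ^ (w * (dim C - dim A - w)) = qbinom q (dim C - dim B) w"
  using assms(2-)
proof (induction w arbitrary: A B)
  case 0
  have A: "fsub A" using C 0 fsub_subset by (meson order_trans)
  have "W = A" if "W \<in> above A B C 0" for W
    using that fsub_dim_eqI[of W A] fsub_subset[OF C, of W] 0 by (auto simp: above_def)
  moreover have "A \<in> above A B C 0" using 0 by (auto simp: above_def)
  ultimately have "above A B C 0 = {A}" by blast
  thus ?case using q_pos by simp
next
  case (Suc w)
  let ?R = "real CARD('a)"
  have A: "fsub A" and B: "fsub B" using C Suc.prems fsub_subset by (meson order_trans)+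
  have dAB: "dim A \<le> dim B" using dim_mono[OF B] Suc.prems by simp
  define a b c where "a = dim A" and "b = dim B" and "c = dim C"
  \<comment> \<open>The codimension of \<open>W\<close> in \<open>C\<close>. It stays the same in
    the induction hypothesis, where \<open>A\<close> has grown by one dimension and \<open>w\<close>
    has dropped by one.\<close>
  define e where "e = c - a - Suc w"
  have le: "b + Suc w \<le> c" "a \<le> b" using Suc.prems dAB by (auto simp: a_def b_def c_def)
  let ?W = "above A B C (Suc w)"
  let ?P = "SIGMA W:?W. W - A"
  have finW: "finite ?W" using C by (simp add: finite_above fsubD)
  have cardW: "real (card (W - A)) = ?R ^ (a + Suc w) - ?R ^ a" if "W \<in> ?W" for W
  proof -
    have W: "fsub W" "A \<subseteq> W" "dim W = a + Suc w"
      using that fsub_subset[OF C, of W] by (auto simp: above_def a_def)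
    have "card (W - A) = card W - card A" using W A by (intro card_Diff_subset) (auto simp: fsubD)
    moreover have "card A \<le> card W" using W by (intro card_mono) (auto simp: fsubD)
    ultimately show ?thesis by (simp add: card_fsub[OF A] card_fsub[OF W(1)] W(3) a_def of_nat_diff)
  qed
  have "real (card ?P) = (\<Sum>W\<in>?W. real (card (W - A)))"
    using finW C by (subst card_SigmaI) (auto simp: above_def fsubD intro: finite_subset)
  also have "\<dots> = real (card ?W) * (?R ^ (a + Suc w) - ?R ^ a)" using cardW by simp
  finally have c1: "real (card ?P) = real (card ?W) * (?R ^ (a + Suc w) - ?R ^ a)" .
  have finP: "finite ?P" using finW C by (intro finite_SigmaI) (auto simp: above_def fsubD intro: finite_subset)
  have fibeq: "{p \<in> ?P. snd p = v} = (\<lambda>W. (W, v)) ` above (span (insert v A)) (span (insert v B)) C w"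
    if "v \<in> C - B" for v
    using that Suc.prems by (auto simp: above_insert[OF C Suc.prems(1-4) that])
  have c2: "real (card ?P) * q ^ (w * e) = real (card (C - B)) * qbinom q (c - Suc b) w"
  proof (rule card_by_fibers(2)[where f = snd])
    show "finite (C - B)" using C by (simp add: fsubD)
    show "snd ` ?P \<subseteq> C - B" by (auto simp: above_def)
    fix v assume v: "v \<in> C - B"
    show "finite {p \<in> ?P. snd p = v}" using finP by simp
    have "card {p \<in> ?P. snd p = v} = card (above (span (insert v A)) (span (insert v B)) C w)"
      unfolding fibeq[OF v] by (rule card_image) (auto simp: inj_on_def)
    moreover have d: "dim (span (insert v A)) = Suc a" "dim (span (insert v B)) = Suc b"
      using v Suc.prems A B dim_span_insert by (auto simp: a_def b_def)
    have "real (card (above (span (insert v A)) (span (insert v B)) C w))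
        * q ^ (w * (dim C - dim (span (insert v A)) - w)) = qbinom q (dim C - dim (span (insert v B))) w"
    proof (rule Suc.IH)
      show "span (insert v A) \<subseteq> span (insert v B)" using Suc.prems by (intro span_mono) auto
      show "span (insert v B) \<subseteq> C" using v Suc.prems C by (intro span_insert_least) (auto simp: fsubD)
      show "dim (span (insert v B)) + w \<le> dim C" using d le by (simp add: c_def)
    qed auto
    hence "real (card (above (span (insert v A)) (span (insert v B)) C w)) * q ^ (w * e)
        = qbinom q (c - Suc b) w" using d by (simp add: e_def c_def)
    ultimately show "real (card {p \<in> ?P. snd p = v}) * q ^ (w * e) = qbinom q (c - Suc b) w" by simp
  qed
  have c3: "real (card (C - B)) = ?R ^ c - ?R ^ b"
  proof -
    have "card (C - B) = card C - card B" using C B Suc.prems by (intro card_Diff_subset) (auto simp: fsubD)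
    moreover have "card B \<le> card C" using C Suc.prems by (intro card_mono) (auto simp: fsubD)
    ultimately show ?thesis by (simp add: card_fsub[OF B] card_fsub[OF C] b_def c_def of_nat_diff)
  qed
  define Z where "Z = qbinom q (c - b) (Suc w)"
  have "qbinom q (Suc (c - Suc b)) (Suc w) * qint q (Suc w) = qbinom q (c - Suc b) w * qint q (Suc (c - Suc b))"
    by (rule qbinom_Suc_Suc[OF q_pos])
  moreover have sc: "Suc (c - Suc b) = c - b" using le by simp
  ultimately have "Z * (qint q (Suc w) * (1 - q)) = qbinom q (c - Suc b) w * (qint q (c - b) * (1 - q))"
    by (simp add: Z_def)
  hence Z: "Z * (1 - q ^ Suc w) = qbinom q (c - Suc b) w * (1 - q ^ (c - b))"
    by (simp only: qint_mult)
  have p1: "(?R ^ (a + Suc w) - ?R ^ a) * q ^ (a + Suc w) = 1 - q ^ Suc w"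
    using card_power_diff[of a "a + Suc w"] by (simp del: power_Suc)
  have p2: "(?R ^ c - ?R ^ b) * q ^ c = 1 - q ^ (c - b)"
    using card_power_diff[of b c] le by simp
  have ce: "c = a + Suc w + e" using le by (simp add: e_def)
  have "real (card ?W) * q ^ (Suc w * e) * (1 - q ^ Suc w)
      = real (card ?P) * q ^ (w * e) * q ^ e * q ^ (a + Suc w)"
    by (simp only: c1 p1[symmetric] mult_Suc power_add) (simp only: mult_ac)
  also have "\<dots> = qbinom q (c - Suc b) w * ((?R ^ c - ?R ^ b) * q ^ c)"
    unfolding c2 c3 using arg_cong[OF ce, of "power q"] by (simp only: power_add mult_ac)
  also have "\<dots> = Z * (1 - q ^ Suc w)" by (simp only: p2 Z)
  finally have "real (card ?W) * q ^ (Suc w * e) * (1 - q ^ Suc w) = Z * (1 - q ^ Suc w)" .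
  moreover have "q ^ Suc w < 1" using q_pos q_less_1 by (intro power_Suc_less_one) auto
  ultimately have "real (card ?W) * q ^ (Suc w * e) = Z" by simp
  thus ?case by (simp add: Z_def a_def b_def c_def e_def)
qed

text \<open>\<open>w t\<close> is the growth of \<open>W \<inter> G i\<close> from
  \<open>i = t\<close> to \<open>Suc t\<close>. Everything is relative to \<open>G 0\<close>, which
  is the image of a nilpotent map in one application and zero in the other.\<close>

definition meeting :: "(nat \<Rightarrow> 'b set) \<Rightarrow> nat \<Rightarrow> (nat \<Rightarrow> nat) \<Rightarrow> 'b set set"
  where "meeting G m w = {W. subspace W \<and> G 0 \<subseteq> W \<and> W \<subseteq> G m \<and>
    (\<forall>i\<le>m. dim (W \<inter> G i) = dim (G 0) + (\<Sum>t<i. w t))}"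

lemma finite_meeting: "finite (G m) \<Longrightarrow> finite (meeting G m w)"
  by (rule finite_subset[of _ "Pow (G m)"]) (auto simp: meeting_def)

lemma chain_mono:
  assumes "\<And>i. i < m \<Longrightarrow> (G i :: 'c set) \<subseteq> G (Suc i)" "i \<le> j" "j \<le> m"
  shows "G i \<subseteq> G j"
  using assms(2,3)
proof (induction j rule: dec_induct)
  case (step j)
  thus ?case using assms(1)[of j] by simp
qed simp

text \<open>The map sending \<open>W\<close> to \<open>W \<inter> G m\<close> has sets of the form
  \<open>above\<close> as fibres, so each step of the flag contributes one binomial. The sum of the
  differences \<open>g t - w t\<close> up to \<open>i\<close> is the codimension of
  \<open>W \<inter> G (Suc i)\<close> in \<open>G (Suc i)\<close>.\<close>

lemma card_meeting:
  assumes "\<And>i. i \<le> m \<Longrightarrow> subspace (G i)" "finite (G m)" "\<And>i. i < m \<Longrightarrow> G i \<subseteq> G (Suc i)"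
    and "\<And>i. i < m \<Longrightarrow> w i \<le> g i" "\<And>i. i \<le> m \<Longrightarrow> dim (G i) = dim (G 0) + (\<Sum>t<i. g t)"
  shows "real (card (meeting G m w)) * q ^ (\<Sum>i<m. w i * (\<Sum>t\<le>i. g t - w t)) = (\<Prod>i<m. qbinom q (g i) (w i))"
  using assms
proof (induction m)
  case 0
  have "meeting G 0 w = {G 0}" using 0(1) by (auto simp: meeting_def Int_absorb1 intro: antisym)
  thus ?case by simp
next
  case (Suc m)
  have C: "fsub (G (Suc m))" using Suc.prems by (simp add: fsub_def)
  have fin: "finite (G m)" using Suc.prems(2,3) finite_subset by blast
  have mono: "G i \<subseteq> G m" if "i \<le> m" for i
    using chain_mono[of m G i m] Suc.prems(3) that by simp
  let ?S = "\<Sum>i<m. w i * (\<Sum>t\<le>i. g t - w t)" and ?e = "w m * (\<Sum>t\<le>m. g t - w t)"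
  have eq: "{W \<in> meeting G (Suc m) w. W \<inter> G m = W'} = above W' (G m) (G (Suc m)) (w m)"
    if W': "W' \<in> meeting G m w" for W'
  proof -
    have dW': "dim W' = dim (G 0) + (\<Sum>t<m. w t)" and W'm: "W' \<inter> G m = W'"
      using W' by (auto simp: meeting_def Int_absorb2)
    show ?thesis
    proof (intro equalityI subsetI)
      fix W assume "W \<in> {W \<in> meeting G (Suc m) w. W \<inter> G m = W'}"
      thus "W \<in> above W' (G m) (G (Suc m)) (w m)"
        using dW' by (auto simp: meeting_def above_def Int_absorb2 dest!: spec[of _ "Suc m"])
    next
      fix W assume "W \<in> above W' (G m) (G (Suc m)) (w m)"
      hence W: "subspace W" "W' \<subseteq> W" "W \<subseteq> G (Suc m)" "W \<inter> G m = W'" "dim W = dim W' + w m"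
        by (auto simp: above_def)
      have "dim (W \<inter> G i) = dim (G 0) + (\<Sum>t<i. w t)" if "i \<le> Suc m" for i
      proof (cases "i = Suc m")
        case True
        thus ?thesis using W dW' by (simp add: Int_absorb2)
      next
        case False
        hence "W \<inter> G i = W' \<inter> G i" using W mono[of i] that by auto
        thus ?thesis using W' False that by (simp add: meeting_def)
      qed
      thus "W \<in> {W \<in> meeting G (Suc m) w. W \<inter> G m = W'}"
        using W W' by (auto simp: meeting_def)
    qed
  qed
  have "real (card (meeting G (Suc m) w)) * q ^ ?e = real (card (meeting G m w)) * qbinom q (g m) (w m)"
  proof (rule card_by_fibers(2)[where f = "\<lambda>W. W \<inter> G m"])
    show "finite (meeting G m w)" using fin by (rule finite_meeting)
    show "(\<lambda>W. W \<inter> G m) ` meeting G (Suc m) w \<subseteq> meeting G m w"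
    proof clarify
      fix W assume W: "W \<in> meeting G (Suc m) w"
      have "W \<inter> G m \<inter> G i = W \<inter> G i" if "i \<le> m" for i using mono[OF that] by auto
      thus "W \<inter> G m \<in> meeting G m w"
        using W mono[of 0] Suc.prems(1)[of m] by (auto simp: meeting_def subspace_inter)
    qed
    fix W' assume W': "W' \<in> meeting G m w"
    show "finite {W \<in> meeting G (Suc m) w. W \<inter> G m = W'}"
      using Suc.prems by (simp add: finite_meeting)
    have dW': "dim W' = dim (G 0) + (\<Sum>t<m. w t)" and sub: "subspace W'" "W' \<subseteq> G m"
      using W' by (auto simp: meeting_def Int_absorb2)
    have dm: "dim (G m) = dim (G 0) + (\<Sum>t<m. g t)"
      and dSm: "dim (G (Suc m)) = dim (G 0) + (\<Sum>t<m. g t) + g m"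
      using Suc.prems(5)[of m] Suc.prems(5)[of "Suc m"] by simp_all
    have "(\<Sum>t\<le>m. g t - w t) = (\<Sum>t\<le>m. g t) - (\<Sum>t\<le>m. w t)"
      using Suc.prems(4) by (intro sum_subtractf_nat) auto
    hence "dim (G (Suc m)) - dim W' - w m = (\<Sum>t\<le>m. g t - w t)"
      by (simp add: dSm dW' lessThan_Suc_atMost[symmetric])
    moreover have "dim (G (Suc m)) - dim (G m) = g m" using dm dSm by simp
    moreover have "real (card (above W' (G m) (G (Suc m)) (w m)))
        * q ^ (w m * (dim (G (Suc m)) - dim W' - w m)) = qbinom q (dim (G (Suc m)) - dim (G m)) (w m)"
      by (rule card_above[OF C]) (use sub Suc.prems(1-4) dm dSm in auto)
    ultimately show "real (card {W \<in> meeting G (Suc m) w. W \<inter> G m = W'}) * q ^ ?e = qbinom q (g m) (w m)"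
      by (simp only: eq[OF W'])
  qed
  moreover have "real (card (meeting G m w)) * q ^ ?S = (\<Prod>i<m. qbinom q (g i) (w i))"
    by (rule Suc.IH[OF Suc.prems(1) fin Suc.prems(3-5)]) simp_all
  moreover have "real (card (meeting G (Suc m) w)) * q ^ (\<Sum>i<Suc m. w i * (\<Sum>t\<le>i. g t - w t))
      = real (card (meeting G (Suc m) w)) * q ^ ?e * q ^ ?S"
    by (simp add: power_add)
  ultimately show ?case by simp
qed

end

subsection \<open>Counting linear extensions\<close>

context finite_field_space
begin

text \<open>Linear maps on a subspace \<open>B\<close>, as extensional functions, so that maps
  agreeing on \<open>B\<close> are equal and can be counted. Asking for a linear extension avoids a
  separate notion of linearity on subspaces.\<close>

definition Lin :: "'b set \<Rightarrow> ('b \<Rightarrow> 'b) set"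
  where "Lin B = {restrict g B | g. lin g}"

lemma LinE:
  assumes "g \<in> Lin B" obtains f where "lin f" "g = restrict f B"
  using assms by (auto simp: Lin_def)

lemma LinI: "lin f \<Longrightarrow> restrict f B \<in> Lin B"
  by (auto simp: Lin_def)

lemma restrict_Lin: "g \<in> Lin B \<Longrightarrow> A \<subseteq> B \<Longrightarrow> restrict g A \<in> Lin A"
  by (auto simp: Lin_def restrict_restrict Int_absorb1)

lemma restrict_eq_iff: "restrict f A = restrict g A \<longleftrightarrow> (\<forall>x\<in>A. f x = g x)"
  by (auto simp: restrict_def fun_eq_iff)

lemma Lin_diff: "g \<in> Lin B \<Longrightarrow> subspace B \<Longrightarrow> x \<in> B \<Longrightarrow> y \<in> B \<Longrightarrow> g (x - y) = g x - g y"
  by (auto simp: Lin_def lin_diff subspace_diff)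

lemma Lin_scale: "g \<in> Lin B \<Longrightarrow> subspace B \<Longrightarrow> x \<in> B \<Longrightarrow> g (c *s x) = c *s g x"
  by (auto simp: Lin_def lin_scale subspace_scale)

lemma Lin_eqI:
  assumes "g \<in> Lin B" "h \<in> Lin B" "\<And>x. x \<in> B \<Longrightarrow> g x = h x" shows "g = h"
  using assms by (auto simp: Lin_def restrict_def fun_eq_iff)

lemma lin_extend_insert:
  assumes f: "lin f" and A: "subspace A" and v: "v \<notin> A"
  obtains h where "lin h" "\<And>a. a \<in> A \<Longrightarrow> h a = f a" "h v = y"
proof -
  interpret vector_space_pair scale scale by unfold_locales
  obtain B where B: "B \<subseteq> A" "independent B" "A \<subseteq> span B"
    by (rule basis_exists[of A])
  have sB: "span B = A" using B A by (intro span_subspace) auto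
  have "independent (insert v B)" using B(2) v sB by (simp add: independent_insertI)
  then obtain h where h: "Vector_Spaces.linear scale scale h"
    "\<forall>x\<in>insert v B. h x = (if x = v then y else f x)"
    using linear_independent_extend[of "insert v B" "\<lambda>x. if x = v then y else f x"] by blast
  have "h a = f a" if "a \<in> A" for a
  proof (rule linear_eq_on[OF h(1)])
    show "Vector_Spaces.linear scale scale f" using f by (simp add: lin_iff_linear)
    show "a \<in> span B" using that sB by simp
    show "h b = f b" if "b \<in> B" for b using h(2) that v B by auto
  qed
  thus thesis using that[of h] h by (auto simp: lin_iff_linear)
qed

lemma Lin_eq_on_span_insert:
  assumes "lin f" "lin g" "fsub A" "\<And>a. a \<in> A \<Longrightarrow> f a = g a" "f v = g v" "x \<in> span (insert v A)"
  shows "f x = g x"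
proof -
  obtain k where "x - k *s v \<in> A" using assms(3,6) span_insert_fsub by auto
  hence "f (x - k *s v) = g (x - k *s v)" using assms(4) by blast
  thus ?thesis using assms by (simp add: lin_diff lin_scale)
qed

lemma restrict_span_insert_iff:
  assumes "g \<in> Lin B" "lin h" "fsub A" "span (insert v A) \<subseteq> B"
  shows "restrict g (span (insert v A)) = restrict h (span (insert v A)) \<longleftrightarrow>
    restrict g A = restrict h A \<and> g v = h v"
proof -
  obtain g' where g': "lin g'" "g = restrict g' B" using assms(1) by (rule LinE)
  have sub: "insert v A \<subseteq> span (insert v A)" by (rule span_superset)
  have gg': "g x = g' x" if "x \<in> span (insert v A)" for x using that assms(4) g' by auto
  show ?thesis
    unfolding restrict_eq_iff
  proof safe
    fix x assume *: "\<forall>a\<in>A. g a = h a" "g v = h v" "x \<in> span (insert v A)"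
    have "g' x = h x"
      by (rule Lin_eq_on_span_insert[OF g'(1) assms(2,3) _ _ *(3)]) (use * sub gg' in \<open>auto simp: subset_iff\<close>)
    thus "g x = h x" using gg' * by simp
  qed (use sub in auto)
qed

section \<open>Extensions of a linear map to a larger subspace\<close>

definition extensions :: "'b set \<Rightarrow> ('b \<Rightarrow> 'b) \<Rightarrow> 'b set \<Rightarrow> ('b \<Rightarrow> 'b) set"
  where "extensions A f B = {g \<in> Lin B. restrict g A = restrict f A}"

lemma extensions_self: "lin f \<Longrightarrow> extensions A f A = {restrict f A}"
  by (auto simp: extensions_def Lin_def restrict_restrict)

lemma extensions_insert:
  assumes "lin h" "fsub A" "span (insert v A) \<subseteq> B" "\<And>a. a \<in> A \<Longrightarrow> h a = f a"
  shows "extensions (span (insert v A)) h B = {g \<in> extensions A f B. g v = h v}"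
proof -
  have "restrict h A = restrict f A" using assms(4) by (auto simp: restrict_def)
  thus ?thesis using restrict_span_insert_iff[OF _ assms(1-3)] by (auto simp: extensions_def)
qed

text \<open>Since \<open>B = A + X\<close>, a basis of a complement of \<open>A\<close> in
  \<open>B\<close> can be chosen inside \<open>X\<close>, and its images are arbitrary vectors of
  \<open>Y\<close>. The hypothesis on \<open>A \<inter> X\<close> ensures that the rest of
  \<open>X\<close> is mapped into \<open>Y\<close> as well.\<close>

lemma card_extensions:
  assumes B: "fsub B" and Y: "fsub Y" and X: "subspace X" "X \<subseteq> B"
    and "subspace A" "A \<subseteq> B" "\<And>b. b \<in> B \<Longrightarrow> \<exists>a\<in>A. \<exists>x\<in>X. b = a + x"
    and "lin f" "f ` (A \<inter> X) \<subseteq> Y"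
  shows "card {g \<in> extensions A f B. g ` X \<subseteq> Y} = card Y ^ (dim B - dim A)"
  using assms(5-)
proof (induction "dim B - dim A" arbitrary: A f)
  case 0
  have "dim A \<le> dim B" using dim_mono[OF B] 0 by simp
  hence "A = B" using 0 by (intro fsub_dim_eqI[OF B]) auto
  moreover have "f ` X \<subseteq> Y" using 0 X \<open>A = B\<close> by (simp add: Int_absorb1)
  ultimately have "{g \<in> extensions A f B. g ` X \<subseteq> Y} = {restrict f B}"
    using 0 X by (auto simp: extensions_self image_subset_iff subset_iff)
  thus ?case using 0(1) by simp
next
  case (Suc k)
  have A: "fsub A" using fsub_subset[OF B] Suc.prems by blast
  obtain v where v: "v \<in> X" "v \<notin> A"
  proof (rule ccontr)
    assume "\<not> thesis"
    hence "X \<subseteq> A" using that by blast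
    hence "B \<subseteq> A" using Suc.prems(1,3) by (auto dest!: Suc.prems(3) intro!: subspace_add)
    thus False using Suc.prems Suc.hyps(2) by (metis antisym diff_self_eq_0 nat.distinct(1))
  qed
  let ?A = "span (insert v A)" and ?S = "{g \<in> extensions A f B. g ` X \<subseteq> Y}"
  have AB: "?A \<subseteq> B" using Suc.prems v X B by (intro span_insert_least) (auto simp: fsubD)
  have d: "k = dim B - dim ?A" using dim_span_insert[OF A v(2)] Suc.hyps(2) by simp
  have "card ?S = card Y * card Y ^ k"
  proof (rule card_by_fibers_nat(2)[where f = "\<lambda>g. g v"])
    show "finite Y" using Y by (simp add: fsubD)
    thus "0 < card Y ^ k" using zero_in_fsub[OF Y] by (auto simp: card_gt_0_iff)
    show "(\<lambda>g. g v) ` ?S \<subseteq> Y" using v by auto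
    fix y assume y: "y \<in> Y"
    obtain h where h: "lin h" "\<And>a. a \<in> A \<Longrightarrow> h a = f a" "h v = y"
      using lin_extend_insert[OF Suc.prems(4,1) v(2), of y] by blast
    have "{g \<in> ?S. g v = y} = {g \<in> extensions ?A h B. g ` X \<subseteq> Y}"
      using extensions_insert[OF h(1) A AB h(2)] h(3) by auto
    moreover have "card {g \<in> extensions ?A h B. g ` X \<subseteq> Y} = card Y ^ (dim B - dim ?A)"
    proof (rule Suc.hyps(1)[OF d _ AB _ h(1)])
      fix b assume "b \<in> B"
      then obtain a x where "a \<in> A" "x \<in> X" "b = a + x" using Suc.prems(3) by blast
      thus "\<exists>a\<in>?A. \<exists>x\<in>X. b = a + x" using span_superset[of "insert v A"] by blast
    next
      show "h ` (?A \<inter> X) \<subseteq> Y"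
      proof clarify
        fix x assume x: "x \<in> ?A" "x \<in> X"
        then obtain c where c: "x - c *s v \<in> A" using span_insert_fsub[OF A] by auto
        \<comment> \<open>As \<open>v\<close> was taken from \<open>X\<close>, the remainder lies in
          \<open>A \<inter> X\<close>, where the values are already known to be in
          \<open>Y\<close>.\<close>
        have "x - c *s v \<in> X" using x v X by (auto intro!: subspace_diff subspace_scale)
        hence "h (x - c *s v) \<in> Y" using c h(2) Suc.prems(5) by auto
        moreover have "h x = h (x - c *s v) + c *s y" by (simp add: lin_diff lin_scale h)
        ultimately show "h x \<in> Y" using Y y by (auto simp: fsubD intro!: subspace_add subspace_scale)
      qed
    qed simp
    ultimately show "card {g \<in> ?S. g v = y} = card Y ^ k" using d by simp
  qed
  thus ?case by (simp flip: Suc.hyps(2))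
qed

text \<open>These extensions induce injective maps from \<open>B / A\<close> to \<open>Z / Y\<close>.\<close>

definition inj_extensions :: "'b set \<Rightarrow> ('b \<Rightarrow> 'b) \<Rightarrow> 'b set \<Rightarrow> 'b set \<Rightarrow> 'b set \<Rightarrow> ('b \<Rightarrow> 'b) set"
  where "inj_extensions A f B Y Z = {g \<in> extensions A f B. g ` B \<subseteq> Z \<and> {b \<in> B. g b \<in> Y} = A}"

text \<open>If \<open>g v = y\<close> with \<open>y\<close> outside \<open>Y\<close>, then the
  induced map on \<open>B / A\<close> is injective exactly if it stays injective after dividing by
  the lines of \<open>v\<close> and \<open>y\<close> on the two sides.\<close>

lemma inj_extensions_insert:
  assumes B: "fsub B" and A: "fsub A" "A \<subseteq> B" and Z: "fsub Z" and Y: "fsub Y" "Y \<subseteq> Z"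
    and f: "f ` A \<subseteq> Y" and v: "v \<in> B" "v \<notin> A" and y: "y \<in> Z" "y \<notin> Y"
    and h: "lin h" "\<And>a. a \<in> A \<Longrightarrow> h a = f a" "h v = y"
  shows "inj_extensions (span (insert v A)) h B (span (insert y Y)) Z = {g \<in> inj_extensions A f B Y Z. g v = y}"
proof -
  let ?A = "span (insert v A)" and ?Y = "span (insert y Y)"
  have AB: "?A \<subseteq> B" using v A B by (intro span_insert_least) (auto simp: fsubD)
  have key: "{b \<in> B. g b \<in> ?Y} = ?A \<longleftrightarrow> {b \<in> B. g b \<in> Y} = A"
    if g: "g \<in> extensions A f B" "g v = y" for g
  proof -
    have gL: "g \<in> Lin B" and gA: "\<And>a. a \<in> A \<Longrightarrow> g a = f a"
      using g by (auto simp: extensions_def restrict_eq_iff)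
    have sB: "subspace B" using B by (simp add: fsubD)
    have gc: "g (b - c *s v) = g b - c *s y" if "b \<in> B" for b c
      using that v sB gL g(2) by (simp add: Lin_diff Lin_scale subspace_scale)
    have bc: "b - c *s v \<in> B" if "b \<in> B" for b c
      using that v sB by (auto intro!: subspace_diff subspace_scale)
    note iA = span_insert_fsub[OF A(1), of v] and iY = span_insert_fsub[OF Y(1), of y]
    show ?thesis
    proof
      assume L: "{b \<in> B. g b \<in> ?Y} = ?A"
      show "{b \<in> B. g b \<in> Y} = A"
      proof (intro equalityI subsetI)
        fix b assume b: "b \<in> {b \<in> B. g b \<in> Y}"
        hence "b \<in> ?A" using L span_superset[of "insert y Y"] by auto
        then obtain c where c: "b - c *s v \<in> A" using iA by auto
        hence "g b - c *s y \<in> Y" using gc[of b c] b gA f by auto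
        hence cy: "c *s y \<in> Y"
          using b subspace_diff[OF fsubD(1)[OF Y(1)], of "g b" "g b - c *s y"] by simp
        have "c = 0"
        proof (rule ccontr)
          assume "c \<noteq> 0"
          hence "y = inverse c *s (c *s y)" by simp
          thus False using y(2) subspace_scale[OF fsubD(1)[OF Y(1)] cy, of "inverse c"] by simp
        qed
        thus "b \<in> A" using c by simp
      qed (use A f gA in auto)
    next
      assume R: "{b \<in> B. g b \<in> Y} = A"
      show "{b \<in> B. g b \<in> ?Y} = ?A"
      proof (intro equalityI subsetI)
        fix b assume b: "b \<in> {b \<in> B. g b \<in> ?Y}"
        then obtain c where "g b - c *s y \<in> Y" using iY by auto
        hence "b - c *s v \<in> A" using R gc[of b c] bc[of b c] b by auto
        thus "b \<in> ?A" using iA by auto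
      next
        fix b assume b: "b \<in> ?A"
        then obtain c where "b - c *s v \<in> A" using iA by auto
        hence "g (b - c *s v) \<in> Y" using gA f by auto
        hence "g b - c *s y \<in> Y" using gc[of b c] b AB by auto
        thus "b \<in> {b \<in> B. g b \<in> ?Y}" using iY b AB by auto
      qed
    qed
  qed
  have "g \<in> inj_extensions ?A h B ?Y Z \<longleftrightarrow> g \<in> {g \<in> inj_extensions A f B Y Z. g v = y}" for g
  proof (cases "g \<in> extensions A f B \<and> g v = y")
    case True
    thus ?thesis
      using key[of g] by (simp add: inj_extensions_def extensions_insert[OF h(1) A(1) AB h(2)] h(3))
  next
    case False
    thus ?thesis
      by (auto simp: inj_extensions_def extensions_insert[OF h(1) A(1) AB h(2)] h(3))
  qed
  thus ?thesis by blast
qed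

lemma finite_funcset_Lin: "finite B \<Longrightarrow> finite Z \<Longrightarrow> finite {g \<in> Lin B. g ` B \<subseteq> Z}"
  by (rule finite_subset[OF _ finite_PiE[of B "\<lambda>_. Z"]])
    (auto simp: Lin_def PiE_def Pi_def extensional_def)

text \<open>The values on a basis of a complement of \<open>A\<close> must successively avoid
  \<open>Y\<close> and the span of the earlier values. With \<open>z = dim Z\<close>,
  \<open>y = dim Y\<close> and \<open>Q = 1/q\<close> this is the product of the factors
  \<open>Q^z - Q^(y+i)\<close>; pulling out \<open>Q^z\<close> leaves \<open>1 - q^(z-y-i)\<close>,
  a multiple of a \<open>q\<close>-integer.\<close>

lemma card_inj_extensions:
  assumes B: "fsub B" and Z: "fsub Z"
    and "subspace A" "A \<subseteq> B" "subspace Y" "Y \<subseteq> Z" "lin f" "f ` A \<subseteq> Y"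
    and "dim Y + (dim B - dim A) \<le> dim Z"
  shows "real (card (inj_extensions A f B Y Z)) * q ^ ((dim B - dim A) * dim Z)
      * qfact q (dim Z - dim Y - (dim B - dim A)) = (1 - q) ^ (dim B - dim A) * qfact q (dim Z - dim Y)"
  using assms(3-)
proof (induction "dim B - dim A" arbitrary: A f Y)
  case 0
  have "dim A \<le> dim B" using dim_mono[OF B] 0 by simp
  hence "A = B" using 0 by (intro fsub_dim_eqI[OF B]) auto
  moreover have "f ` B \<subseteq> Z" "{b \<in> B. f b \<in> Y} = B" using 0 \<open>A = B\<close> by auto
  ultimately have "inj_extensions A f B Y Z = {restrict f B}"
    using 0 by (auto simp: inj_extensions_def extensions_self)
  thus ?case by (simp flip: 0(1))
next
  case (Suc k)
  let ?R = "real CARD('a)"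
  have A: "fsub A" using fsub_subset[OF B] Suc.prems by blast
  have Y: "fsub Y" using fsub_subset[OF Z] Suc.prems by blast
  have "A \<noteq> B" using Suc.hyps(2) by auto
  then obtain v where v: "v \<in> B" "v \<notin> A" using Suc.prems by blast
  let ?A = "span (insert v A)" and ?S = "inj_extensions A f B Y Z"
  define y z where "y = dim Y" and "z = dim Z"
  have AB: "?A \<subseteq> B" using Suc.prems v B by (intro span_insert_least) (auto simp: fsubD)
  have d: "k = dim B - dim ?A" using dim_span_insert[OF A v(2)] Suc.hyps(2) by simp
  have le: "y + Suc k \<le> z" using Suc.prems(7) by (simp add: y_def z_def flip: Suc.hyps(2))
  have finS: "finite ?S"
    by (rule finite_subset[OF _ finite_funcset_Lin[of B Z]])
      (use B Z in \<open>auto simp: inj_extensions_def extensions_def fsubD\<close>)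
  have e1: "real (card ?S) * (q ^ (k * z) * qfact q (z - Suc y - k))
      = real (card (Z - Y)) * ((1 - q) ^ k * qfact q (z - Suc y))"
  proof (rule card_by_fibers(2)[where f = "\<lambda>g. g v"])
    show "finite (Z - Y)" using Z by (simp add: fsubD)
    show "(\<lambda>g. g v) ` ?S \<subseteq> Z - Y"
    proof clarify
      fix g assume g: "g \<in> ?S"
      hence "g v \<notin> Y" using v by (auto simp: inj_extensions_def)
      thus "g v \<in> Z - Y" using g v by (auto simp: inj_extensions_def)
    qed
    fix u assume u: "u \<in> Z - Y"
    show "finite {g \<in> ?S. g v = u}" using finS by simp
    obtain h where h: "lin h" "\<And>a. a \<in> A \<Longrightarrow> h a = f a" "h v = u"
      using lin_extend_insert[OF Suc.prems(5,1) v(2), of u] by blast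
    let ?Y = "span (insert u Y)"
    have dY: "dim ?Y = Suc y" using dim_span_insert[OF Y] u by (simp add: y_def)
    have "{g \<in> ?S. g v = u} = inj_extensions ?A h B ?Y Z"
      using u v Suc.prems by (intro inj_extensions_insert[OF B A _ Z Y, symmetric] h) auto
    moreover have "real (card (inj_extensions ?A h B ?Y Z)) * q ^ ((dim B - dim ?A) * dim Z)
        * qfact q (dim Z - dim ?Y - (dim B - dim ?A)) = (1 - q) ^ (dim B - dim ?A) * qfact q (dim Z - dim ?Y)"
    proof (rule Suc.hyps(1)[OF d _ AB _ _ h(1)])
      show "?Y \<subseteq> Z" using u Suc.prems Z by (intro span_insert_least) (auto simp: fsubD)
      show "dim ?Y + (dim B - dim ?A) \<le> dim Z" unfolding dY d[symmetric] using le by (simp add: z_def)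
      show "h ` ?A \<subseteq> ?Y"
      proof clarify
        fix x assume x: "x \<in> ?A"
        then obtain c where c: "x - c *s v \<in> A" using span_insert_fsub[OF A] by auto
        have "h x - c *s u = h (x - c *s v)" by (simp add: lin_diff lin_scale h)
        also have "\<dots> \<in> Y" using c h(2) Suc.prems(6) by auto
        finally show "h x \<in> ?Y" using span_insert_fsub[OF Y] by auto
      qed
    qed auto
    hence "real (card (inj_extensions ?A h B ?Y Z)) * q ^ (k * z)
        * qfact q (z - Suc y - k) = (1 - q) ^ k * qfact q (z - Suc y)"
      unfolding dY z_def d .
    ultimately show "real (card {g \<in> ?S. g v = u}) * (q ^ (k * z) * qfact q (z - Suc y - k))
        = (1 - q) ^ k * qfact q (z - Suc y)" by simp
  qed
  have e2: "real (card (Z - Y)) * q ^ z = (1 - q) * qint q (z - y)"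
  proof -
    have "card (Z - Y) = card Z - card Y" using Z Y Suc.prems by (intro card_Diff_subset) (auto simp: fsubD)
    moreover have "card Y \<le> card Z" using Z Suc.prems by (intro card_mono) (auto simp: fsubD)
    ultimately have "real (card (Z - Y)) = ?R ^ z - ?R ^ y"
      by (simp add: card_fsub[OF Y] card_fsub[OF Z] y_def z_def of_nat_diff)
    thus ?thesis using card_power_diff[of y z] le qint_mult[of q "z - y"] by (simp add: mult.commute)
  qed
  have e3: "qfact q (z - y) = qfact q (z - Suc y) * qint q (z - y)"
    using qfact_Suc[of q "z - Suc y"] le by (simp add: Suc_diff_Suc)
  have e4: "z - y - Suc k = z - Suc y - k" by simp
  have "real (card ?S) * q ^ (Suc k * z) * qfact q (z - y - Suc k)
      = q ^ z * (real (card ?S) * (q ^ (k * z) * qfact q (z - Suc y - k)))"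
    by (simp add: e4 power_add)
  also have "\<dots> = (real (card (Z - Y)) * q ^ z) * ((1 - q) ^ k * qfact q (z - Suc y))"
    unfolding e1 by (simp only: mult_ac)
  also have "\<dots> = (1 - q) ^ Suc k * qfact q (z - y)"
    unfolding e2 e3 by simp
  finally have "real (card ?S) * q ^ (Suc k * z) * qfact q (z - y - Suc k)
      = (1 - q) ^ Suc k * qfact q (z - y)" .

  thus ?case by (simp only: y_def z_def Suc.hyps(2))
qed

text \<open>The map is extended from \<open>A + H i\<close> to \<open>A + H (Suc i)\<close> one step
  at a time, each step being an instance of \<open>card_extensions\<close> with
  \<open>X = H (Suc i)\<close> and target \<open>Y i\<close>.\<close>

lemma card_chain_extensions:
  assumes A: "fsub A" and f: "lin f"
    and "\<And>i. i \<le> k \<Longrightarrow> fsub (H i)" "\<And>i. i < k \<Longrightarrow> H i \<subseteq> H (Suc i)" "H 0 = {0}"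
    and "\<And>i. i < k \<Longrightarrow> fsub (Y i)" "\<And>i. Suc i < k \<Longrightarrow> Y i \<subseteq> Y (Suc i)"
    and "\<And>i. i < k \<Longrightarrow> f ` (A \<inter> H (Suc i)) \<subseteq> Y i"
  defines "B \<equiv> \<lambda>i. {a + h | a h. a \<in> A \<and> h \<in> H i}"
  shows "card {g \<in> extensions A f (B k). \<forall>i<k. g ` H (Suc i) \<subseteq> Y i}
    = (\<Prod>i<k. card (Y i) ^ (dim (B (Suc i)) - dim (B i)))"
  using assms(3-8)
proof (induction k)
  case 0
  have "B 0 = A" using 0 by (auto simp: B_def)
  thus ?case by (simp add: extensions_self[OF f])
next
  case (Suc k)
  let ?S = "\<lambda>k. {g \<in> extensions A f (B k). \<forall>i<k. g ` H (Suc i) \<subseteq> Y i}"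
  have fB: "fsub (B i)" if "i \<le> Suc k" for i
    unfolding B_def using dim_sum(1)[OF A Suc.prems(1)[OF that]] .
  have AB: "A \<subseteq> B i" if "i \<le> Suc k" for i
    using zero_in_fsub[OF Suc.prems(1)[OF that]] unfolding B_def by force
  have HB: "H i \<subseteq> B i" if "i \<le> Suc k" for i
    using zero_in_fsub[OF A] unfolding B_def by force
  have BB: "B k \<subseteq> B (Suc k)" using Suc.prems(2)[of k] unfolding B_def by blast
  have Hm: "H i \<subseteq> H k" if "i \<le> k" for i
    using chain_mono[of k H i k] Suc.prems(2) that by simp
  have IH: "card (?S k) = (\<Prod>i<k. card (Y i) ^ (dim (B (Suc i)) - dim (B i)))"
    by (rule Suc.IH) (use Suc.prems in auto)
  have pos: "0 < card (Y i)" if "i < Suc k" for i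
    using Suc.prems(4)[OF that] zero_in_fsub by (auto simp: card_gt_0_iff fsubD)
  have fin: "finite (?S k)"
    by (rule card_ge_0_finite) (use IH pos in \<open>auto intro!: prod_pos\<close>)
  have "card (?S (Suc k)) = card (?S k) * card (Y k) ^ (dim (B (Suc k)) - dim (B k))"
  proof (rule card_by_fibers_nat(2)[where f = "\<lambda>g. restrict g (B k)"])
    show "finite (?S k)" by (rule fin)
    show "0 < card (Y k) ^ (dim (B (Suc k)) - dim (B k))" using pos by simp
    show "(\<lambda>g. restrict g (B k)) ` ?S (Suc k) \<subseteq> ?S k"
    proof clarify
      fix g assume g: "g \<in> extensions A f (B (Suc k))" "\<forall>i<Suc k. g ` H (Suc i) \<subseteq> Y i"
      have "restrict g (B k) \<in> extensions A f (B k)"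
        using g(1) restrict_Lin[OF _ BB] AB[of k]
        by (auto simp: extensions_def restrict_restrict Int_absorb1)
      moreover have "H (Suc i) \<subseteq> B k" if "i < k" for i
        using Hm[of "Suc i"] HB[of k] that by auto
      ultimately show "restrict g (B k) \<in> extensions A f (B k) \<and> (\<forall>i<k. restrict g (B k) ` H (Suc i) \<subseteq> Y i)"
        using g(2) by (auto simp: subset_iff image_iff)
    qed
    fix g' assume g': "g' \<in> ?S k"
    then obtain f' where f': "lin f'" "g' = restrict f' (B k)" by (auto simp: extensions_def elim: LinE)
    have eq: "{g \<in> ?S (Suc k). restrict g (B k) = g'} = {g \<in> extensions (B k) f' (B (Suc k)). g ` H (Suc k) \<subseteq> Y k}"
    proof (intro equalityI subsetI)
      fix g assume g: "g \<in> {g \<in> extensions (B k) f' (B (Suc k)). g ` H (Suc k) \<subseteq> Y k}"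
      hence gB: "g b = g' b" if "b \<in> B k" for b
        using that by (auto simp: extensions_def restrict_eq_iff f')
      have "g a = f a" if "a \<in> A" for a
        using that gB[of a] AB[of k] g' by (auto simp: extensions_def restrict_eq_iff)
      moreover have "g ` H (Suc i) \<subseteq> Y i" if "i < Suc k" for i
      proof (cases "i = k")
        case False
        hence i: "i < k" using that by simp
        have "g h = g' h" if "h \<in> H (Suc i)" for h
          using gB[of h] Hm[of "Suc i"] HB[of k] i that by auto
        thus ?thesis using g' i by (auto simp: image_subset_iff)
      qed (use g in auto)
      ultimately show "g \<in> {g \<in> ?S (Suc k). restrict g (B k) = g'}"
        using g by (auto simp: extensions_def f' restrict_eq_iff)
    qed (auto simp: extensions_def f')
    have "card {g \<in> extensions (B k) f' (B (Suc k)). g ` H (Suc k) \<subseteq> Y k}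
        = card (Y k) ^ (dim (B (Suc k)) - dim (B k))"
    proof (rule card_extensions[OF fB Suc.prems(4) _ _ _ BB _ f'(1)])
      show "subspace (H (Suc k))" "subspace (B k)" using Suc.prems(1)[of "Suc k"] fB[of k] by (auto simp: fsubD)
      show "H (Suc k) \<subseteq> B (Suc k)" by (rule HB) simp
      show "\<exists>a\<in>B k. \<exists>x\<in>H (Suc k). b = a + x" if "b \<in> B (Suc k)" for b
        using that AB[of k] unfolding B_def by force
      \<comment> \<open>Compatibility of the new condition with the values chosen before. Writing
        \<open>u = a + h\<close>, the part \<open>h\<close> is sent to an earlier, smaller
        \<open>Y\<close> (or is zero at the bottom), and \<open>a = u - h\<close> lies in
        \<open>A \<inter> H (Suc k)\<close>, where \<open>f\<close> satisfies the condition by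
        hypothesis.\<close>
      show "f' ` (B k \<inter> H (Suc k)) \<subseteq> Y k"
      proof clarify
        fix u assume u: "u \<in> B k" "u \<in> H (Suc k)"
        then obtain a h where ah: "u = a + h" "a \<in> A" "h \<in> H k" unfolding B_def by blast
        have hY: "g' h \<in> Y k"
        proof (cases k)
          case 0
          thus ?thesis using ah Suc.prems(3) f' zero_in_fsub[OF fB[of k]] zero_in_fsub[OF Suc.prems(4)[of k]]
            by simp
        next
          case (Suc j)
          hence "g' h \<in> Y j" using g' ah by auto
          thus ?thesis using Suc.prems(5)[of j] Suc by auto
        qed
        have mem: "a \<in> B k" "h \<in> B k" using ah AB[of k] HB[of k] by auto
        have "u - h \<in> H (Suc k)"
          using u ah Suc.prems(1)[of "Suc k"] Suc.prems(2)[of k] by (intro subspace_diff) (auto simp: fsubD)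
        hence "f a \<in> Y k" using ah Suc.prems(6)[of k] by auto
        moreover have "g' a = f a" using g' ah by (auto simp: extensions_def restrict_eq_iff)
        ultimately have "f' a \<in> Y k" "f' h \<in> Y k" using hY mem f' by auto
        thus "f' u \<in> Y k"
          using Suc.prems(4)[of k] by (simp add: ah lin_add[OF f'(1)] subspace_add fsubD)
      qed
    qed simp_all
    thus "card {g \<in> ?S (Suc k). restrict g (B k) = g'} = card (Y k) ^ (dim (B (Suc k)) - dim (B k))"
      by (simp only: eq)
  qed
  thus ?case by (simp add: IH)
qed

end

subsection \<open>Counting nilpotent maps\<close>

lemma funpow_cong_on:
  assumes "\<And>v. v \<in> V \<Longrightarrow> g v = h v" "h ` V \<subseteq> V" "v \<in> V"
  shows "(g ^^ r) v = (h ^^ r) v" "(h ^^ r) v \<in> V"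
proof -
  have "(g ^^ r) v = (h ^^ r) v \<and> (h ^^ r) v \<in> V"
    by (induction r) (use assms in auto)
  thus "(g ^^ r) v = (h ^^ r) v" "(h ^^ r) v \<in> V" by auto
qed

context finite_field_space
begin

definition kerp :: "('b \<Rightarrow> 'b) \<Rightarrow> 'b set \<Rightarrow> nat \<Rightarrow> 'b set"
  where "kerp g V r = {v \<in> V. (g ^^ r) v = 0}"

lemma kerp_subset: "kerp g V r \<subseteq> V"
  by (auto simp: kerp_def)

lemma kerp_cong:
  assumes "\<And>v. v \<in> V \<Longrightarrow> g v = h v" "h ` V \<subseteq> V" shows "kerp g V r = kerp h V r"
  using funpow_cong_on(1)[OF assms] by (auto simp: kerp_def)

lemma kerp_mono_set: "W \<subseteq> V \<Longrightarrow> kerp g W r = W \<inter> kerp g V r"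
  by (auto simp: kerp_def)

lemma subspace_kerp: "lin g \<Longrightarrow> subspace V \<Longrightarrow> subspace (kerp g V r)"
  unfolding kerp_def by (intro subspace_ker lin_funpow)

lemma fsub_kerp: "lin g \<Longrightarrow> fsub V \<Longrightarrow> fsub (kerp g V r)"
  unfolding kerp_def by (intro fsub_ker lin_funpow)

lemma kerp_mono:
  assumes "lin g" "r \<le> s" shows "kerp g V r \<subseteq> kerp g V s"
proof -
  have "(g ^^ s) v = (g ^^ (s - r)) ((g ^^ r) v)" for v
    using assms(2) funpow_add[of "s - r" r g] by simp
  thus ?thesis using lin_0[OF lin_funpow[OF assms(1), of "s - r"]] by (auto simp: kerp_def)
qed

lemma kerp_0 [simp]: "fsub V \<Longrightarrow> kerp g V 0 = {0}"
  by (auto simp: kerp_def zero_in_fsub)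

lemma kerp_Suc: "g v \<in> V \<Longrightarrow> v \<in> V \<Longrightarrow> v \<in> kerp g V (Suc r) \<longleftrightarrow> g v \<in> kerp g V r"
  by (auto simp: kerp_def funpow_Suc_right simp del: funpow.simps)

text \<open>The parts of \<open>lam\<close> are successive differences of kernel dimensions, so
  \<open>lam\<close> is conjugate to the partition of Jordan block sizes. Nilpotency is encoded in
  the kernel dimensions reaching \<open>dim V\<close>.\<close>

definition nilp :: "'b set \<Rightarrow> (nat \<Rightarrow> nat) \<Rightarrow> ('b \<Rightarrow> 'b) set"
  where "nilp V lam = {g \<in> Lin V. g ` V \<subseteq> V \<and> (\<forall>r. dim (kerp g V r) = (\<Sum>i<r. lam i))}"

lemma nilpE:
  assumes "g \<in> nilp V lam"
  obtains G where "lin G" "g = restrict G V" "G ` V \<subseteq> V" "\<And>r. kerp g V r = kerp G V r"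
    "\<And>r. dim (kerp G V r) = (\<Sum>i<r. lam i)"
proof -
  obtain G where G: "lin G" "g = restrict G V" using assms by (auto simp: nilp_def elim: LinE)
  have GV: "G ` V \<subseteq> V" using assms G by (auto simp: nilp_def)
  have "kerp g V r = kerp G V r" for r
    by (rule kerp_cong) (use G GV in auto)
  thus thesis using that[OF G GV] assms by (auto simp: nilp_def)
qed

lemma nilpI:
  assumes "lin G" "G ` V \<subseteq> V" "\<And>r. dim (kerp G V r) = (\<Sum>i<r. lam i)"
  shows "restrict G V \<in> nilp V lam"
proof -
  have "kerp (restrict G V) V r = kerp G V r" for r
    by (rule kerp_cong) (use assms in auto)
  thus ?thesis using assms by (auto simp: nilp_def LinI)
qed

lemma finite_nilp: "finite V \<Longrightarrow> finite (nilp V lam)"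
  by (rule finite_subset[OF _ finite_funcset_Lin[of V V]]) (auto simp: nilp_def)

lemma sum_truncate:
  fixes lam :: "nat \<Rightarrow> nat"
  shows "(\<Sum>i<r. if i < m then lam i else 0) = (\<Sum>i<min r m. lam i)"
proof -
  have "(\<Sum>i<r. if i < m then lam i else 0) = (\<Sum>i\<in>{..<r} \<inter> {..<m}. lam i)"
    by (simp add: sum.If_cases lessThan_def)
  moreover have "{..<r} \<inter> {..<m} = {..<min r m}" by auto
  ultimately show ?thesis by simp
qed

lemma sum_support:
  fixes lam :: "nat \<Rightarrow> nat"
  assumes "\<And>i. m \<le> i \<Longrightarrow> lam i = 0" "m \<le> r" shows "(\<Sum>i<r. lam i) = (\<Sum>i<m. lam i)"
  by (rule sum.mono_neutral_right) (use assms in auto)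

text \<open>On the kernel of the \<open>m\<close>-th power, the kernel of the \<open>r\<close>-th
  power is that of the power \<open>min r m\<close>, so the type is cut off after \<open>m\<close>
  parts.\<close>

lemma nilp_restrict:
  assumes V: "fsub V" and g: "g \<in> nilp V lam" and W: "W = kerp g V m"
  shows "restrict g W \<in> nilp W (\<lambda>i. if i < m then lam i else 0)" "dim W = (\<Sum>i<m. lam i)"
proof -
  obtain G where G: "lin G" "g = restrict G V" "G ` V \<subseteq> V" "\<And>r. kerp g V r = kerp G V r"
    and dk: "\<And>r. dim (kerp G V r) = (\<Sum>i<r. lam i)" using g by (rule nilpE) (rule that)
  have WV: "W \<subseteq> V" by (simp add: W kerp_subset)
  have GW: "G ` W \<subseteq> W"
  proof clarify
    fix v assume v: "v \<in> W"
    hence "v \<in> kerp G V (Suc m)" using kerp_mono[OF G(1), of m "Suc m" V] W G(4) by auto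
    moreover have "v \<in> V" "G v \<in> V" using v WV G(3) by auto
    ultimately show "G v \<in> W" using kerp_Suc[of G v V m] G(4) W by simp
  qed
  have "kerp G W r = kerp G V (min r m)" for r
    using kerp_mono[OF G(1), of r m V] kerp_mono[OF G(1), of m r V] kerp_mono_set[OF WV, of G r]
    by (cases "r \<le> m") (auto simp: min_def W G(4))
  hence "restrict G W \<in> nilp W (\<lambda>i. if i < m then lam i else 0)"
    using GW G(1) by (intro nilpI) (simp_all add: dk sum_truncate)
  thus "restrict g W \<in> nilp W (\<lambda>i. if i < m then lam i else 0)"
    using WV by (simp add: G(2) restrict_restrict Int_absorb1)
  show "dim W = (\<Sum>i<m. lam i)" by (simp add: W G(4) dk)
qed

text \<open>A map \<open>g\<close> with \<open>g\<^sup>m\<^sup>+\<^sup>2 = 0\<close> sends \<open>V\<close> to \<open>W = ker g\<^sup>m\<^sup>+\<^sup>1\<close>, and the induced map from \<open>V / W\<close> to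
  \<open>W / ker g\<^sup>m\<close> is injective; the shape of \<open>g\<close> and this condition determine each other.\<close>

lemma nilp_extension:
  assumes V: "fsub V" and W: "subspace W" "W \<subseteq> V" and f: "lin f" "f ` W \<subseteq> W"
    and dk: "\<And>r. dim (kerp f W r) = (\<Sum>i<min r (Suc m). lam i)"
    and lam: "\<And>i. Suc m < i \<Longrightarrow> lam i = 0" and dV: "dim V = (\<Sum>i<Suc (Suc m). lam i)"
    and dW: "dim W = (\<Sum>i<Suc m. lam i)"
  shows "{g \<in> nilp V lam. kerp g V (Suc m) = W \<and> restrict g W = restrict f W}
    = inj_extensions W f V (kerp f W m) W"
proof (intro equalityI subsetI)
  fix g assume "g \<in> {g \<in> nilp V lam. kerp g V (Suc m) = W \<and> restrict g W = restrict f W}"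
  hence g: "g \<in> nilp V lam" and kW: "kerp g V (Suc m) = W" and gf: "restrict g W = restrict f W" by auto
  obtain G where G: "lin G" "g = restrict G V" "G ` V \<subseteq> V" "\<And>r. kerp g V r = kerp G V r"
    and dG: "\<And>r. dim (kerp G V r) = (\<Sum>i<r. lam i)" using g by (rule nilpE) (rule that)
  \<comment> \<open>The sum of the parts is \<open>dim V\<close>, hence the power
    \<open>m + 2\<close> vanishes on \<open>V\<close> and \<open>g\<close> maps \<open>V\<close>
    into \<open>W\<close>.\<close>
  have top: "kerp G V (Suc (Suc m)) = V"
    using fsub_kerp[OF G(1) V] by (intro fsub_dim_eqI[OF V]) (auto simp: fsubD kerp_subset dG dV)
  have GW: "G v \<in> W" if "v \<in> V" for v
    using kerp_Suc[of G v V "Suc m"] that G(3) top kW G(4) by auto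
  have Gf: "G v = f v" if "v \<in> W" for v
    using gf[unfolded restrict_eq_iff, rule_format, OF that] that W(2) by (auto simp: G(2))
  have kf: "kerp f W m = kerp G W m" by (rule kerp_cong[symmetric]) (use Gf f in auto)
  have "v \<in> W \<longleftrightarrow> G v \<in> kerp f W m" if v: "v \<in> V" for v
  proof -
    have "v \<in> W \<longleftrightarrow> G v \<in> kerp G V m" using kerp_Suc[of G v V m] v G(3,4) kW by auto
    also have "\<dots> \<longleftrightarrow> G v \<in> kerp f W m" unfolding kf using GW[OF v] W(2) by (auto simp: kerp_def)
    finally show ?thesis .
  qed
  hence "{v \<in> V. g v \<in> kerp f W m} = W" using W(2) by (auto simp: G(2))
  thus "g \<in> inj_extensions W f V (kerp f W m) W"
    using GW gf g by (auto simp: inj_extensions_def extensions_def nilp_def G(2))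
next
  have fW: "fsub W" using fsub_subset[OF V W] .
  fix g assume g: "g \<in> inj_extensions W f V (kerp f W m) W"
  then obtain G where G: "lin G" "g = restrict G V" by (auto simp: inj_extensions_def extensions_def elim: LinE)
  have gf: "restrict g W = restrict f W" and GW: "\<And>v. v \<in> V \<Longrightarrow> G v \<in> W"
    using g by (auto simp: inj_extensions_def extensions_def G(2))
  have "{v \<in> V. g v \<in> kerp f W m} = W" using g by (simp add: inj_extensions_def)
  hence "v \<in> V \<and> g v \<in> kerp f W m \<longleftrightarrow> v \<in> W" for v by blast
  moreover have "g v = G v" if "v \<in> V" for v using that by (simp add: G(2))
  ultimately have iff: "G v \<in> kerp f W m \<longleftrightarrow> v \<in> W" if "v \<in> V" for v using that by metis
  have Gf: "G v = f v" if "v \<in> W" for v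
    using gf[unfolded restrict_eq_iff, rule_format, OF that] that W(2) by (auto simp: G(2))
  have kf: "kerp G W r = kerp f W r" for r by (rule kerp_cong) (use Gf f in auto)
  have GV: "G ` V \<subseteq> V" using GW W(2) by auto
  have kfW: "kerp f W (Suc m) = W"
    using fsub_kerp[OF f(1) fW] by (intro fsub_dim_eqI[OF fW]) (auto simp: fsubD kerp_subset dk dW)
  \<comment> \<open>Here injectivity enters: a vector killed by a power up to \<open>m + 1\<close>
    has its image in the kernel of the \<open>m\<close>-th power, which only vectors of
    \<open>W\<close> do.\<close>
  have low: "kerp G V r = kerp f W r" if "r \<le> Suc m" for r
  proof (intro equalityI subsetI)
    fix v assume v: "v \<in> kerp G V r"
    hence vV: "v \<in> V" by (auto simp: kerp_def)
    have "v \<in> W"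
    proof (cases r)
      case 0
      thus ?thesis using v V zero_in_fsub[OF fW] by simp
    next
      case (Suc s)
      hence "G v \<in> kerp G V s" using v kerp_Suc[of G v V s] vV GV by auto
      hence "G v \<in> kerp f W s" using GW[OF vV] unfolding kf[symmetric] by (auto simp: kerp_def)
      hence "G v \<in> kerp f W m" using kerp_mono[OF f(1), of s m W] Suc that by auto
      thus ?thesis using iff[OF vV] by simp
    qed
    thus "v \<in> kerp f W r" using v unfolding kf[symmetric] by (auto simp: kerp_def)
  next
    fix v assume "v \<in> kerp f W r"
    thus "v \<in> kerp G V r" using W(2) unfolding kf[symmetric] by (auto simp: kerp_def)
  qed
  have high: "kerp G V r = V" if r: "Suc m < r" for r
  proof -
    obtain s where s: "r = Suc s" "Suc m \<le> s" using r by (cases r) auto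
    have "kerp f W s = W" using kerp_mono[OF f(1) s(2), of W] kfW kerp_subset[of f W s] by auto
    hence "G v \<in> kerp G V s" if "v \<in> V" for v
      using GW[OF that] W(2) unfolding kf[symmetric] by (auto simp: kerp_def)
    hence "v \<in> kerp G V r" if "v \<in> V" for v
      using kerp_Suc[of G v V s] that GV s by auto
    thus ?thesis using kerp_subset[of G V r] by auto
  qed
  have "dim (kerp G V r) = (\<Sum>i<r. lam i)" for r
  proof (cases "r \<le> Suc m")
    case True
    thus ?thesis by (simp only: low dk min_absorb1)
  next
    case False
    moreover have "(\<Sum>i<r. lam i) = dim V"
      unfolding dV by (rule sum_support) (use lam False in auto)
    ultimately show ?thesis using high by simp
  qed
  hence "g \<in> nilp V lam" unfolding G(2) by (intro nilpI G GV)
  moreover have "kerp g V (Suc m) = W"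
  proof -
    have "kerp g V (Suc m) = kerp G V (Suc m)" by (rule kerp_cong) (use G GV in auto)
    thus ?thesis using low kfW by simp
  qed
  ultimately show "g \<in> {g \<in> nilp V lam. kerp g V (Suc m) = W \<and> restrict g W = restrict f W}"
    using gf by simp
qed

text \<open>The formula is the order of the general linear group divided by that of the centraliser
  of a nilpotent map of type \<open>lam\<close>. It is obtained here by removing the last part
  \<open>b\<close> of \<open>lam\<close>: choose the kernel \<open>W\<close> of codimension
  \<open>b\<close>, a map of the truncated type on \<open>W\<close>, and an extension that is
  injective modulo \<open>W\<close>.\<close>

lemma card_nilp:
  assumes "fsub V" "\<And>i. lam (Suc i) \<le> lam i" "\<And>i. m < i \<Longrightarrow> lam i = 0" "dim V = (\<Sum>i\<le>m. lam i)"
  shows "real (card (nilp V lam)) * q ^ (dim V)\<^sup>2 * (\<Prod>i\<le>m. qfact q (lam i - lam (Suc i)))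
    = q ^ (\<Sum>i\<le>m. (lam i)\<^sup>2) * (1 - q) ^ (dim V - lam 0) * qfact q (dim V)"
  using assms
proof (induction m arbitrary: V lam)
  case 0
  have "nilp V lam = {restrict (\<lambda>_. 0) V}"
  proof (intro equalityI subsetI)
    fix g assume "g \<in> nilp V lam"
    then obtain G where G: "lin G" "g = restrict G V" and dG: "\<And>r. dim (kerp G V r) = (\<Sum>i<r. lam i)"
      by (rule nilpE) (rule that)
    have "kerp G V 1 = V"
      using fsub_kerp[OF G(1) 0(1)] dG[of 1] 0 by (intro fsub_dim_eqI[OF 0(1)]) (auto simp: fsubD kerp_subset)
    thus "g \<in> {restrict (\<lambda>_. 0) V}" by (auto simp: G(2) kerp_def restrict_eq_iff)
  next
    have "kerp (\<lambda>_. 0) V r = (if r = 0 then {0} else V)" for r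
      using 0(1) by (cases r) (auto simp: kerp_def zero_in_fsub)
    moreover have "(\<Sum>i<r. lam i) = dim V" if "r \<noteq> 0" for r
      using sum_support[of 1 lam r] 0(3,4) that by simp
    ultimately have "restrict (\<lambda>_. 0) V \<in> nilp V lam"
      using zero_in_fsub[OF 0(1)] by (intro nilpI) auto
    thus "g \<in> nilp V lam" if "g \<in> {restrict (\<lambda>_. 0) V}" for g using that by simp
  qed
  thus ?case using 0 by simp
next
  case (Suc m)
  note V = Suc.prems(1)
  define n a b lam' where "n = dim V" and "a = lam m" and "b = lam (Suc m)"
    and "lam' = (\<lambda>i. if i < Suc m then lam i else 0)"
  have nb: "n = (\<Sum>i<Suc m. lam i) + b" and dV: "dim V = (\<Sum>i<Suc (Suc m). lam i)"
    using Suc.prems(4) by (simp_all add: n_def b_def lessThan_Suc_atMost[symmetric])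
  have ba: "b \<le> a" using Suc.prems(2) by (simp add: a_def b_def)
  have lam0: "lam 0 \<le> n - b"
    using nb member_le_sum[of 0 "{..<Suc m}" lam] by simp
  have fin: "finite V" using V by (simp add: fsubD)
  \<comment> \<open>With both inner spaces zero the intersection condition is void, so these are all
    subspaces of dimension \<open>n - b\<close>.\<close>
  let ?Y = "above {0} {0} V (n - b)"
  have Y: "fsub W" "W \<subseteq> V" "dim W = n - b" if "W \<in> ?Y" for W
    using that fsub_subset[OF V] by (auto simp: above_def)
  define P where "P = (\<Prod>i<m. qfact q (lam i - lam (Suc i)))"
  define S where "S = (\<Sum>i<Suc m. (lam i)\<^sup>2)"
  have N: "real (card (nilp W lam')) * (q ^ (n - b)\<^sup>2 * (P * qfact q a))
      = q ^ S * (1 - q) ^ (n - b - lam 0) * qfact q (n - b)" if "W \<in> ?Y" for W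
  proof -
    have "real (card (nilp W lam')) * q ^ (dim W)\<^sup>2 * (\<Prod>i\<le>m. qfact q (lam' i - lam' (Suc i)))
        = q ^ (\<Sum>i\<le>m. (lam' i)\<^sup>2) * (1 - q) ^ (dim W - lam' 0) * qfact q (dim W)"
      using Y[OF that] Suc.prems nb
      by (intro Suc.IH) (auto simp: lam'_def lessThan_Suc_atMost[symmetric])
    \<comment> \<open>In the truncated type the last difference is \<open>a\<close> itself, since
      the part after it is now zero. This factor cancels below against the numerator of the
      extension count.\<close>
    moreover have "(\<Prod>i\<le>m. qfact q (lam' i - lam' (Suc i))) = P * qfact q a"
      by (simp add: lessThan_Suc_atMost[symmetric] lam'_def P_def a_def)
    moreover have "(\<Sum>i\<le>m. (lam' i)\<^sup>2) = S"
      by (simp add: lessThan_Suc_atMost[symmetric] lam'_def S_def)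
    ultimately show ?thesis using Y(3)[OF that] by (simp add: lam'_def)
  qed
  define E where "E = (1 - q) ^ b * qfact q a"
  have fiber: "real (card {g \<in> nilp V lam. kerp g V (Suc m) = W}) * (q ^ (b * (n - b)) * qfact q (a - b))
      = real (card (nilp W lam')) * E" if W: "W \<in> ?Y" for W
  proof (rule card_by_fibers(2)[where f = "\<lambda>g. restrict g W"])
    show "finite (nilp W lam')" using Y(1)[OF W] by (simp add: finite_nilp fsubD)
    show "(\<lambda>g. restrict g W) ` {g \<in> nilp V lam. kerp g V (Suc m) = W} \<subseteq> nilp W lam'"
      using nilp_restrict(1)[OF V] by (auto simp: lam'_def)
    fix g' assume g': "g' \<in> nilp W lam'"
    show "finite {g \<in> {g \<in> nilp V lam. kerp g V (Suc m) = W}. restrict g W = g'}"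
      using finite_nilp[OF fin] by simp
    obtain f where f: "lin f" "g' = restrict f W" "f ` W \<subseteq> W"
      and df: "\<And>r. dim (kerp f W r) = (\<Sum>i<r. lam' i)" using g' by (rule nilpE) (rule that)
    have df': "dim (kerp f W r) = (\<Sum>i<min r (Suc m). lam i)" for r
      unfolding df lam'_def by (rule sum_truncate)
    have dW: "dim W = (\<Sum>i<Suc m. lam i)" using Y(3)[OF W] nb by simp
    have dY: "dim (kerp f W m) + a = n - b" using df'[of m] nb by (simp add: a_def)
    have eq: "{g \<in> {g \<in> nilp V lam. kerp g V (Suc m) = W}. restrict g W = g'}
        = inj_extensions W f V (kerp f W m) W"
      using nilp_extension[OF V _ _ f(1,3) df' _ dV dW] Y[OF W] Suc.prems(3) f(2) by (simp add: fsubD conj_assoc)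
    have "real (card (inj_extensions W f V (kerp f W m) W)) * q ^ ((dim V - dim W) * dim W)
        * qfact q (dim W - dim (kerp f W m) - (dim V - dim W))
        = (1 - q) ^ (dim V - dim W) * qfact q (dim W - dim (kerp f W m))"
    proof (rule card_inj_extensions[OF V Y(1)[OF W] _ _ _ kerp_subset f(1)])
      show "f ` W \<subseteq> kerp f W m"
      proof clarify
        fix v assume v: "v \<in> W"
        have "kerp f W (Suc m) = W"
          using fsub_kerp[OF f(1) Y(1)[OF W]] df'[of "Suc m"] dW
          by (intro fsub_dim_eqI[OF Y(1)[OF W]]) (auto simp: fsubD kerp_subset)
        thus "f v \<in> kerp f W m" using kerp_Suc[of f v W m] v f(3) by auto
      qed
      show "dim (kerp f W m) + (dim V - dim W) \<le> dim W"
        using dY Y(3)[OF W] ba nb by (simp add: n_def)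
    qed (use Y[OF W] f in \<open>auto simp: fsubD subspace_kerp\<close>)
    moreover have "dim V - dim W = b" "dim W - dim (kerp f W m) = a"
      using Y(3)[OF W] nb dY by (simp_all add: n_def)
    ultimately show "real (card {g \<in> {g \<in> nilp V lam. kerp g V (Suc m) = W}. restrict g W = g'})
        * (q ^ (b * (n - b)) * qfact q (a - b)) = E"
      unfolding eq E_def by (simp only: Y(3)[OF W] mult.assoc)
  qed
  define C where "C = q ^ (b * (n - b)) * qfact q (a - b) * (q ^ (n - b)\<^sup>2 * (P * qfact q a))"
  have X: "real (card (nilp V lam)) * C
      = real (card ?Y) * (q ^ S * (1 - q) ^ (n - b - lam 0) * qfact q (n - b) * E)"
  proof (rule card_by_fibers(2)[where f = "\<lambda>g. kerp g V (Suc m)"])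
    show "finite ?Y" using fin by (rule finite_above)
    show "(\<lambda>g. kerp g V (Suc m)) ` nilp V lam \<subseteq> ?Y"
    proof clarify
      fix g assume g: "g \<in> nilp V lam"
      then obtain G where G: "lin G" "kerp g V (Suc m) = kerp G V (Suc m)" by (rule nilpE) (rule that)
      have "fsub (kerp g V (Suc m))" unfolding G(2) by (rule fsub_kerp[OF G(1) V])
      thus "kerp g V (Suc m) \<in> ?Y"
        using nilp_restrict(2)[OF V g refl, of "Suc m"] nb zero_in_fsub
        by (auto simp: above_def fsubD kerp_subset)
    qed
    fix W assume W: "W \<in> ?Y"
    show "finite {g \<in> nilp V lam. kerp g V (Suc m) = W}" using finite_nilp[OF fin] by simp
    have "real (card {g \<in> nilp V lam. kerp g V (Suc m) = W}) * C
        = real (card (nilp W lam')) * E * (q ^ (n - b)\<^sup>2 * (P * qfact q a))"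
      unfolding C_def fiber[OF W, symmetric] by simp
    also have "\<dots> = (real (card (nilp W lam')) * (q ^ (n - b)\<^sup>2 * (P * qfact q a))) * E" by simp
    finally show "real (card {g \<in> nilp V lam. kerp g V (Suc m) = W}) * C
        = q ^ S * (1 - q) ^ (n - b - lam 0) * qfact q (n - b) * E" by (simp only: N[OF W])
  qed
  have F: "real (card ?Y) * q ^ (b * (n - b)) * (qfact q (n - b) * qfact q b) = qfact q n"
  proof -
    have "real (card ?Y) * q ^ ((n - b) * (dim V - dim {0} - (n - b))) = qbinom q (dim V - dim {0}) (n - b)"
      using nb V by (intro card_above) (auto simp: n_def zero_in_fsub)
    moreover have "n - (n - b) = b" using nb by simp
    ultimately show ?thesis
      by (simp add: n_def[symmetric] qbinom_def mult.commute qfact_nonzero[OF q_pos])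
  qed
  \<comment> \<open>The two terms \<open>b * (n - b)\<close> belong to the choice of
    \<open>W\<close> and to the extension, \<open>(n - b)\<close> squared to the induction
    hypothesis; \<open>b\<close> squared becomes the new summand in the sum of the squared
    parts.\<close>
  have n2: "n\<^sup>2 = b * (n - b) + (n - b)\<^sup>2 + b * (n - b) + b\<^sup>2"
  proof -
    obtain c where "n = c + b" using nb by blast
    thus ?thesis by (simp add: power2_eq_square algebra_simps)
  qed
  let ?X = "real (card (nilp V lam))"
  have P: "(\<Prod>i\<le>Suc m. qfact q (lam i - lam (Suc i))) = P * qfact q (a - b) * qfact q b"
    using Suc.prems(3)[of "Suc (Suc m)"]
    by (simp add: P_def a_def b_def lessThan_Suc_atMost[symmetric])
  \<comment> \<open>The extra factor \<open>qfact q a\<close> on both sides avoids a division; it is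
    cancelled at the end.\<close>
  have "?X * q ^ n\<^sup>2 * (P * qfact q (a - b) * qfact q b) * qfact q a
      = (?X * C) * (q ^ (b * (n - b)) * q ^ b\<^sup>2 * qfact q b)"
    unfolding C_def n2 power_add by simp
  also have "\<dots> = (real (card ?Y) * q ^ (b * (n - b)) * (qfact q (n - b) * qfact q b))
      * (q ^ S * (1 - q) ^ (n - b - lam 0) * E * q ^ b\<^sup>2)"
    unfolding X by simp
  also have "\<dots> = q ^ (S + b\<^sup>2) * (1 - q) ^ (n - b - lam 0 + b) * qfact q n * qfact q a"
    unfolding F E_def power_add by simp
  finally have "?X * q ^ n\<^sup>2 * (P * qfact q (a - b) * qfact q b)
      = q ^ (S + b\<^sup>2) * (1 - q) ^ (n - b - lam 0 + b) * qfact q n"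
    using qfact_nonzero[OF q_pos, of a] by simp
  moreover have "n - b - lam 0 + b = n - lam 0" using lam0 nb by simp
  moreover have "(\<Sum>i\<le>Suc m. (lam i)\<^sup>2) = S + b\<^sup>2"
    by (simp add: S_def b_def lessThan_Suc_atMost[symmetric])
  ultimately show ?case unfolding P n_def[symmetric] by (simp only:)
qed

end

subsection \<open>Counting flags with a prescribed tableau\<close>

lemma qbinom_symmetric: "r \<le> m \<Longrightarrow> qbinom q m (m - r) = qbinom q m r"
  by (simp add: qbinom_def mult.commute)

text \<open>Exponent bookkeeping for removing a horizontal strip from \<open>lam\<close>, leaving
  \<open>mu\<close>. The double sum is the exponent from \<open>card_meeting\<close>; the last
  summand is a boundary term that carries the induction and vanishes once
  \<open>lam m = 0\<close>.\<close>

lemma strip_choose_two: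
  fixes lam mu :: "nat \<Rightarrow> nat"
  assumes "\<And>r. mu r \<le> lam r" "\<And>r. lam (Suc r) \<le> mu r"
  shows "(\<Sum>r<m. lam r choose 2) = (\<Sum>r<m. mu r choose 2) + ((\<Sum>r<m. lam r - mu r) choose 2)
    + (\<Sum>i<m. (mu i - lam (Suc i)) * (\<Sum>t\<le>i. lam t - mu t)) + lam m * (\<Sum>r<m. lam r - mu r)"
proof (induction m)
  case (Suc m)
  define U u w where "U = (\<Sum>r<m. lam r - mu r)" and "u = lam m - mu m" and "w = mu m - lam (Suc m)"
  have l: "lam m = mu m + u" and m: "mu m = lam (Suc m) + w"
    using assms by (simp_all add: u_def w_def)
  have c1: "lam m choose 2 = (mu m choose 2) + (u choose 2) + mu m * u"
    unfolding l by (rule choose_two_add)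
  have "mu m * u + lam m * U = U * u + w * (U + u) + lam (Suc m) * (U + u)"
    by (simp add: l m algebra_simps)
  thus ?case
    using Suc c1 choose_two_add[of U u]
    by (simp add: U_def[symmetric] u_def[symmetric] w_def[symmetric] lessThan_Suc_atMost[symmetric])
qed simp

context finite_field_space
begin

text \<open>The candidates for the second largest member of a flag strictly compatible with
  \<open>g\<close>. Containing the image of \<open>g\<close> makes each of them stable under
  \<open>g\<close>.\<close>

definition strip_subspaces :: "('b \<Rightarrow> 'b) \<Rightarrow> 'b set \<Rightarrow> (nat \<Rightarrow> nat) \<Rightarrow> 'b set set"
  where "strip_subspaces g V mu = {W. subspace W \<and> W \<subseteq> V \<and> g ` V \<subseteq> W \<and>
    (\<forall>r. dim (kerp g W r) = (\<Sum>t<r. mu t))}"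

lemma kerp_full:
  assumes "lin g" "fsub V" "\<And>r. dim (kerp g V r) = (\<Sum>t<r. lam t)"
    and "\<And>r. n \<le> r \<Longrightarrow> lam r = 0" "dim V = (\<Sum>t<n. lam t)" "n \<le> r"
  shows "kerp g V r = V"
  using fsub_kerp[OF assms(1,2)] sum_support[of n lam r] assms
  by (intro fsub_dim_eqI[OF assms(2)]) (auto simp: fsubD kerp_subset)

text \<open>A subspace \<open>W\<close> between \<open>g ` V\<close> and \<open>V\<close> restricts \<open>g\<close> to the type \<open>\<mu>\<close> iff it meets the members
  \<open>g ` V + ker g\<^sup>r\<close> of a flag in the dimensions counted by \<open>card_meeting\<close>.\<close>

lemma strip_subspaces_meeting:
  assumes g: "lin g" "g ` V \<subseteq> V" and V: "fsub V"
    and dk: "\<And>r. dim (kerp g V r) = (\<Sum>t<r. lam t)"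
    and lam: "\<And>r. n \<le> r \<Longrightarrow> lam r = 0" and dV: "dim V = (\<Sum>t<n. lam t)"
    and mu: "\<And>r. mu r \<le> lam r" "\<And>r. lam (Suc r) \<le> mu r"
  defines "G \<equiv> \<lambda>r. {g a + d | a d. a \<in> V \<and> d \<in> kerp g V r}"
  shows "strip_subspaces g V mu = meeting G n (\<lambda>i. mu i - lam (Suc i))"
    and "\<And>r. fsub (G r)" and "\<And>r. dim (G r) + lam r = dim V" and "\<And>r. G r \<subseteq> G (Suc r)"
proof -
  have sub: "fsub (kerp g V r)" for r using fsub_kerp[OF g(1) V] .
  show fG: "fsub (G r)" for r unfolding G_def by (rule dim_image_sum(1)[OF g(1) V sub])
  have pre: "{a \<in> V. g a \<in> kerp g V r} = kerp g V (Suc r)" for r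
    using kerp_Suc[of g _ V r] g(2) kerp_subset[of g V "Suc r"] by blast
  \<comment> \<open>The dimension formula compares the kernels of the powers \<open>Suc r\<close>
    and \<open>r\<close>, whose dimensions differ by \<open>lam r\<close>.\<close>
  show dG: "dim (G r) + lam r = dim V" for r
    using dim_image_sum(2)[OF g(1) V sub, of r] unfolding G_def pre dk by simp
  show "G r \<subseteq> G (Suc r)" for r
  proof -
    have "kerp g V r \<subseteq> kerp g V (Suc r)" by (rule kerp_mono[OF g(1)]) simp
    thus ?thesis unfolding G_def by blast
  qed
  have G0: "G 0 = g ` V" using V by (auto simp: G_def)
  have "kerp g V n = V" by (rule kerp_full[OF g(1) V dk lam dV]) auto
  hence Gn: "G n = V"
    using g(2) V g(1) zero_in_fsub[OF V] by (force simp: G_def fsubD intro: subspace_add)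
  \<comment> \<open>Because \<open>W\<close> contains the image of \<open>g\<close>, the modular law
    identifies \<open>W \<inter> G r\<close> with the sum of that image and the kernel of the
    \<open>r\<close>-th power on \<open>W\<close>.\<close>
  have dim_meet: "dim (W \<inter> G r) + (\<Sum>t<Suc r. lam t) = dim V + dim (kerp g W r)"
    if W: "subspace W" "W \<subseteq> V" "g ` V \<subseteq> W" for W r
  proof -
    have fW: "fsub W" using fsub_subset[OF V] W by blast
    have "W \<inter> G r = {g a + d | a d. a \<in> V \<and> d \<in> kerp g W r}"
    proof (intro equalityI subsetI)
      fix x assume x: "x \<in> W \<inter> G r"
      then obtain a d where ad: "x = g a + d" "a \<in> V" "d \<in> kerp g V r" by (auto simp: G_def)
      have "x - g a \<in> W" using x ad W by (intro subspace_diff) auto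
      hence "d \<in> kerp g W r" using ad kerp_mono_set[OF W(2)] by simp
      thus "x \<in> {g a + d | a d. a \<in> V \<and> d \<in> kerp g W r}" using ad by blast
    next
      fix x assume "x \<in> {g a + d | a d. a \<in> V \<and> d \<in> kerp g W r}"
      then obtain a d where ad: "x = g a + d" "a \<in> V" "d \<in> kerp g W r" by blast
      hence "x \<in> W" using W kerp_subset[of g W r] by (auto intro!: subspace_add)
      thus "x \<in> W \<inter> G r" using ad kerp_mono_set[OF W(2)] by (auto simp: G_def)
    qed
    moreover have "{a \<in> V. g a \<in> kerp g W r} = kerp g V (Suc r)"
      using pre[of r] W(3) kerp_mono_set[OF W(2), of g r] by auto
    ultimately show ?thesis
      using dim_image_sum(2)[OF g(1) V fsub_kerp[OF g(1) fW], of r] by (simp add: dk)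
  qed
  have sums: "(\<Sum>t<r. mu t - lam (Suc t)) + (\<Sum>t<Suc r. lam t) = (\<Sum>t<r. mu t) + lam 0" for r
  proof (induction r)
    case (Suc r)
    thus ?case using mu(2)[of r] by simp
  qed simp
  have iff: "dim (W \<inter> G r) = dim (G 0) + (\<Sum>t<r. mu t - lam (Suc t)) \<longleftrightarrow> dim (kerp g W r) = (\<Sum>t<r. mu t)"
    if W: "subspace W" "W \<subseteq> V" "g ` V \<subseteq> W" for W r
    using dim_meet[OF W, of r] sums[of r] dG[of 0] by linarith
  \<comment> \<open>\<open>meeting\<close> constrains only the indices up to \<open>n\<close>;
    beyond that the kernels are all of \<open>W\<close> and the parts of \<open>mu\<close> are
    zero.\<close>
  have large: "\<forall>r. dim (kerp g W r) = (\<Sum>t<r. mu t)"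
    if W: "W \<subseteq> V" and le: "\<And>r. r \<le> n \<Longrightarrow> dim (kerp g W r) = (\<Sum>t<r. mu t)" for W
  proof
    fix r
    show "dim (kerp g W r) = (\<Sum>t<r. mu t)"
    proof (cases "r \<le> n")
      case False
      have "kerp g W s = W" if "n \<le> s" for s
        using kerp_full[OF g(1) V dk lam dV that] kerp_mono_set[OF W, of g s] W by auto
      hence "dim (kerp g W r) = dim (kerp g W n)" using False by simp
      also have "\<dots> = (\<Sum>t<r. mu t)"
        unfolding le[OF order_refl]
      proof (rule sum_support[symmetric])
        fix i assume "n \<le> i"
        thus "mu i = 0" using mu(1)[of i] lam[of i] by simp
      qed (use False in simp)
      finally show ?thesis .
    qed (rule le)
  qed
  show "strip_subspaces g V mu = meeting G n (\<lambda>i. mu i - lam (Suc i))"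
  proof (intro equalityI subsetI)
    fix W assume "W \<in> strip_subspaces g V mu"
    thus "W \<in> meeting G n (\<lambda>i. mu i - lam (Suc i))"
      using iff[of W] by (auto simp: strip_subspaces_def meeting_def G0[symmetric] Gn)
  next
    fix W assume "W \<in> meeting G n (\<lambda>i. mu i - lam (Suc i))"
    hence W: "subspace W" "W \<subseteq> V" "g ` V \<subseteq> W"
      and "\<And>r. r \<le> n \<Longrightarrow> dim (W \<inter> G r) = dim (G 0) + (\<Sum>t<r. mu t - lam (Suc t))"
      by (auto simp: meeting_def G0[symmetric] Gn)
    thus "W \<in> strip_subspaces g V mu"
      using large[OF W(2)] iff[OF W] by (simp add: strip_subspaces_def)
  qed
qed

text \<open>The dimension of \<open>G r\<close> is \<open>dim V - lam r\<close>, so the flag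
  \<open>G\<close> has steps \<open>lam t - lam (Suc t)\<close>, and \<open>W\<close> has to meet it
  in steps \<open>mu t - lam (Suc t)\<close>. The exponent from \<open>card_meeting\<close> is
  rewritten so that it compares the sums of binomials of \<open>lam\<close> and
  \<open>mu\<close>.\<close>

lemma card_strip_subspaces:
  assumes g: "lin g" "g ` V \<subseteq> V" and V: "fsub V"
    and dk: "\<And>r. dim (kerp g V r) = (\<Sum>t<r. lam t)"
    and lam: "\<And>r. n \<le> r \<Longrightarrow> lam r = 0" and dV: "dim V = (\<Sum>t<n. lam t)"
    and mu: "\<And>r. mu r \<le> lam r" "\<And>r. lam (Suc r) \<le> mu r"
  shows "real (card (strip_subspaces g V mu)) * q ^ (\<Sum>r<n. lam r choose 2)
    = q ^ ((\<Sum>r<n. mu r choose 2) + ((\<Sum>r<n. lam r - mu r) choose 2))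
      * (\<Prod>r<n. qbinom q (lam r - lam (Suc r)) (lam r - mu r))"
proof -
  define G where "G = (\<lambda>r. {g a + d | a d. a \<in> V \<and> d \<in> kerp g V r})"
  define w where "w = (\<lambda>i. mu i - lam (Suc i))"
  note meet = strip_subspaces_meeting[OF g V dk lam dV mu]
  have meeting: "strip_subspaces g V mu = meeting G n w" using meet(1) by (simp only: G_def w_def)
  have fG: "fsub (G r)" for r unfolding G_def by (rule meet(2))
  have dG: "dim (G r) + lam r = dim V" for r unfolding G_def by (rule meet(3))
  have mono: "G r \<subseteq> G (Suc r)" for r unfolding G_def by (rule meet(4))
  have "real (card (meeting G n w)) * q ^ (\<Sum>i<n. w i * (\<Sum>t\<le>i. (lam t - lam (Suc t)) - w t))
      = (\<Prod>i<n. qbinom q (lam i - lam (Suc i)) (w i))"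
  proof (rule card_meeting)
    fix i
    show "subspace (G i)" "G i \<subseteq> G (Suc i)" "finite (G n)" using fG mono by (auto simp: fsubD)
    show "w i \<le> lam i - lam (Suc i)" using mu(1)[of i] by (simp add: w_def)
    show "dim (G i) = dim (G 0) + (\<Sum>t<i. lam t - lam (Suc t))"
    proof (induction i)
      case (Suc i)
      thus ?case using dG[of i] dG[of "Suc i"] mu[of i] by simp
    qed simp
  qed
  moreover have "lam t - lam (Suc t) - w t = lam t - mu t" for t
    using mu[of t] by (simp add: w_def)
  \<comment> \<open>Passing to the complementary lower index yields the factor as it occurs in the
    weight of a tableau.\<close>
  moreover have "qbinom q (lam i - lam (Suc i)) (w i) = qbinom q (lam i - lam (Suc i)) (lam i - mu i)" for i
  proof -
    have "w i = (lam i - lam (Suc i)) - (lam i - mu i)" using mu[of i] by (simp add: w_def)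
    thus ?thesis using mu[of i] by (simp only:) (rule qbinom_symmetric, simp)
  qed
  ultimately have "real (card (strip_subspaces g V mu)) * q ^ (\<Sum>i<n. w i * (\<Sum>t\<le>i. lam t - mu t))
      = (\<Prod>r<n. qbinom q (lam r - lam (Suc r)) (lam r - mu r))"
    by (simp add: meeting)
  thus ?thesis
    unfolding strip_choose_two[of mu lam n, OF mu] by (simp add: lam power_add w_def)
qed

definition strict_flags :: "nat \<Rightarrow> ('b \<Rightarrow> 'b) \<Rightarrow> 'b set \<Rightarrow> (nat \<Rightarrow> nat \<Rightarrow> nat) \<Rightarrow> 'b set list set"
  where "strict_flags k g V L = {F. length F = Suc k \<and> F ! 0 = {0} \<and> F ! k = V \<and>
    (\<forall>i\<le>k. subspace (F ! i) \<and> (\<forall>r. dim (kerp g (F ! i) r) = (\<Sum>t<r. L i t))) \<and>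
    (\<forall>i<k. F ! i \<subseteq> F ! Suc i \<and> g ` (F ! Suc i) \<subseteq> F ! i)}"

lemma finite_chains:
  assumes "finite V"
  shows "finite {F. length F = Suc k \<and> F ! k = V \<and> (\<forall>i<k. F ! i \<subseteq> F ! Suc i)}"
proof (rule finite_subset)
  show "finite {F. set F \<subseteq> Pow V \<and> length F = Suc k}"
    using assms by (intro finite_lists_length_eq) simp
  show "{F. length F = Suc k \<and> F ! k = V \<and> (\<forall>i<k. F ! i \<subseteq> F ! Suc i)}
      \<subseteq> {F. set F \<subseteq> Pow V \<and> length F = Suc k}"
  proof clarify
    fix F X x assume F: "length F = Suc k" "V = F ! k" "\<forall>i<k. F ! i \<subseteq> F ! Suc i"
      and x: "X \<in> set F" "x \<in> X"
    then obtain i where i: "i \<le> k" "X = F ! i" by (auto simp: in_set_conv_nth less_Suc_eq_le)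
    thus "x \<in> F ! k" using chain_mono[of k "\<lambda>i. F ! i" i k] F(3) x by auto
  qed
qed

lemma finite_strict_flags: "finite V \<Longrightarrow> finite (strict_flags k g V L)"
  by (rule finite_subset[OF _ finite_chains[of V k]]) (auto simp: strict_flags_def)

lemma snoc_conv_nth: "length F = Suc (Suc k) \<Longrightarrow> F ! Suc k = V \<Longrightarrow> F = take (Suc k) F @ [V]"
  by (metis lessI take_Suc_conv_app_nth take_all_iff order_refl)

lemma strict_flags_snoc:
  assumes W: "W \<in> strip_subspaces g V (L k)" and V: "subspace V"
    and dk: "\<And>r. dim (kerp g V r) = (\<Sum>t<r. L (Suc k) t)"
  shows "{F \<in> strict_flags (Suc k) g V L. F ! k = W} = (\<lambda>F. F @ [V]) ` strict_flags k g W L"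
proof (intro equalityI subsetI)
  fix F assume "F \<in> {F \<in> strict_flags (Suc k) g V L. F ! k = W}"
  hence F: "F \<in> strict_flags (Suc k) g V L" "F ! k = W" by auto
  hence len: "length F = Suc (Suc k)" and FV: "F ! Suc k = V" by (auto simp: strict_flags_def)
  have "take (Suc k) F \<in> strict_flags k g W L"
    using F by (auto simp: strict_flags_def min_def)
  thus "F \<in> (\<lambda>F. F @ [V]) ` strict_flags k g W L"
    using snoc_conv_nth[OF len FV] by blast
next
  fix F assume "F \<in> (\<lambda>F. F @ [V]) ` strict_flags k g W L"
  then obtain F' where F': "F = F' @ [V]" "F' \<in> strict_flags k g W L" by blast
  have len: "length F' = Suc k" using F' by (auto simp: strict_flags_def)
  have n1: "F ! i = F' ! i" if "i \<le> k" for i using that len F' by (simp add: nth_append)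
  have n2: "F ! Suc k = V" using len F' by (simp add: nth_append)
  have "\<forall>i\<le>Suc k. subspace (F ! i) \<and> (\<forall>r. dim (kerp g (F ! i) r) = (\<Sum>t<r. L i t))"
    using F'(2) n1 n2 V dk by (auto simp: strict_flags_def le_Suc_eq)
  moreover have "\<forall>i<Suc k. F ! i \<subseteq> F ! Suc i \<and> g ` (F ! Suc i) \<subseteq> F ! i"
    using F'(2) n1 n2 W by (auto simp: strict_flags_def less_Suc_eq strip_subspaces_def)
  ultimately show "F \<in> {F \<in> strict_flags (Suc k) g V L. F ! k = W}"
    using F'(2) n1 n2 len F'(1) by (auto simp: strict_flags_def)
qed

text \<open>Removing the top member \<open>V\<close> reduces the count to strip subspaces. The
  powers attached to the shapes cancel between consecutive steps, so only that of the top shape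
  survives, along with one power for each step size and the product of binomials that becomes the
  tableau weight.\<close>

lemma card_strict_flags:
  assumes g: "lin g"
    and "g ` V \<subseteq> V" "fsub V" "\<And>r. dim (kerp g V r) = (\<Sum>t<r. L k t)" "dim V = (\<Sum>t<n. L k t)"
    and "\<And>j r. j < k \<Longrightarrow> L j r \<le> L (Suc j) r" "\<And>j r. j < k \<Longrightarrow> L (Suc j) (Suc r) \<le> L j r"
    and "\<And>r. L 0 r = 0" "\<And>j r. j \<le> k \<Longrightarrow> n \<le> r \<Longrightarrow> L j r = 0"
  shows "real (card (strict_flags k g V L)) * q ^ (\<Sum>r<n. L k r choose 2)
    = q ^ (\<Sum>j<k. (\<Sum>r<n. L (Suc j) r - L j r) choose 2)
      * (\<Prod>j<k. \<Prod>r<n. qbinom q (L (Suc j) r - L (Suc j) (Suc r)) (L (Suc j) r - L j r))"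
  using assms(2-)
proof (induction k arbitrary: V)
  case 0
  have V0: "V = {0}" using fsub_dim_0 0 by simp
  have "strict_flags 0 g V L = {[V]}"
  proof (intro equalityI subsetI)
    fix F assume "F \<in> strict_flags 0 g V L"
    thus "F \<in> {[V]}" by (cases F) (auto simp: strict_flags_def)
  next
    fix F assume "F \<in> {[V]}"
    thus "F \<in> strict_flags 0 g V L" using 0 V0 by (auto simp: strict_flags_def)
  qed
  thus ?case using 0 by (simp add: numeral_2_eq_2)
next
  case (Suc k)
  note V = Suc.prems(2)
  let ?C = "\<lambda>j. \<Sum>r<n. L j r choose 2" and ?b = "\<lambda>j. (\<Sum>r<n. L (Suc j) r - L j r) choose 2"
  let ?P = "\<lambda>j. \<Prod>r<n. qbinom q (L (Suc j) r - L (Suc j) (Suc r)) (L (Suc j) r - L j r)"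
  let ?S = "strip_subspaces g V (L k)"
  have "real (card (strict_flags (Suc k) g V L)) * q ^ ?C k
      = real (card ?S) * (q ^ (\<Sum>j<k. ?b j) * (\<Prod>j<k. ?P j))"
  proof (rule card_by_fibers(2)[where f = "\<lambda>F. F ! k"])
    show "finite ?S"
    proof (rule finite_subset)
      show "?S \<subseteq> Pow V" by (auto simp: strip_subspaces_def)
      show "finite (Pow V)" using V by (simp add: fsubD)
    qed
    show "(\<lambda>F. F ! k) ` strict_flags (Suc k) g V L \<subseteq> ?S"
    proof clarify
      fix F assume F: "F \<in> strict_flags (Suc k) g V L"
      hence "F ! k \<subseteq> F ! Suc k \<and> g ` (F ! Suc k) \<subseteq> F ! k" "F ! Suc k = V"
        unfolding strict_flags_def by blast+
      with F have "subspace (F ! k)" "F ! k \<subseteq> V" "g ` V \<subseteq> F ! k"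
        "\<forall>r. dim (kerp g (F ! k) r) = (\<Sum>t<r. L k t)"
        by (simp_all add: strict_flags_def)
      thus "F ! k \<in> ?S" by (simp add: strip_subspaces_def)
    qed
    fix W assume W: "W \<in> ?S"
    hence W': "subspace W" "W \<subseteq> V" "g ` V \<subseteq> W" "\<And>r. dim (kerp g W r) = (\<Sum>t<r. L k t)"
      by (auto simp: strip_subspaces_def)
    have fW: "fsub W" using fsub_subset[OF V W'(1,2)] .
    show "finite {F \<in> strict_flags (Suc k) g V L. F ! k = W}"
      using finite_strict_flags[of V] V by (simp add: fsubD)
    have "card {F \<in> strict_flags (Suc k) g V L. F ! k = W} = card (strict_flags k g W L)"
      unfolding strict_flags_snoc[OF W fsubD(1)[OF V] Suc.prems(3)]
      by (rule card_image) (simp add: inj_on_def)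
    moreover have "real (card (strict_flags k g W L)) * q ^ ?C k
        = q ^ (\<Sum>j<k. ?b j) * (\<Prod>j<k. ?P j)"
    proof (rule Suc.IH)
      show "g ` W \<subseteq> W" "fsub W" "\<And>r. dim (kerp g W r) = (\<Sum>t<r. L k t)" using W' fW by auto
      have "kerp g V n = V" by (rule kerp_full[OF g V Suc.prems(3,8,4)]) auto
      hence "kerp g W n = W" using kerp_mono_set[OF W'(2), of g n] W'(2) by auto
      thus "dim W = (\<Sum>t<n. L k t)" using W'(4)[of n] by simp
    qed (use Suc.prems in auto)
    ultimately show "real (card {F \<in> strict_flags (Suc k) g V L. F ! k = W}) * q ^ ?C k
        = q ^ (\<Sum>j<k. ?b j) * (\<Prod>j<k. ?P j)" by simp
  qed
  note e1 = this
  have e2: "real (card ?S) * q ^ ?C (Suc k) = q ^ (?C k + ?b k) * ?P k"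
    by (rule card_strip_subspaces[OF g Suc.prems(1,2,3) _ Suc.prems(4)]) (use Suc.prems in auto)
  have "(real (card (strict_flags (Suc k) g V L)) * q ^ ?C k) * q ^ ?C (Suc k)
      = (real (card ?S) * q ^ ?C (Suc k)) * (q ^ (\<Sum>j<k. ?b j) * (\<Prod>j<k. ?P j))"
    unfolding e1 by (simp only: mult_ac)
  also have "\<dots> = (q ^ (?C k + ?b k) * ?P k) * (q ^ (\<Sum>j<k. ?b j) * (\<Prod>j<k. ?P j))"
    by (simp only: e2)
  finally have "(real (card (strict_flags (Suc k) g V L)) * q ^ ?C k) * q ^ ?C (Suc k)
      = (q ^ (?C k + ?b k) * ?P k) * (q ^ (\<Sum>j<k. ?b j) * (\<Prod>j<k. ?P j))" .
  hence "(real (card (strict_flags (Suc k) g V L)) * q ^ ?C (Suc k)) * q ^ ?C k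
      = (q ^ (\<Sum>j<Suc k. ?b j) * (\<Prod>j<Suc k. ?P j)) * q ^ ?C k"
    by (simp add: power_add mult_ac)
  thus ?case using q_pos by simp
qed

end

subsection \<open>Counting flags and maps in a prescribed relative position\<close>

text \<open>The index pairs are split by which index is larger. In \<open>card_compat_flags\<close>
  one part is the exponent for choosing a subspace and the other the exponent for extending a
  map.\<close>

lemma sum_mult_sum_split:
  fixes w m :: "nat \<Rightarrow> nat"
  shows "(\<Sum>i<k. w i) * (\<Sum>i<k. m i) = (\<Sum>i<k. w i * (\<Sum>t\<le>i. m t)) + (\<Sum>i<k. m i * (\<Sum>t<i. w t))"
  by (induction k) (simp_all add: algebra_simps lessThan_Suc_atMost[symmetric])

context finite_field_space
begin

text \<open>\<open>F\<close> stays fixed while \<open>V\<close> shrinks along the induction on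
  \<open>l\<close>. The conditions coming from \<open>F\<close> are therefore imposed on its
  intersections with \<open>V\<close>, and \<open>g\<close> is a map on \<open>V\<close>
  only.\<close>

definition compat_flags :: "nat \<Rightarrow> (nat \<Rightarrow> 'b set) \<Rightarrow> nat \<Rightarrow> 'b set \<Rightarrow> (nat \<Rightarrow> nat \<Rightarrow> nat)
    \<Rightarrow> ('b set list \<times> ('b \<Rightarrow> 'b)) set"
  where "compat_flags k F l V M = {(F', g). length F' = Suc l \<and> F' ! 0 = {0} \<and> F' ! l = V \<and>
    (\<forall>j\<le>l. subspace (F' ! j) \<and> (\<forall>i\<le>k. dim (F i \<inter> F' ! j) = (\<Sum>i'<i. \<Sum>j'<j. M i' j'))) \<and>
    (\<forall>j<l. F' ! j \<subseteq> F' ! Suc j) \<and> g \<in> Lin V \<and> (\<forall>j<l. g ` (F' ! Suc j) \<subseteq> F' ! j) \<and>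
    (\<forall>i<k. g ` (F (Suc i) \<inter> V) \<subseteq> F i)}"

lemma compat_flags_image:
  assumes "(F', g) \<in> compat_flags k F l V M" shows "g ` V \<subseteq> V"
proof (cases l)
  case 0
  hence "V = {0}" using assms by (auto simp: compat_flags_def)
  moreover have "g \<in> Lin V" using assms by (auto simp: compat_flags_def)
  ultimately show ?thesis by (auto simp: Lin_def)
next
  case (Suc j)
  hence "j < l" by simp
  hence "g ` (F' ! Suc j) \<subseteq> F' ! j" "F' ! j \<subseteq> F' ! Suc j" "F' ! l = V"
    using assms unfolding compat_flags_def by blast+
  thus ?thesis using Suc by blast
qed

lemma finite_compat_flags:
  assumes "finite V" shows "finite (compat_flags k F l V M)"
proof (rule finite_subset)
  let ?A = "{F. length F = Suc l \<and> F ! l = V \<and> (\<forall>i<l. F ! i \<subseteq> F ! Suc i)}"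
  show "finite (?A \<times> {g \<in> Lin V. g ` V \<subseteq> V})"
    using finite_chains[OF assms] finite_funcset_Lin[OF assms assms] by (rule finite_cartesian_product)
  show "compat_flags k F l V M \<subseteq> ?A \<times> {g \<in> Lin V. g ` V \<subseteq> V}"
    using compat_flags_image[of _ _ k F l V M] by (auto simp: compat_flags_def)
qed

text \<open>An instance of \<open>card_chain_extensions\<close> with the traces of \<open>F\<close>
  on \<open>V\<close> as domains and those on \<open>W\<close> as targets. Passing from
  \<open>W + (F i \<inter> V)\<close> to the next such sum adds \<open>m i\<close> dimensions, each
  with a free value in \<open>F i \<inter> W\<close>.\<close>

lemma card_compat_extensions:
  assumes V: "fsub V" "V \<subseteq> F k" and W: "subspace W" "W \<subseteq> V"
    and F: "\<And>i. i \<le> k \<Longrightarrow> subspace (F i)" "\<And>i. i < k \<Longrightarrow> F i \<subseteq> F (Suc i)" "F 0 = {0}"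
    and dV: "\<And>i. i \<le> k \<Longrightarrow> dim (F i \<inter> V) = (\<Sum>t<i. w t + m t)"
    and dW: "\<And>i. i \<le> k \<Longrightarrow> dim (F i \<inter> W) = (\<Sum>t<i. w t)"
    and f: "lin f" "f ` W \<subseteq> W" "\<And>i. i < k \<Longrightarrow> f ` (F (Suc i) \<inter> W) \<subseteq> F i"
  shows "real (card {g \<in> extensions W f V. \<forall>i<k. g ` (F (Suc i) \<inter> V) \<subseteq> F i \<inter> W})
      * q ^ (\<Sum>i<k. m i * (\<Sum>t<i. w t)) = 1"
    and "finite {g \<in> extensions W f V. \<forall>i<k. g ` (F (Suc i) \<inter> V) \<subseteq> F i \<inter> W}"
proof -
  have fW: "fsub W" using fsub_subset[OF V(1) W] .
  define H Y B where "H = (\<lambda>i. F i \<inter> V)" and "Y = (\<lambda>i. F i \<inter> W)"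
    and "B = (\<lambda>i. {a + h | a h. a \<in> W \<and> h \<in> H i})"
  have fH: "fsub (H i)" if "i \<le> k" for i
    using fsub_Int[OF V(1) F(1)[OF that]] by (simp add: H_def Int_commute)
  have fY: "fsub (Y i)" if "i \<le> k" for i
    using fsub_Int[OF fW F(1)[OF that]] by (simp add: Y_def Int_commute)
  have Hk: "H k = V" using V(2) by (auto simp: H_def)
  have Bk: "B k = V"
    using W V(1) subspace_0[OF W(1)] by (force simp: B_def Hk fsubD intro: subspace_add)
  have dB: "dim (B i) = dim W + (\<Sum>t<i. m t)" if "i \<le> k" for i
  proof -
    have "W \<inter> H i = F i \<inter> W" using W(2) by (auto simp: H_def)
    thus ?thesis
      using dim_sum(2)[OF fW fH[OF that]] dV[OF that] dW[OF that]
      by (simp add: B_def H_def sum.distrib)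
  qed
  have "card {g \<in> extensions W f (B k). \<forall>i<k. g ` H (Suc i) \<subseteq> Y i}
      = (\<Prod>i<k. card (Y i) ^ (dim (B (Suc i)) - dim (B i)))"
    unfolding B_def
  proof (rule card_chain_extensions[OF fW f(1)])
    show "H 0 = {0}" using F(3) zero_in_fsub[OF V(1)] by (auto simp: H_def)
    show "f ` (W \<inter> H (Suc i)) \<subseteq> Y i" if "i < k" for i
      using f(2) f(3)[OF that] by (auto simp: H_def Y_def)
    show "H i \<subseteq> H (Suc i)" if "i < k" for i using F(2)[OF that] by (auto simp: H_def)
    show "Y i \<subseteq> Y (Suc i)" if "Suc i < k" for i using F(2)[of i] that by (auto simp: Y_def)
  qed (use fH fY in auto)
  hence c: "card {g \<in> extensions W f V. \<forall>i<k. g ` (F (Suc i) \<inter> V) \<subseteq> F i \<inter> W} = (\<Prod>i<k. card (Y i) ^ m i)"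
    unfolding Bk by (simp add: dB H_def Y_def)
  have "real (card (Y i) ^ m i) * q ^ (m i * (\<Sum>t<i. w t)) = 1" if "i < k" for i
  proof -
    have "real (card (Y i)) * q ^ (\<Sum>t<i. w t) = 1"
      using card_fsub_mult_q[OF fY, of i] dW[of i] that by (simp add: Y_def)
    thus ?thesis by (simp add: power_mult mult.commute[of "m i"] flip: power_mult_distrib)
  qed
  hence "(\<Prod>i<k. real (card (Y i) ^ m i) * q ^ (m i * (\<Sum>t<i. w t))) = 1" by simp
  thus "real (card {g \<in> extensions W f V. \<forall>i<k. g ` (F (Suc i) \<inter> V) \<subseteq> F i \<inter> W})
      * q ^ (\<Sum>i<k. m i * (\<Sum>t<i. w t)) = 1"
    unfolding c by (simp add: prod.distrib power_sum)
  hence "card {g \<in> extensions W f V. \<forall>i<k. g ` (F (Suc i) \<inter> V) \<subseteq> F i \<inter> W} \<noteq> 0" by (intro notI) simp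
  thus "finite {g \<in> extensions W f V. \<forall>i<k. g ` (F (Suc i) \<inter> V) \<subseteq> F i \<inter> W}"
    by (meson card.infinite)
qed

lemma compat_flags_snoc:
  assumes V: "subspace V" "V \<subseteq> F k" and W: "W \<subseteq> V"
    and F: "\<And>i. i \<le> k \<Longrightarrow> subspace (F i)" "F 0 = {0}"
    and dV: "\<And>i. i \<le> k \<Longrightarrow> dim (F i \<inter> V) = (\<Sum>t<i. \<Sum>j<Suc l. M t j)"
    and p: "(F'', restrict f W) \<in> compat_flags k F l W M"
  shows "{p \<in> {p \<in> compat_flags k F (Suc l) V M. fst p ! l = W}.
      (take (Suc l) (fst p), restrict (snd p) W) = (F'', restrict f W)}
    = (\<lambda>g. (F'' @ [V], g)) ` {g \<in> extensions W f V. \<forall>i<k. g ` (F (Suc i) \<inter> V) \<subseteq> F i \<inter> W}"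
proof (intro equalityI subsetI)
  fix p assume p': "p \<in> {p \<in> {p \<in> compat_flags k F (Suc l) V M. fst p ! l = W}.
      (take (Suc l) (fst p), restrict (snd p) W) = (F'', restrict f W)}"
  obtain F' g where pFg: "p = (F', g)" by (cases p)
  have C: "(F', g) \<in> compat_flags k F (Suc l) V M" and Fl: "F' ! l = W"
    and t: "take (Suc l) F' = F''" and r: "restrict g W = restrict f W" using p' pFg by auto
  have len: "length F' = Suc (Suc l)" and FV: "F' ! Suc l = V" using C by (auto simp: compat_flags_def)
  have "F' = F'' @ [V]" using snoc_conv_nth[OF len FV] t by simp
  moreover have "g \<in> Lin V" using C by (simp add: compat_flags_def)
  moreover have "g ` V \<subseteq> W"
  proof -
    have "g ` (F' ! Suc l) \<subseteq> F' ! l" using C unfolding compat_flags_def by blast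
    thus ?thesis by (simp add: FV Fl)
  qed
  moreover have "\<forall>i<k. g ` (F (Suc i) \<inter> V) \<subseteq> F i" using C by (simp add: compat_flags_def)
  ultimately show "p \<in> (\<lambda>g. (F'' @ [V], g)) ` {g \<in> extensions W f V. \<forall>i<k. g ` (F (Suc i) \<inter> V) \<subseteq> F i \<inter> W}"
    using r pFg by (intro image_eqI[of _ _ g]) (simp, simp add: extensions_def, blast)
next
  fix p assume "p \<in> (\<lambda>g. (F'' @ [V], g)) ` {g \<in> extensions W f V. \<forall>i<k. g ` (F (Suc i) \<inter> V) \<subseteq> F i \<inter> W}"
  then obtain g where g: "p = (F'' @ [V], g)" "g \<in> Lin V" "restrict g W = restrict f W"
    and gF: "\<And>i. i < k \<Longrightarrow> g ` (F (Suc i) \<inter> V) \<subseteq> F i \<inter> W"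
    by (auto simp: extensions_def)
  have len: "length F'' = Suc l" and Wl: "F'' ! l = W" using p by (auto simp: compat_flags_def)
  have n1: "(F'' @ [V]) ! j = F'' ! j" if "j \<le> l" for j using that len by (simp add: nth_append)
  have n2: "(F'' @ [V]) ! Suc l = V" using len by (simp add: nth_append)
  \<comment> \<open>This is the last step of the condition along \<open>F\<close>, because
    \<open>V \<subseteq> F k\<close>. For \<open>k = 0\<close> there is no such step, but then
    \<open>V\<close> is zero.\<close>
  have gV: "g ` V \<subseteq> W"
  proof (cases k)
    case 0
    hence "V = {0}" using V F subspace_0[OF V(1)] by auto
    moreover have "0 \<in> W" using p subspace_0 Wl by (auto simp: compat_flags_def)
    ultimately show ?thesis using g(2) by (auto simp: Lin_def)
  next
    case (Suc i)
    hence "F (Suc i) \<inter> V = V" using V by auto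
    thus ?thesis using gF[of i] Suc by simp
  qed
  have gf: "g x = restrict f W x" if "x \<in> W" for x
    using g(3)[unfolded restrict_eq_iff] that by simp
  have sub: "F'' ! Suc j \<subseteq> W" if "j < l" for j
    using chain_mono[of l "\<lambda>j. F'' ! j" "Suc j" l] p that Wl by (simp add: compat_flags_def)
  have "\<forall>j\<le>Suc l. subspace ((F'' @ [V]) ! j) \<and>
      (\<forall>i\<le>k. dim (F i \<inter> (F'' @ [V]) ! j) = (\<Sum>i'<i. \<Sum>j'<j. M i' j'))"
    using p V(1) dV n1 n2 by (auto simp: compat_flags_def le_Suc_eq)
  moreover have "\<forall>j<Suc l. (F'' @ [V]) ! j \<subseteq> (F'' @ [V]) ! Suc j"
    using p n1 n2 W Wl by (auto simp: compat_flags_def less_Suc_eq)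
  moreover have "g ` ((F'' @ [V]) ! Suc j) \<subseteq> (F'' @ [V]) ! j" if j: "j < Suc l" for j
  proof (cases "j = l")
    case True
    thus ?thesis using n1 n2 Wl gV by simp
  next
    case False
    hence jl: "j < l" using j by simp
    have "restrict f W ` (F'' ! Suc j) \<subseteq> F'' ! j" using p jl by (simp add: compat_flags_def)
    moreover have "g ` (F'' ! Suc j) = restrict f W ` (F'' ! Suc j)"
      using sub[OF jl] gf by (intro image_cong) auto
    ultimately show ?thesis using n1 jl by simp
  qed
  ultimately have "p \<in> compat_flags k F (Suc l) V M"
    using p g(1,2) gF n1 n2 len by (auto simp: compat_flags_def)
  thus "p \<in> {p \<in> {p \<in> compat_flags k F (Suc l) V M. fst p ! l = W}.
      (take (Suc l) (fst p), restrict (snd p) W) = (F'', restrict f W)}"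
    using g n1 Wl len by simp
qed

lemma compat_flags_restrict:
  assumes "(F', g) \<in> compat_flags k F (Suc l) V M" "F' ! l = W"
  shows "(take (Suc l) F', restrict g W) \<in> compat_flags k F l W M"
proof -
  have C: "(F', g) \<in> compat_flags k F (Suc l) V M" by fact
  have WV: "W \<subseteq> V" and gL: "g \<in> Lin V" using C assms(2) by (auto simp: compat_flags_def)
  have sub: "F' ! Suc j \<subseteq> W" if "j < l" for j
    using chain_mono[of l "\<lambda>j. F' ! j" "Suc j" l] C that assms(2) by (simp add: compat_flags_def)
  have "restrict g W ` (F' ! Suc j) \<subseteq> F' ! j" if "j < l" for j
  proof -
    have "g ` (F' ! Suc j) \<subseteq> F' ! j" using C that by (simp add: compat_flags_def)
    moreover have "restrict g W ` (F' ! Suc j) = g ` (F' ! Suc j)"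
      using sub[OF that] by (intro image_cong) auto
    ultimately show ?thesis by simp
  qed
  moreover have "restrict g W ` (F (Suc i) \<inter> W) \<subseteq> F i" if "i < k" for i
  proof -
    have "g ` (F (Suc i) \<inter> V) \<subseteq> F i" using C that by (simp add: compat_flags_def)
    thus ?thesis using WV by auto
  qed
  ultimately show ?thesis
    using C assms(2) restrict_Lin[OF gL WV] by (auto simp: compat_flags_def min_def)
qed

text \<open>Splitting off the last column of \<open>M\<close>: the space \<open>W\<close> below
  \<open>V\<close> is counted by \<open>card_meeting\<close>, and every configuration on
  \<open>W\<close> has the same number of extensions. The binomials of the successive columns
  multiply to the multinomial coefficients of the rows of \<open>M\<close>.\<close>

lemma card_compat_flags:
  assumes "fsub V" "V \<subseteq> F k"
    and F: "\<And>i. i \<le> k \<Longrightarrow> subspace (F i)" "\<And>i. i < k \<Longrightarrow> F i \<subseteq> F (Suc i)" "F 0 = {0}"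
    and "\<And>i. i \<le> k \<Longrightarrow> dim (F i \<inter> V) = (\<Sum>t<i. \<Sum>j<l. M t j)"
  shows "real (card (compat_flags k F l V M)) * q ^ (dim V choose 2) * (\<Prod>i<k. \<Prod>j<l. qfact q (M i j))
    = q ^ (\<Sum>j<l. (\<Sum>i<k. M i j) choose 2) * (\<Prod>i<k. qfact q (\<Sum>j<l. M i j))"
  using assms(1,2,6)
proof (induction l arbitrary: V)
  case 0
  have "F k \<inter> V = V" using 0 by auto
  hence dV: "dim V = 0" using 0(3)[of k] by simp
  hence V0: "V = {0}" using fsub_dim_0 0 by simp
  have "compat_flags k F 0 V M = {([V], restrict (\<lambda>_. 0) V)}"
  proof (intro equalityI subsetI)
    fix p assume p: "p \<in> compat_flags k F 0 V M"
    obtain F' g where Fg: "p = (F', g)" by (cases p)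
    have "F' = [V]" using p Fg by (cases F') (auto simp: compat_flags_def)
    moreover have "g = restrict (\<lambda>_. 0) V"
      using p Fg V0 by (intro Lin_eqI[of _ V]) (auto simp: compat_flags_def Lin_def)
    ultimately show "p \<in> {([V], restrict (\<lambda>_. 0) V)}" using Fg by simp
  next
    fix p assume p: "p \<in> {([V], restrict (\<lambda>_ :: 'b. 0 :: 'b) V)}"
    have "0 \<in> F i" if "i \<le> k" for i using F(1)[OF that] by (rule subspace_0)
    thus "p \<in> compat_flags k F 0 V M"
      using p V0 0(3) by (auto simp: compat_flags_def LinI)
  qed
  thus ?case using dV by (simp add: numeral_2_eq_2)
next
  case (Suc l)
  note V = Suc.prems(1,2)
  define w m where "w = (\<lambda>i. \<Sum>j<l. M i j)" and "m = (\<lambda>i. M i l)"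
  have dV: "dim (F i \<inter> V) = (\<Sum>t<i. w t + m t)" if "i \<le> k" for i
    using Suc.prems(3)[OF that] by (simp add: w_def m_def)
  have FkV: "F k \<inter> V = V" using V by auto
  have finV: "finite V" using V by (simp add: fsubD)
  have mono: "F i \<subseteq> F k" if "i \<le> k" for i
    using chain_mono[of k F i k] F(2) that by simp
  define e1 e2 where "e1 = (\<Sum>i<k. w i * (\<Sum>t\<le>i. m t))" and "e2 = (\<Sum>i<k. m i * (\<Sum>t<i. w t))"
  define S where "S = (\<Sum>i<k. w i)"
  define b where "b = (\<Sum>i<k. m i)"
  have dVS: "dim V = S + b" using dV[of k] by (simp add: FkV S_def b_def sum.distrib)
  have Sb: "S * b = e1 + e2" unfolding S_def b_def e1_def e2_def by (rule sum_mult_sum_split)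
  let ?Y = "meeting (\<lambda>i. F i \<inter> V) k w"
  have V0: "F 0 \<inter> V = {0}" using F(3) zero_in_fsub[OF V(1)] by auto
  have "real (card ?Y) * q ^ (\<Sum>i<k. w i * (\<Sum>t\<le>i. (w t + m t) - w t)) = (\<Prod>i<k. qbinom q (w i + m i) (w i))"
  proof (rule card_meeting)
    show "subspace (F i \<inter> V)" if "i \<le> k" for i using F(1)[OF that] V by (simp add: fsubD subspace_inter)
    show "F i \<inter> V \<subseteq> F (Suc i) \<inter> V" if "i < k" for i using F(2)[OF that] by auto
    show "dim (F i \<inter> V) = dim (F 0 \<inter> V) + (\<Sum>t<i. w t + m t)" if "i \<le> k" for i
      using dV[OF that] V0 by simp
  qed (use finV in auto)
  hence Y: "real (card ?Y) * q ^ e1 * ((\<Prod>i<k. qfact q (w i)) * (\<Prod>i<k. qfact q (m i))) = (\<Prod>i<k. qfact q (w i + m i))"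
    by (simp add: e1_def qbinom_def prod_dividef prod.distrib qfact_nonzero[OF q_pos])
  have YD: "subspace W" "W \<subseteq> V" "\<And>i. i \<le> k \<Longrightarrow> dim (F i \<inter> W) = (\<Sum>t<i. w t)" if "W \<in> ?Y" for W
  proof -
    show "subspace W" "W \<subseteq> V" using that by (auto simp: meeting_def)
    fix i assume "i \<le> k"
    moreover have "W \<inter> (F i \<inter> V) = F i \<inter> W" using \<open>W \<subseteq> V\<close> by auto
    ultimately show "dim (F i \<inter> W) = (\<Sum>t<i. w t)" using that V0 by (auto simp: meeting_def)
  qed
  have dimW: "dim W = S" if "W \<in> ?Y" for W
  proof -
    have "F k \<inter> W = W" using YD(2)[OF that] V by auto
    thus ?thesis using YD(3)[OF that, of k] by (simp add: S_def)
  qed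
  let ?X = "compat_flags k F (Suc l) V M" and ?N = "\<lambda>W. compat_flags k F l W M"
  let ?P = "\<Prod>i<k. \<Prod>j<l. qfact q (M i j)"
  define R where "R = q ^ (\<Sum>j<l. (\<Sum>i<k. M i j) choose 2) * (\<Prod>i<k. qfact q (w i))"
  have fiber: "real (card {p \<in> ?X. fst p ! l = W}) * q ^ e2 = real (card (?N W)) * 1" if W: "W \<in> ?Y" for W
  proof (rule card_by_fibers(2)[where f = "\<lambda>p. (take (Suc l) (fst p), restrict (snd p) W)"])
    have fW: "fsub W" using fsub_subset[OF V(1) YD(1,2)[OF W]] .
    show "finite (?N W)" using fW by (simp add: finite_compat_flags fsubD)
    show "(\<lambda>p. (take (Suc l) (fst p), restrict (snd p) W)) ` {p \<in> ?X. fst p ! l = W} \<subseteq> ?N W"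
      using compat_flags_restrict by auto
    fix p assume p: "p \<in> ?N W"
    obtain F'' g' where pFg: "p = (F'', g')" by (cases p)
    have "g' \<in> Lin W" using p pFg by (simp add: compat_flags_def)
    then obtain f where f: "lin f" "g' = restrict f W" by (rule LinE)
    have "g' ` W \<subseteq> W" using p unfolding pFg by (rule compat_flags_image)
    hence fWW: "f ` W \<subseteq> W" by (auto simp: f)
    have fF: "f ` (F (Suc i) \<inter> W) \<subseteq> F i" if "i < k" for i
    proof -
      have "restrict f W ` (F (Suc i) \<inter> W) \<subseteq> F i" using p pFg f that by (simp add: compat_flags_def)
      thus ?thesis by auto
    qed
    let ?E = "{g \<in> extensions W f V. \<forall>i<k. g ` (F (Suc i) \<inter> V) \<subseteq> F i \<inter> W}"
    have E: "real (card ?E) * q ^ (\<Sum>i<k. m i * (\<Sum>t<i. w t)) = 1" "finite ?E"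
      using card_compat_extensions[OF V YD(1,2)[OF W] F dV YD(3)[OF W] f(1) fWW fF] by simp_all
    have eq: "{x \<in> {p \<in> ?X. fst p ! l = W}. (take (Suc l) (fst x), restrict (snd x) W) = p}
        = (\<lambda>g. (F'' @ [V], g)) ` ?E"
      unfolding pFg f(2)
      using p unfolding pFg f(2)
      by (intro compat_flags_snoc[OF _ V(2) YD(2)[OF W] F(1,3) Suc.prems(3)]) (use V in \<open>auto simp: fsubD\<close>)
    show "finite {x \<in> {p \<in> ?X. fst p ! l = W}. (take (Suc l) (fst x), restrict (snd x) W) = p}"
      unfolding eq using E(2) by (rule finite_imageI)
    have "card ((\<lambda>g. (F'' @ [V], g)) ` ?E) = card ?E" by (rule card_image) (simp add: inj_on_def)
    thus "real (card {x \<in> {p \<in> ?X. fst p ! l = W}. (take (Suc l) (fst x), restrict (snd x) W) = p}) * q ^ e2 = 1"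
      unfolding eq using E(1) by (simp add: e2_def)
  qed
  have X: "real (card ?X) * (q ^ e2 * (q ^ (S choose 2) * ?P)) = real (card ?Y) * R"
  proof (rule card_by_fibers(2)[where f = "\<lambda>p. fst p ! l"])
    show "finite ?Y" using finV by (intro finite_meeting) auto
    show "(\<lambda>p. fst p ! l) ` ?X \<subseteq> ?Y"
    proof clarify
      fix F' g assume C: "(F', g) \<in> ?X"
      hence W: "subspace (F' ! l)" "F' ! l \<subseteq> V" by (auto simp: compat_flags_def)
      have "dim (F' ! l \<inter> (F i \<inter> V)) = (\<Sum>t<i. w t)" if "i \<le> k" for i
      proof -
        have "F' ! l \<inter> (F i \<inter> V) = F i \<inter> F' ! l" using W(2) by auto
        thus ?thesis using C that by (simp add: compat_flags_def w_def)
      qed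
      thus "fst (F', g) ! l \<in> ?Y"
        using W subspace_0[OF W(1)] V0 FkV by (auto simp: meeting_def)
    qed
    fix W assume W: "W \<in> ?Y"
    have fW: "fsub W" using fsub_subset[OF V(1) YD(1,2)[OF W]] .
    show "finite {p \<in> ?X. fst p ! l = W}" using finite_compat_flags[OF finV] by simp
    have "real (card (?N W)) * q ^ (dim W choose 2) * ?P = R"
      unfolding R_def w_def
      by (rule Suc.IH[OF fW]) (use YD[OF W] V in \<open>auto simp: w_def\<close>)
    hence N: "real (card (?N W)) * (q ^ (S choose 2) * ?P) = R" by (simp add: dimW[OF W])
    have "real (card {p \<in> ?X. fst p ! l = W}) * (q ^ e2 * (q ^ (S choose 2) * ?P))
        = real (card {p \<in> ?X. fst p ! l = W}) * q ^ e2 * (q ^ (S choose 2) * ?P)" by simp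
    also have "\<dots> = R" unfolding fiber[OF W] using N by simp
    finally show "real (card {p \<in> ?X. fst p ! l = W}) * (q ^ e2 * (q ^ (S choose 2) * ?P)) = R" .
  qed
  let ?Qm = "\<Prod>i<k. qfact q (m i)" and ?Qw = "\<Prod>i<k. qfact q (w i)"
  \<comment> \<open>The mixed term \<open>S * b\<close> is used up exactly: \<open>e1\<close> by the
    choice of \<open>W\<close>, \<open>e2\<close> by the extension of the map.\<close>
  have c2: "dim V choose 2 = (S choose 2) + (b choose 2) + (e1 + e2)"
    unfolding dVS choose_two_add Sb ..
  have "real (card ?X) * q ^ (dim V choose 2) * (?P * ?Qm)
      = (real (card ?X) * (q ^ e2 * (q ^ (S choose 2) * ?P))) * (q ^ (b choose 2) * q ^ e1 * ?Qm)"
    unfolding c2 power_add by simp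
  also have "\<dots> = (real (card ?Y) * q ^ e1 * (?Qw * ?Qm))
      * (q ^ (b choose 2) * q ^ (\<Sum>j<l. (\<Sum>i<k. M i j) choose 2))"
    unfolding X R_def by simp
  also have "\<dots> = q ^ (\<Sum>j<Suc l. (\<Sum>i<k. M i j) choose 2) * (\<Prod>i<k. qfact q (w i + m i))"
    unfolding Y by (simp add: power_add b_def m_def)
  finally show ?case by (simp add: prod.distrib w_def m_def)
qed

end

subsection \<open>Semistandard tableaux as chains of shapes\<close>

lemma tshape_0 [simp]: "tshape T 0 r = 0"
proof -
  have "{c. T r c \<noteq> 0 \<and> T r c \<le> 0} = {}" by auto
  thus ?thesis by (simp only: tshape_def card.empty)
qed

lemma card_entries:
  assumes fin: "\<And>r. finite {c. T r c \<noteq> 0}" and zero: "\<And>r c. n \<le> r \<Longrightarrow> T r c = 0"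
  shows "card {(r, c). T r c = Suc i} = (\<Sum>r<n. tshape T (Suc i) r - tshape T i r)"
proof -
  have "{(r, c). T r c = Suc i} = (SIGMA r:{..<n}. {c. T r c = Suc i})"
    using zero by (auto simp: not_le[symmetric])
  moreover have "finite {c. T r c = Suc i}" for r by (rule finite_subset[OF _ fin[of r]]) auto
  ultimately have "card {(r, c). T r c = Suc i} = (\<Sum>r<n. card {c. T r c = Suc i})" by simp
  also have "\<dots> = (\<Sum>r<n. tshape T (Suc i) r - tshape T i r)"
  proof (rule sum.cong)
    fix r
    have "{c. T r c = Suc i} = {c. T r c \<noteq> 0 \<and> T r c \<le> Suc i} - {c. T r c \<noteq> 0 \<and> T r c \<le> i}" by auto
    moreover have "finite {c. T r c \<noteq> 0 \<and> T r c \<le> i}" by (rule finite_subset[OF _ fin[of r]]) auto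
    ultimately show "card {c. T r c = Suc i} = tshape T (Suc i) r - tshape T i r"
      by (simp add: tshape_def card_Diff_subset Collect_mono)
  qed simp
  finally show ?thesis .
qed

lemma ssyt_nonzero_iff: "ssyt \<alpha> lam T \<Longrightarrow> T r c \<noteq> 0 \<longleftrightarrow> c < lam r"
  unfolding ssyt_def by blast

text \<open>Rows increase weakly, so the entries up to \<open>i\<close> occupy an initial segment of
  the row and their number locates them. A tableau can thus be recovered from its chain of
  shapes.\<close>

lemma tshape_le_iff:
  assumes "ssyt \<alpha> lam T" shows "T r c \<noteq> 0 \<and> T r c \<le> i \<longleftrightarrow> c < tshape T i r"
proof -
  have nz: "T r c \<noteq> 0 \<longleftrightarrow> c < lam r" for c by (rule ssyt_nonzero_iff[OF assms])
  have mono: "T r c \<le> T r d" if "c \<le> d" "d < lam r" for c d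
    using that
  proof (induction d rule: dec_induct)
    case (step d)
    thus ?case using assms by (auto simp: ssyt_def intro: order_trans)
  qed simp
  let ?S = "{c. T r c \<noteq> 0 \<and> T r c \<le> i}"
  have S: "?S \<subseteq> {..<lam r}" using nz by auto
  hence fin: "finite ?S" by (rule finite_subset) simp
  have down: "d \<in> ?S" if "c \<in> ?S" "d \<le> c" for c d
  proof -
    have "c < lam r" using that nz[of c] by simp
    thus ?thesis using mono[of d c] that nz[of d] by auto
  qed
  show ?thesis
  proof
    assume "T r c \<noteq> 0 \<and> T r c \<le> i"
    hence "{..c} \<subseteq> ?S" using down by blast
    from card_mono[OF fin this] show "c < tshape T i r" by (simp add: tshape_def)
  next
    assume c: "c < tshape T i r"
    show "T r c \<noteq> 0 \<and> T r c \<le> i"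
    proof (rule ccontr)
      assume "\<not> ?thesis"
      hence "c \<notin> ?S" by blast
      hence "x < c" if "x \<in> ?S" for x using down[OF that, of c] by (meson not_less)
      hence "?S \<subseteq> {..<c}" by blast
      from card_mono[OF _ this] c show False by (simp add: tshape_def)
    qed
  qed
qed

lemma ssyt_unique:
  assumes T: "ssyt \<alpha> lam T" and T': "ssyt \<alpha> lam T'"
    and eq: "\<And>i r. i \<le> length \<alpha> \<Longrightarrow> tshape T i r = tshape T' i r"
  shows "T = T'"
proof (intro ext)
  fix r c
  have le: "T r c \<le> length \<alpha>" "T' r c \<le> length \<alpha>" using T T' by (simp_all add: ssyt_def)
  have nz: "T r c \<noteq> 0 \<longleftrightarrow> T' r c \<noteq> 0" using T T' by (simp add: ssyt_def)
  show "T r c = T' r c"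
  proof (cases "T r c = 0")
    case False
    have "T' r c \<le> T r c"
      using tshape_le_iff[OF T, of r c "T r c"] tshape_le_iff[OF T', of r c "T r c"] eq[OF le(1)] False by simp
    moreover have "T r c \<le> T' r c"
      using tshape_le_iff[OF T, of r c "T' r c"] tshape_le_iff[OF T', of r c "T' r c"] eq[OF le(2)] False nz by simp
    ultimately show ?thesis by simp
  qed (use nz in simp)
qed

lemma partition_vanishes: "is_partition n lam \<Longrightarrow> n \<le> r \<Longrightarrow> lam r = 0"
  unfolding is_partition_def by blast

lemma partition_le:
  assumes "is_partition n lam" shows "lam i \<le> n"
proof (cases "i < n")
  case True
  hence "lam i \<le> (\<Sum>i<n. lam i)" by (intro member_le_sum) auto
  thus ?thesis using assms unfolding is_partition_def by simp
qed (use partition_vanishes[OF assms, of i] in simp)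

context
  fixes n :: nat and lam :: "nat \<Rightarrow> nat" and \<alpha> :: "nat list" and T :: "nat \<Rightarrow> nat \<Rightarrow> nat"
  assumes lam: "is_partition n lam" and T: "ssyt \<alpha> lam T"
begin

lemma tableau_row_finite: "finite {c. T r c \<noteq> 0}"
  using T by (simp add: ssyt_def flip: lessThan_def)

lemma tshape_top: "tshape T (length \<alpha>) r = lam r"
proof -
  have "{c. T r c \<noteq> 0 \<and> T r c \<le> length \<alpha>} = {..<lam r}" using T by (auto simp: ssyt_def)
  thus ?thesis by (simp add: tshape_def)
qed

lemma tshape_mono: "i \<le> j \<Longrightarrow> tshape T i r \<le> tshape T j r"
  unfolding tshape_def
  by (rule card_mono[OF finite_subset[OF _ tableau_row_finite[of r]]]) auto

text \<open>By strictness of columns, a cell with entry at most \<open>Suc j\<close> lies below one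
  with entry at most \<open>j\<close>; consecutive shapes differ by horizontal strips.\<close>

lemma tshape_strip: "tshape T (Suc j) (Suc r) \<le> tshape T j r"
  unfolding tshape_def
proof (rule card_mono[OF finite_subset[OF _ tableau_row_finite[of r]]])
  show "{c. T (Suc r) c \<noteq> 0 \<and> T (Suc r) c \<le> Suc j} \<subseteq> {c. T r c \<noteq> 0 \<and> T r c \<le> j}"
  proof
    fix c assume "c \<in> {c. T (Suc r) c \<noteq> 0 \<and> T (Suc r) c \<le> Suc j}"
    hence c: "T (Suc r) c \<noteq> 0" "T (Suc r) c \<le> Suc j" by auto
    hence "c < lam (Suc r)" using ssyt_nonzero_iff[OF T] by blast
    moreover have "lam (Suc r) \<le> lam r" using lam unfolding is_partition_def by blast
    ultimately have "T r c < T (Suc r) c" "T r c \<noteq> 0"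
      using T ssyt_nonzero_iff[OF T, of r c] by (auto simp: ssyt_def)
    thus "c \<in> {c. T r c \<noteq> 0 \<and> T r c \<le> j}" using c by simp
  qed
qed auto

lemma tableau_row_zero: "n \<le> r \<Longrightarrow> T r c = 0"
  using partition_vanishes[OF lam, of r] ssyt_nonzero_iff[OF T, of r c] by simp

lemma tshape_zero: "n \<le> r \<Longrightarrow> tshape T j r = 0"
  by (simp add: tshape_def tableau_row_zero)

lemma tshape_content: "j < length \<alpha> \<Longrightarrow> (\<Sum>r<n. tshape T (Suc j) r - tshape T j r) = \<alpha> ! j"
  using card_entries[of T n j, OF tableau_row_finite tableau_row_zero] T by (simp add: ssyt_def)

lemma tshape_size: "i \<le> length \<alpha> \<Longrightarrow> (\<Sum>r<n. tshape T i r) = (\<Sum>t<i. \<alpha> ! t)"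
proof (induction i)
  case (Suc i)
  have "(\<Sum>r<n. tshape T (Suc i) r) = (\<Sum>r<n. tshape T i r + (tshape T (Suc i) r - tshape T i r))"
    using tshape_mono[of i "Suc i"] by (intro sum.cong) auto
  thus ?case using Suc tshape_content[of i] by (simp add: sum.distrib)
qed simp

end

lemma wtq_altdef: "wtq q n k T = (\<Prod>j<k. \<Prod>r<n.
    qbinom q (tshape T (Suc j) r - tshape T (Suc j) (Suc r)) (tshape T (Suc j) r - tshape T j r))"
  unfolding wtq_def by (simp add: prod.atLeast1_atMost_eq)

lemma wtq_pos: "0 < q \<Longrightarrow> 0 < wtq q n k T"
  unfolding wtq_def by (intro prod_pos) (simp add: qbinom_pos)

lemma ssyt_of_chain:
  fixes L :: "nat \<Rightarrow> nat \<Rightarrow> nat"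
  assumes L0: "\<And>r. L 0 r = 0" and mono: "\<And>j r. j < length \<alpha> \<Longrightarrow> L j r \<le> L (Suc j) r"
    and strip: "\<And>j r. j < length \<alpha> \<Longrightarrow> L (Suc j) (Suc r) \<le> L j r"
    and zero: "\<And>r. n \<le> r \<Longrightarrow> L (length \<alpha>) r = 0"
    and content: "\<And>j. j < length \<alpha> \<Longrightarrow> (\<Sum>r<n. L (Suc j) r - L j r) = \<alpha> ! j"
  obtains T where "ssyt \<alpha> (L (length \<alpha>)) T" "\<And>i r. i \<le> length \<alpha> \<Longrightarrow> tshape T i r = L i r"
proof -
  let ?k = "length \<alpha>"
  \<comment> \<open>Each cell receives the index of the first shape containing it. Monotonicity of
    the chain orders the rows, and the strip condition makes the columns strict.\<close>
  define T where "T = (\<lambda>r c. if c < L ?k r then LEAST i. c < L i r else 0)"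
  have mono': "L i r \<le> L j r" if "i \<le> j" "j \<le> ?k" for i j r
    using that
  proof (induction j rule: dec_induct)
    case (step j)
    thus ?case using mono[of j r] by simp
  qed simp
  have iff: "T r c \<noteq> 0 \<and> T r c \<le> i \<longleftrightarrow> c < L i r" if i: "i \<le> ?k" for r c i
  proof
    assume c: "c < L i r"
    hence ck: "c < L ?k r" using mono'[OF i] by (meson less_le_trans order_refl)
    have "(LEAST i. c < L i r) \<le> i" by (rule Least_le) (rule c)
    moreover have "c < L (LEAST i. c < L i r) r" by (rule LeastI[of "\<lambda>i. c < L i r"]) (rule c)
    hence "(LEAST i. c < L i r) \<noteq> 0" using L0 by (metis less_nat_zero_code)
    ultimately show "T r c \<noteq> 0 \<and> T r c \<le> i" using ck by (simp add: T_def)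
  next
    assume t: "T r c \<noteq> 0 \<and> T r c \<le> i"
    hence ck: "c < L ?k r" by (simp add: T_def split: if_splits)
    have "c < L (LEAST i. c < L i r) r" by (rule LeastI[of "\<lambda>i. c < L i r"]) (rule ck)
    hence "c < L (T r c) r" using ck by (simp add: T_def)
    thus "c < L i r" using mono'[of "T r c" i r] t i by simp
  qed
  have le: "T r c \<le> ?k" for r c
    using Least_le[of "\<lambda>i. c < L i r" ?k] by (simp add: T_def)
  have nz: "T r c \<noteq> 0 \<longleftrightarrow> c < L ?k r" for r c using iff[of ?k r c] le[of r c] by simp
  have sh: "tshape T i r = L i r" if "i \<le> ?k" for i r
  proof -
    have "{c. T r c \<noteq> 0 \<and> T r c \<le> i} = {..<L i r}" using iff[OF that] by auto
    thus ?thesis by (simp add: tshape_def)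
  qed
  have "ssyt \<alpha> (L ?k) T"
    unfolding ssyt_def
  proof (intro conjI allI impI)
    show "T r c \<noteq> 0 \<longleftrightarrow> c < L ?k r" "T r c \<le> ?k" for r c using nz le by auto
    show "T r c \<le> T r (Suc c)" if "Suc c < L ?k r" for r c
      using iff[of "T r (Suc c)" r "Suc c"] iff[of "T r (Suc c)" r c] le[of r "Suc c"] nz[of r "Suc c"] that by simp
    show "T r c < T (Suc r) c" if c: "c < L ?k (Suc r)" for r c
    proof -
      have "T (Suc r) c \<noteq> 0" using c nz by simp
      then obtain a where a: "T (Suc r) c = Suc a" by (cases "T (Suc r) c") auto
      hence ak: "a < ?k" using le[of "Suc r" c] by simp
      have "c < L (Suc a) (Suc r)" using iff[of "Suc a" "Suc r" c] a ak by simp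
      hence "c < L a r" using strip[OF ak, of r] by simp
      thus ?thesis using iff[of a r c] ak a by simp
    qed
    show "card {(r, c). T r c = Suc i} = \<alpha> ! i" if "i < ?k" for i
    proof -
      have "card {(r, c). T r c = Suc i} = (\<Sum>r<n. tshape T (Suc i) r - tshape T i r)"
      proof (rule card_entries)
        show "finite {c. T r c \<noteq> 0}" for r unfolding nz by simp
        show "T r c = 0" if "n \<le> r" for r c using nz[of r c] zero[OF that] by simp
      qed
      thus ?thesis using sh that content[OF that] by simp
    qed
  qed
  thus thesis using that sh by blast
qed

section \<open>Finiteness of the index sets\<close>

lemma finite_bounded_matrices:
  "finite {M :: nat \<Rightarrow> nat \<Rightarrow> nat. (\<forall>i j. (a \<le> i \<or> b \<le> j) \<longrightarrow> M i j = 0) \<and> (\<forall>i j. M i j \<le> c)}"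
proof -
  have *: "finite {f :: nat \<times> nat \<Rightarrow> nat. \<forall>x. (x \<in> {..<a} \<times> {..<b} \<longrightarrow> f x \<in> {..c}) \<and>
      (x \<notin> {..<a} \<times> {..<b} \<longrightarrow> f x = 0)}"
    by (rule finite_set_of_finite_funs) auto
  show ?thesis
  proof (rule finite_subset[OF _ finite_imageI[OF *, of curry]], rule subsetI)
    fix M :: "nat \<Rightarrow> nat \<Rightarrow> nat"
    assume "M \<in> {M. (\<forall>i j. (a \<le> i \<or> b \<le> j) \<longrightarrow> M i j = 0) \<and> (\<forall>i j. M i j \<le> c)}"
    thus "M \<in> curry ` {f :: nat \<times> nat \<Rightarrow> nat. \<forall>x. (x \<in> {..<a} \<times> {..<b} \<longrightarrow> f x \<in> {..c}) \<and>
        (x \<notin> {..<a} \<times> {..<b} \<longrightarrow> f x = 0)}"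
      by (intro image_eqI[of _ _ "case_prod M"]) (auto simp: not_less)
  qed
qed

lemma finite_contingency: "finite (contingency \<alpha> \<beta>)"
proof (rule finite_subset[OF _ finite_bounded_matrices])
  show "contingency \<alpha> \<beta> \<subseteq> {M. (\<forall>i j. (length \<alpha> \<le> i \<or> length \<beta> \<le> j) \<longrightarrow> M i j = 0) \<and>
      (\<forall>i j. M i j \<le> sum_list \<alpha>)}"
  proof clarify
    fix M assume M: "M \<in> contingency \<alpha> \<beta>"
    have "M i j \<le> sum_list \<alpha>" for i j
    proof (cases "i < length \<alpha> \<and> j < length \<beta>")
      case True
      hence "M i j \<le> (\<Sum>j<length \<beta>. M i j)" by (intro member_le_sum) auto
      also have "\<dots> = \<alpha> ! i" using M True by (simp add: contingency_def)
      also have "\<dots> \<le> sum_list \<alpha>" using True by (simp add: elem_le_sum_list)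
      finally show ?thesis .
    next
      case False
      thus ?thesis using M by (auto simp: contingency_def not_less)
    qed
    thus "(\<forall>i j. (length \<alpha> \<le> i \<or> length \<beta> \<le> j) \<longrightarrow> M i j = 0) \<and> (\<forall>i j. M i j \<le> sum_list \<alpha>)"
      using M by (simp add: contingency_def)
  qed
qed

lemma finite_partitions: "finite {lam. is_partition n lam}"
proof (rule finite_subset)
  show "finite {f :: nat \<Rightarrow> nat. \<forall>i. (i \<in> {..<n} \<longrightarrow> f i \<in> {..n}) \<and> (i \<notin> {..<n} \<longrightarrow> f i = 0)}"
    by (rule finite_set_of_finite_funs) auto
  show "{lam. is_partition n lam} \<subseteq> {f. \<forall>i. (i \<in> {..<n} \<longrightarrow> f i \<in> {..n}) \<and> (i \<notin> {..<n} \<longrightarrow> f i = 0)}"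
  proof clarify
    fix lam i assume lam: "is_partition n lam"
    show "(i \<in> {..<n} \<longrightarrow> lam i \<in> {..n}) \<and> (i \<notin> {..<n} \<longrightarrow> lam i = 0)"
      using partition_le[OF lam, of i] partition_vanishes[OF lam, of i] by simp
  qed
qed

lemma finite_ssyt:
  assumes "is_partition n lam" shows "finite {T. ssyt \<alpha> lam T}"
proof (rule finite_subset[OF _ finite_bounded_matrices])
  show "{T. ssyt \<alpha> lam T} \<subseteq> {T. (\<forall>r c. (n \<le> r \<or> n \<le> c) \<longrightarrow> T r c = 0) \<and> (\<forall>r c. T r c \<le> length \<alpha>)}"
  proof clarify
    fix T assume T: "ssyt \<alpha> lam T"
    have "T r c = 0" if "n \<le> r \<or> n \<le> c" for r c
    proof -
      have "\<not> c < lam r" using that partition_vanishes[OF assms, of r] partition_le[OF assms, of r] by auto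
      thus ?thesis using ssyt_nonzero_iff[OF T, of r c] by blast
    qed
    thus "(\<forall>r c. (n \<le> r \<or> n \<le> c) \<longrightarrow> T r c = 0) \<and> (\<forall>r c. T r c \<le> length \<alpha>)"
      using T by (simp add: ssyt_def)
  qed
qed

subsection \<open>Matrices and flags in coordinate space\<close>

locale matrix_space =
  finite_field_space "\<lambda>(c :: 'a::{field,finite}) (v :: nat \<Rightarrow> 'a). (\<lambda>i. c * v i)" q for q
begin

definition unit_vec :: "nat \<Rightarrow> nat \<Rightarrow> 'a"
  where "unit_vec m = (\<lambda>i. if i = m then 1 else 0)"

lemma subspace_Vn: "subspace (Vn n)"
  by (rule subspaceI) (auto simp: Vn_def)

lemma span_insert_unit_vec:
  assumes "fsub (Vn m)" shows "span (insert (unit_vec m) (Vn m)) = Vn (Suc m)"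
  unfolding span_insert_fsub[OF assms]
proof (intro equalityI subsetI)
  fix x assume "x \<in> {x. \<exists>k. x - (\<lambda>i. k * unit_vec m i) \<in> Vn m}"
  then obtain k where "x - (\<lambda>i. k * unit_vec m i) \<in> Vn m" by blast
  hence "x i = 0" if "Suc m \<le> i" for i using that by (auto simp: Vn_def unit_vec_def dest!: spec[of _ i])
  thus "x \<in> Vn (Suc m)" by (simp add: Vn_def)
next
  fix x :: "nat \<Rightarrow> 'a" assume "x \<in> Vn (Suc m)"
  hence "x - (\<lambda>i. x m * unit_vec m i) \<in> Vn m" by (auto simp: Vn_def unit_vec_def)
  thus "x \<in> {x. \<exists>k. x - (\<lambda>i. k * unit_vec m i) \<in> Vn m}" by blast
qed

lemma unit_vec_notin: "unit_vec m \<notin> Vn m"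
  by (auto simp: Vn_def unit_vec_def)

lemma unit_vec_in: "j < n \<Longrightarrow> unit_vec j \<in> Vn n"
  by (auto simp: Vn_def unit_vec_def)

lemma fsub_dim_Vn: "fsub (Vn n) \<and> dim (Vn n) = n"
proof (induction n)
  case 0
  have "Vn 0 = {0 :: nat \<Rightarrow> 'a}" by (auto simp: Vn_def fun_eq_iff)
  thus ?case by simp
next
  case (Suc n)
  hence V: "fsub (Vn n)" by simp
  show ?case
    using fsub_span_insert[OF V, of "unit_vec n"] dim_span_insert[OF V unit_vec_notin] Suc
    unfolding span_insert_unit_vec[OF V] by simp
qed

lemma fsub_Vn: "fsub (Vn n)" and dim_Vn: "dim (Vn n) = n"
  using fsub_dim_Vn by auto

lemma lin_mv: "lin (mv n A)"
  by (auto simp: lin_def mv_def fun_eq_iff algebra_simps sum.distrib sum_distrib_left)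

lemma mv_in_Vn: "mv n A v \<in> Vn n"
  by (simp add: mv_def Vn_def)

lemma mv_unit_vec: "i < n \<Longrightarrow> j < n \<Longrightarrow> mv n A (unit_vec j) i = A i j"
  by (simp add: mv_def unit_vec_def if_distrib[of "\<lambda>x. _ * x"] cong: if_cong)

text \<open>The passage from matrices to the extensional maps counted above: it is a bijection from
  \<open>gln n\<close> onto the linear endomorphisms of \<open>Vn n\<close>.\<close>

definition mat_map :: "nat \<Rightarrow> (nat \<Rightarrow> nat \<Rightarrow> 'a) \<Rightarrow> (nat \<Rightarrow> 'a) \<Rightarrow> nat \<Rightarrow> 'a"
  where "mat_map n A = restrict (mv n A) (Vn n)"

lemma mat_map_image: "X \<subseteq> Vn n \<Longrightarrow> mat_map n A ` X = mv n A ` X"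
  by (auto simp: mat_map_def)

lemma kerp_mat_map: "kerp (mat_map n A) (Vn n) r = kerp (mv n A) (Vn n) r"
  by (rule kerp_cong) (auto simp: mat_map_def mv_in_Vn)

lemma inj_on_mat_map: "inj_on (mat_map n) (gln n)"
proof (rule inj_onI)
  fix A B assume A: "A \<in> gln n" and B: "B \<in> gln n" and e: "mat_map n A = mat_map n B"
  have "A i j = B i j" for i j
  proof (cases "i < n \<and> j < n")
    case True
    have "mv n A (unit_vec j) = mv n B (unit_vec j)"
      using e unit_vec_in[of j n] True by (simp add: mat_map_def restrict_eq_iff)
    thus ?thesis using mv_unit_vec[of i n j A] mv_unit_vec[of i n j B] True by simp
  next
    case False
    thus ?thesis using A B by (auto simp: gln_def not_less)
  qed
  thus "A = B" by blast
qed

lemma image_mat_map: "mat_map n ` gln n = {g \<in> Lin (Vn n). g ` Vn n \<subseteq> Vn n}"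
proof (intro equalityI subsetI)
  fix g assume "g \<in> mat_map n ` gln n"
  thus "g \<in> {g \<in> Lin (Vn n). g ` Vn n \<subseteq> Vn n}" by (auto simp: mat_map_def LinI lin_mv mv_in_Vn)
next
  fix g assume "g \<in> {g \<in> Lin (Vn n). g ` Vn n \<subseteq> Vn n}"
  then obtain G where G: "lin G" "g = restrict G (Vn n)" "G ` Vn n \<subseteq> Vn n" by (auto elim!: LinE)
  define A where "A = (\<lambda>i j. if i < n \<and> j < n then G (unit_vec j) i else 0)"
  have Gu: "G (unit_vec j) = mv n A (unit_vec j)" if "j < n" for j
  proof
    fix i
    show "G (unit_vec j) i = mv n A (unit_vec j) i"
    proof (cases "i < n")
      case True
      thus ?thesis using that mv_unit_vec[of i n j A] by (simp add: A_def)
    next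
      case False
      have "G (unit_vec j) \<in> Vn n" using G(3) unit_vec_in[OF that] by blast
      thus ?thesis using False by (simp add: Vn_def mv_def)
    qed
  qed
  \<comment> \<open>Induction over the standard flag, each member of which is spanned by the
    previous one and one unit vector.\<close>
  have "\<forall>v \<in> Vn m. G v = mv n A v" if "m \<le> n" for m
    using that
  proof (induction m)
    case 0
    have "v = 0" if "v \<in> Vn 0" for v :: "nat \<Rightarrow> 'a" using that by (auto simp: Vn_def fun_eq_iff)
    thus ?case using lin_0[OF G(1)] lin_0[OF lin_mv] by metis
  next
    case (Suc m)
    show ?case
    proof
      fix v :: "nat \<Rightarrow> 'a" assume v: "v \<in> Vn (Suc m)"
      show "G v = mv n A v"
        by (rule Lin_eq_on_span_insert[OF G(1) lin_mv fsub_Vn[of m], of _ _ "unit_vec m"])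
          (use Suc Gu v span_insert_unit_vec[OF fsub_Vn[of m]] in auto)
    qed
  qed
  hence "g = mat_map n A" by (auto simp: G(2) mat_map_def restrict_eq_iff)
  moreover have "A \<in> gln n" by (auto simp: gln_def A_def)
  ultimately show "g \<in> mat_map n ` gln n" by blast
qed

lemma finite_gln: "finite (gln n :: (nat \<Rightarrow> nat \<Rightarrow> 'a) set)"
  using finite_funcset_Lin[of "Vn n" "Vn n"] fsub_Vn
  by (simp add: fsubD flip: image_mat_map) (metis finite_imageD inj_on_mat_map)

lemma strict_compat_iff:
  "length F = Suc k \<Longrightarrow> strict_compat n N F \<longleftrightarrow> (\<forall>i<k. mv n N ` (F ! Suc i) \<subseteq> F ! i)"
  unfolding strict_compat_def
proof (intro iffI allI impI, goal_cases)
  case (1 i)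
  thus ?case by (auto dest!: spec[of _ "Suc i"])
next
  case (2 i)
  thus ?case by (cases i) auto
qed

lemma chain_below_last:
  assumes "F ! l = V" "\<forall>j<l. F ! j \<subseteq> F ! Suc j" "j \<le> l" shows "F ! j \<subseteq> V"
  using chain_mono[of l "\<lambda>j. F ! j" j l] assms by simp

lemma sum_nth_list: "(\<Sum>t<length \<alpha>. \<alpha> ! t) = sum_list \<alpha>"
  by (simp add: sum_list_sum_nth atLeast0LessThan)

lemma finite_flags: "finite {F :: (nat \<Rightarrow> 'a) set list. flag n \<alpha> F}"
  by (rule finite_subset[OF _ finite_chains[of "Vn n" "length \<alpha>"]])
    (use fsub_Vn[of n] in \<open>auto simp: flag_def fsubD\<close>)

text \<open>\<open>card_compat_flags\<close> is applied to the one-step flag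
  \<open>{0} \<subseteq> Vn n\<close>. Compatibility with it forces the map to be zero, and the
  relative position becomes a single row with the entries of \<open>\<alpha>\<close>, so only the
  flags are counted.\<close>

lemma card_flags:
  assumes "sum_list \<alpha> = n"
  shows "real (card {F :: (nat \<Rightarrow> 'a) set list. flag n \<alpha> F}) * q ^ (n choose 2)
    * (\<Prod>j<length \<alpha>. qfact q (\<alpha> ! j)) = q ^ nstat \<alpha> * qfact q n"
proof -
  let ?V = "Vn n :: (nat \<Rightarrow> 'a) set" and ?l = "length \<alpha>"
  define G where "G = (\<lambda>i :: nat. if i = 0 then {0} else ?V)"
  have "compat_flags 1 G ?l ?V (\<lambda>_ j. \<alpha> ! j) = (\<lambda>F. (F, restrict (\<lambda>_. 0) ?V)) ` {F. flag n \<alpha> F}"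
  proof (intro equalityI subsetI)
    fix p assume p: "p \<in> compat_flags 1 G ?l ?V (\<lambda>_ j. \<alpha> ! j)"
    obtain F g where Fg: "p = (F, g)" by (cases p)
    have sub: "F ! j \<subseteq> ?V" if "j \<le> ?l" for j
      using p Fg that by (intro chain_below_last) (auto simp: compat_flags_def)
    have "?V \<inter> F ! j = F ! j" if "j \<le> ?l" for j using sub[OF that] by blast
    moreover have "dim (G 1 \<inter> F ! j) = (\<Sum>i'<(1::nat). \<Sum>j'<j. \<alpha> ! j')" if "j \<le> ?l" for j
      using p Fg that by (simp add: compat_flags_def)
    ultimately have "dim (F ! j) = (\<Sum>j'<j. \<alpha> ! j')" if "j \<le> ?l" for j
      using that by (simp add: G_def)
    hence "flag n \<alpha> F" using p Fg sub by (auto simp: flag_def compat_flags_def)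
    moreover have "g = restrict (\<lambda>_. 0) ?V"
    proof (rule Lin_eqI[of _ ?V])
      show "g \<in> Lin ?V" using p Fg by (simp add: compat_flags_def)
      show "g x = restrict (\<lambda>_. 0) ?V x" if "x \<in> ?V" for x
        using p Fg that by (auto simp: compat_flags_def G_def)
    qed (simp add: LinI)
    ultimately show "p \<in> (\<lambda>F. (F, restrict (\<lambda>_. 0) ?V)) ` {F. flag n \<alpha> F}" using Fg by blast
  next
    fix p assume "p \<in> (\<lambda>F. (F, restrict (\<lambda>_ :: nat \<Rightarrow> 'a. 0 :: nat \<Rightarrow> 'a) ?V)) ` {F :: (nat \<Rightarrow> 'a) set list. flag n \<alpha> F}"
    then obtain F where F: "p = (F, restrict (\<lambda>_. 0) ?V)" "flag n \<alpha> F" by blast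
    have z: "0 \<in> F ! j" if "j \<le> ?l" for j using subspace_0[of "F ! j"] F(2) that by (simp add: flag_def)
    have "dim (G i \<inter> F ! j) = (\<Sum>i'<i. \<Sum>j'<j. \<alpha> ! j')" if "i \<le> 1" "j \<le> ?l" for i j
    proof (cases "i = 0")
      case True
      thus ?thesis using z[OF that(2)] by (simp add: G_def)
    next
      case False
      have "?V \<inter> F ! j = F ! j" using F(2) that by (auto simp: flag_def)
      moreover have "i = 1" using False that by simp
      ultimately show ?thesis using F(2) that by (simp add: flag_def G_def)
    qed
    moreover have "restrict (\<lambda>_. 0) ?V ` (F ! Suc j) \<subseteq> F ! j" if "j < ?l" for j
    proof -
      have "F ! Suc j \<subseteq> ?V" using F(2) that by (simp add: flag_def)
      thus ?thesis using z[of j] that by (auto simp: subset_iff)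
    qed
    ultimately show "p \<in> compat_flags 1 G ?l ?V (\<lambda>_ j. \<alpha> ! j)"
      using F by (auto simp: compat_flags_def flag_def LinI G_def)
  qed
  hence "card (compat_flags 1 G ?l ?V (\<lambda>_ j. \<alpha> ! j)) = card {F :: (nat \<Rightarrow> 'a) set list. flag n \<alpha> F}"
    by (simp add: card_image inj_on_def)
  moreover have "real (card (compat_flags 1 G ?l ?V (\<lambda>_ j. \<alpha> ! j))) * q ^ (dim ?V choose 2)
      * (\<Prod>i<(1::nat). \<Prod>j<?l. qfact q (\<alpha> ! j))
      = q ^ (\<Sum>j<?l. (\<Sum>i<(1::nat). \<alpha> ! j) choose 2) * (\<Prod>i<(1::nat). qfact q (\<Sum>j<?l. \<alpha> ! j))"
  proof (rule card_compat_flags[OF fsub_Vn])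
    show "dim (G i \<inter> ?V) = (\<Sum>t<i. \<Sum>j<?l. \<alpha> ! j)" if "i \<le> 1" for i
    proof (cases "i = 0")
      case True
      thus ?thesis using zero_in_fsub[OF fsub_Vn[of n]] by (simp add: G_def)
    next
      case False
      thus ?thesis using that assms by (simp add: G_def dim_Vn sum_nth_list)
    qed
    show "G i \<subseteq> G (Suc i)" for i using zero_in_fsub[OF fsub_Vn[of n]] by (simp add: G_def)
  qed (auto simp: G_def subspace_Vn)
  ultimately show ?thesis by (simp add: dim_Vn sum_nth_list assms nstat_def)
qed

lemma contingency_sums:
  assumes "M \<in> contingency \<alpha> \<beta>"
  shows "j \<le> length \<beta> \<Longrightarrow> (\<Sum>i<length \<alpha>. \<Sum>j'<j. M i j') = (\<Sum>j'<j. \<beta> ! j')"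
    and "i \<le> length \<alpha> \<Longrightarrow> (\<Sum>i'<i. \<Sum>j<length \<beta>. M i' j) = (\<Sum>i'<i. \<alpha> ! i')"
proof -
  assume j: "j \<le> length \<beta>"
  show "(\<Sum>i<length \<alpha>. \<Sum>j'<j. M i j') = (\<Sum>j'<j. \<beta> ! j')"
    unfolding sum.swap[of _ "{..<j}"] using assms j by (intro sum.cong) (auto simp: contingency_def)
next
  assume i: "i \<le> length \<alpha>"
  show "(\<Sum>i'<i. \<Sum>j<length \<beta>. M i' j) = (\<Sum>i'<i. \<alpha> ! i')"
    using assms i by (intro sum.cong) (auto simp: contingency_def)
qed

text \<open>\<open>compat_flags\<close> does not mention the dimensions of the members of
  \<open>F'\<close>; intersecting with the full space at the end of \<open>F\<close> recovers them
  from the column sums of \<open>M\<close>.\<close>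

lemma compat_flags_iff:
  fixes F F' :: "(nat \<Rightarrow> 'a) set list"
  assumes M: "M \<in> contingency \<alpha> \<beta>" and F: "flag n \<alpha> F" and N: "N \<in> gln n"
  shows "(F', mat_map n N) \<in> compat_flags (length \<alpha>) (\<lambda>i. F ! i) (length \<beta>) (Vn n) M \<longleftrightarrow>
    flag n \<beta> F' \<and> strict_compat n N F \<and> strict_compat n N F' \<and> relpos F F' M"
proof
  let ?k = "length \<alpha>" and ?l = "length \<beta>"
  assume C: "(F', mat_map n N) \<in> compat_flags (length \<alpha>) (\<lambda>i. F ! i) (length \<beta>) (Vn n) M"
  hence len: "length F' = Suc ?l" by (simp add: compat_flags_def)
  have lenF: "length F = Suc ?k" using F by (simp add: flag_def)
  have sub: "F' ! j \<subseteq> Vn n" if "j \<le> ?l" for j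
    using C that by (intro chain_below_last) (auto simp: compat_flags_def)
  have "dim (F' ! j) = (\<Sum>t<j. \<beta> ! t)" if "j \<le> ?l" for j
  proof -
    have "F ! ?k \<inter> F' ! j = F' ! j" using sub[OF that] F by (auto simp: flag_def)
    moreover have "dim (F ! ?k \<inter> F' ! j) = (\<Sum>i'<?k. \<Sum>j'<j. M i' j')"
      using C that by (simp add: compat_flags_def)
    ultimately show ?thesis using contingency_sums(1)[OF M that] by simp
  qed
  hence "flag n \<beta> F'" using C sub by (auto simp: flag_def compat_flags_def)
  moreover have "mv n N ` (F ! Suc i) \<subseteq> F ! i" if "i < ?k" for i
  proof -
    have s: "F ! Suc i \<subseteq> Vn n" using F that by (simp add: flag_def)
    have "mat_map n N ` (F ! Suc i \<inter> Vn n) \<subseteq> F ! i" using C that by (simp add: compat_flags_def)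
    thus ?thesis using mat_map_image[OF s, of N] s by (simp add: Int_absorb2)
  qed
  moreover have "mv n N ` (F' ! Suc j) \<subseteq> F' ! j" if "j < ?l" for j
  proof -
    have s: "F' ! Suc j \<subseteq> Vn n" using sub[of "Suc j"] that by simp
    show ?thesis unfolding mat_map_image[OF s, symmetric] using C that by (simp add: compat_flags_def)
  qed
  moreover have "relpos F F' M"
    using C len lenF by (auto simp: relpos_def compat_flags_def less_Suc_eq_le)
  ultimately show "flag n \<beta> F' \<and> strict_compat n N F \<and> strict_compat n N F' \<and> relpos F F' M"
    by (simp add: strict_compat_iff[OF len] strict_compat_iff[OF lenF])
next
  let ?k = "length \<alpha>" and ?l = "length \<beta>"
  assume R: "flag n \<beta> F' \<and> strict_compat n N F \<and> strict_compat n N F' \<and> relpos F F' M"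
  hence F': "flag n \<beta> F'" and len: "length F' = Suc ?l" by (auto simp: flag_def)
  have lenF: "length F = Suc ?k" using F by (simp add: flag_def)
  have "mat_map n N ` (F ! Suc i \<inter> Vn n) \<subseteq> F ! i" if "i < ?k" for i
  proof -
    have s: "F ! Suc i \<subseteq> Vn n" using F that by (simp add: flag_def)
    thus ?thesis using R that mat_map_image[OF s, of N]
      by (simp add: strict_compat_iff[OF lenF] Int_absorb2)
  qed
  moreover have "mat_map n N ` (F' ! Suc j) \<subseteq> F' ! j" if "j < ?l" for j
  proof -
    have s: "F' ! Suc j \<subseteq> Vn n" using F' that by (simp add: flag_def)
    show ?thesis unfolding mat_map_image[OF s] using R that by (simp add: strict_compat_iff[OF len])
  qed
  moreover have "\<forall>j\<le>?l. \<forall>i\<le>?k. dim (F ! i \<inter> F' ! j) = (\<Sum>i'<i. \<Sum>j'<j. M i' j')"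
    using R len lenF by (simp add: relpos_def less_Suc_eq_le)
  moreover have "mat_map n N \<in> Lin (Vn n)" by (simp add: mat_map_def LinI lin_mv)
  ultimately show "(F', mat_map n N) \<in> compat_flags (length \<alpha>) (\<lambda>i. F ! i) (length \<beta>) (Vn n) M"
    using F' by (simp add: compat_flags_def flag_def)
qed

section \<open>The number of triples with a given relative position\<close>

lemma finite_Omega: "finite (Omega n \<alpha> \<beta> :: ((nat \<Rightarrow> 'a) set list \<times> _) set)"
  by (rule finite_subset[OF _ finite_cartesian_product[OF finite_flags[of n \<alpha>]
    finite_cartesian_product[OF finite_flags[of n \<beta>] finite_gln[of n]]]]) (auto simp: Omega_def)

lemma finite_OmegaM: "finite (OmegaM n \<alpha> \<beta> M :: ((nat \<Rightarrow> 'a) set list \<times> _) set)"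
  by (rule finite_subset[OF _ finite_Omega[of n \<alpha> \<beta>]]) (auto simp: OmegaM_def)

lemma finite_OmegaT: "finite (OmegaT n \<alpha> \<beta> T T' :: ((nat \<Rightarrow> 'a) set list \<times> _) set)"
  by (rule finite_subset[OF _ finite_Omega[of n \<alpha> \<beta>]]) (auto simp: OmegaT_def)

text \<open>The choice of \<open>F\<close> and that of the pair \<open>(F', N)\<close> each carry
  the exponent \<open>n choose 2\<close>; with \<open>n\<close> they add up to the square of
  \<open>n\<close>. The factorials of the parts of \<open>\<alpha>\<close> cancel between the two
  counts.\<close>

lemma card_OmegaM:
  assumes \<alpha>: "sum_list \<alpha> = n" and M: "M \<in> contingency \<alpha> \<beta>"
  shows "real (card (OmegaM n \<alpha> \<beta> M :: ((nat \<Rightarrow> 'a) set list \<times> _) set)) * q ^ n\<^sup>2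
    * (\<Prod>i<length \<alpha>. \<Prod>j<length \<beta>. qfact q (M i j)) = q ^ (n + nstat \<alpha> + nstat \<beta>) * qfact q n"
proof -
  let ?k = "length \<alpha>" and ?l = "length \<beta>" and ?V = "Vn n :: (nat \<Rightarrow> 'a) set"
  let ?O = "OmegaM n \<alpha> \<beta> M :: ((nat \<Rightarrow> 'a) set list \<times> _) set"
  let ?P = "\<Prod>i<?k. \<Prod>j<?l. qfact q (M i j)" and ?A = "\<Prod>i<?k. qfact q (\<alpha> ! i)"
  let ?c = "q ^ (n choose 2)"
  have O: "real (card ?O) * (?c * ?P)
      = real (card {F :: (nat \<Rightarrow> 'a) set list. flag n \<alpha> F}) * (q ^ nstat \<beta> * ?A)"
  proof (rule card_by_fibers(2)[where f = fst])
    show "finite {F :: (nat \<Rightarrow> 'a) set list. flag n \<alpha> F}" by (rule finite_flags)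
    show "fst ` ?O \<subseteq> {F. flag n \<alpha> F}" by (auto simp: OmegaM_def Omega_def)
    fix F :: "(nat \<Rightarrow> 'a) set list" assume "F \<in> {F. flag n \<alpha> F}"
    hence F: "flag n \<alpha> F" by simp
    show "finite {x \<in> ?O. fst x = F}" using finite_OmegaM by simp
    let ?C = "compat_flags ?k (\<lambda>i. F ! i) ?l ?V M"
    let ?h = "\<lambda>p. (fst (snd p), mat_map n (snd (snd p)))"
    have "bij_betw ?h {x \<in> ?O. fst x = F} ?C"
    proof (rule bij_betw_imageI)
      show "inj_on ?h {x \<in> ?O. fst x = F}"
        using inj_onD[OF inj_on_mat_map] by (auto simp: inj_on_def OmegaM_def Omega_def)
      show "?h ` {x \<in> ?O. fst x = F} = ?C"
      proof (intro equalityI subsetI)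
        fix y assume "y \<in> ?h ` {x \<in> ?O. fst x = F}"
        thus "y \<in> ?C" using compat_flags_iff[OF M F] by (auto simp: OmegaM_def Omega_def)
      next
        fix y assume y: "y \<in> ?C"
        obtain F' g where Fg: "y = (F', g)" by (cases y)
        have "g \<in> Lin ?V" using y Fg by (simp add: compat_flags_def)
        moreover have "g ` ?V \<subseteq> ?V" using y unfolding Fg by (rule compat_flags_image)
        ultimately have "g \<in> Lin ?V" "g ` ?V \<subseteq> ?V" .
        then obtain N where N: "N \<in> gln n" "g = mat_map n N" using image_mat_map by blast
        have "(F, F', N) \<in> ?O"
          using compat_flags_iff[OF M F N(1), of F'] y Fg N F by (simp add: OmegaM_def Omega_def)
        thus "y \<in> ?h ` {x \<in> ?O. fst x = F}" using Fg N by force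
      qed
    qed
    hence "card {x \<in> ?O. fst x = F} = card ?C" by (rule bij_betw_same_card)
    moreover have "real (card ?C) * q ^ (dim ?V choose 2) * ?P
        = q ^ (\<Sum>j<?l. (\<Sum>i<?k. M i j) choose 2) * (\<Prod>i<?k. qfact q (\<Sum>j<?l. M i j))"
    proof (rule card_compat_flags[OF fsub_Vn])
      show "dim (F ! i \<inter> ?V) = (\<Sum>t<i. \<Sum>j<?l. M t j)" if "i \<le> ?k" for i
      proof -
        have "F ! i \<inter> ?V = F ! i" using F that by (auto simp: flag_def)
        thus ?thesis using F that contingency_sums(2)[OF M that] by (simp add: flag_def)
      qed
    qed (use F in \<open>auto simp: flag_def\<close>)
    moreover have "(\<Sum>j<?l. (\<Sum>i<?k. M i j) choose 2) = nstat \<beta>"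
      using M by (simp add: contingency_def nstat_def)
    moreover have "(\<Prod>i<?k. qfact q (\<Sum>j<?l. M i j)) = ?A"
      using M by (simp add: contingency_def)
    ultimately show "real (card {x \<in> ?O. fst x = F}) * (?c * ?P) = q ^ nstat \<beta> * ?A"
      by (simp add: dim_Vn mult.assoc)
  qed
  have "q ^ n\<^sup>2 = q ^ n * ?c * ?c"
    unfolding square_eq_choose_two by (simp add: power_add mult_2)
  hence "real (card ?O) * q ^ n\<^sup>2 * ?P = (real (card ?O) * (?c * ?P)) * (q ^ n * ?c)" by simp
  also have "\<dots> = (real (card {F :: (nat \<Rightarrow> 'a) set list. flag n \<alpha> F}) * ?c * ?A) * (q ^ nstat \<beta> * q ^ n)"
    unfolding O by simp
  also have "\<dots> = q ^ (n + nstat \<alpha> + nstat \<beta>) * qfact q n"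
    unfolding card_flags[OF \<alpha>] by (simp add: power_add)
  finally show ?thesis .
qed

section \<open>The number of triples with given tableaux\<close>

lemma jfpart_eq: "jfpart n N W r = dim (kerp (mv n N) W (Suc r)) - dim (kerp (mv n N) W r)"
  by (simp only: jfpart_def kerp_def)

text \<open>Ensures that the truncated subtraction in \<open>jfpart\<close> is a true
  difference.\<close>

lemma dim_kerp_mono: "fsub W \<Longrightarrow> dim (kerp (mv n N) W r) \<le> dim (kerp (mv n N) W (Suc r))"
  by (intro dim_mono fsub_kerp lin_mv kerp_mono) (auto intro: subspace_kerp lin_mv fsubD)

lemma dim_kerp_eq_sum: "fsub W \<Longrightarrow> dim (kerp (mv n N) W r) = (\<Sum>t<r. jfpart n N W t)"
proof (induction r)
  case (Suc r)
  thus ?case using dim_kerp_mono[of W n N r] by (simp add: jfpart_eq)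
qed simp

lemma flag_fsub: "flag n \<alpha> F \<Longrightarrow> i \<le> length \<alpha> \<Longrightarrow> fsub (F ! i)"
  by (rule fsub_subset[OF fsub_Vn[of n]]) (auto simp: flag_def)

lemma jf_tab_iff: "length F = Suc (length \<alpha>) \<Longrightarrow>
    jf_tab n N F T \<longleftrightarrow> (\<forall>i\<le>length \<alpha>. \<forall>r. tshape T i r = jfpart n N (F ! i) r)"
  by (simp add: jf_tab_def less_Suc_eq_le)

text \<open>Since \<open>N\<close> has type \<open>lam\<close>, its \<open>n\<close>-th power
  vanishes. So \<open>F ! i\<close> is the kernel of that power on it, and its dimension is the size
  of the \<open>i\<close>-th shape of \<open>T\<close>, which the content prescribes.\<close>

lemma strict_flags_iff:
  fixes F :: "(nat \<Rightarrow> 'a) set list"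
  assumes lam: "is_partition n lam" and T: "ssyt \<alpha> lam T"
    and dk: "\<And>r. dim (kerp (mv n N) (Vn n) r) = (\<Sum>t<r. lam t)"
  shows "F \<in> strict_flags (length \<alpha>) (mv n N) (Vn n) (tshape T)
    \<longleftrightarrow> flag n \<alpha> F \<and> strict_compat n N F \<and> jf_tab n N F T"
proof
  let ?k = "length \<alpha>"
  assume S: "F \<in> strict_flags ?k (mv n N) (Vn n) (tshape T)"
  hence len: "length F = Suc ?k" by (simp add: strict_flags_def)
  have sub: "F ! i \<subseteq> Vn n" if "i \<le> ?k" for i
    using S that by (intro chain_below_last) (auto simp: strict_flags_def)
  have f: "fsub (F ! i)" if "i \<le> ?k" for i
    using S that by (intro fsub_subset[OF fsub_Vn[of n] _ sub[OF that]]) (simp add: strict_flags_def)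
  have dF: "dim (kerp (mv n N) (F ! i) r) = (\<Sum>t<r. tshape T i t)" if "i \<le> ?k" for i r
    using S that by (simp add: strict_flags_def)
  have "kerp (mv n N) (Vn n) n = Vn n"
    by (rule kerp_full[OF lin_mv fsub_Vn dk])
      (use lam partition_vanishes[OF lam] in \<open>auto simp: is_partition_def dim_Vn\<close>)
  hence "kerp (mv n N) (F ! i) n = F ! i" if "i \<le> ?k" for i
    using kerp_mono_set[OF sub[OF that], of "mv n N" n] sub[OF that] by auto
  hence "dim (F ! i) = (\<Sum>t<i. \<alpha> ! t)" if "i \<le> ?k" for i
    using dF[OF that, of n] that tshape_size[OF lam T that] by simp
  hence "flag n \<alpha> F" using S sub by (auto simp: flag_def strict_flags_def)
  moreover have "strict_compat n N F"
    using S by (simp add: strict_compat_iff[OF len] strict_flags_def)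
  moreover have "jf_tab n N F T"
    unfolding jf_tab_iff[OF len] using dF by (simp add: jfpart_eq)
  ultimately show "flag n \<alpha> F \<and> strict_compat n N F \<and> jf_tab n N F T" by blast
next
  let ?k = "length \<alpha>"
  assume R: "flag n \<alpha> F \<and> strict_compat n N F \<and> jf_tab n N F T"
  hence F: "flag n \<alpha> F" and len: "length F = Suc ?k" by (auto simp: flag_def)
  have "dim (kerp (mv n N) (F ! i) r) = (\<Sum>t<r. tshape T i t)" if "i \<le> ?k" for i r
    using dim_kerp_eq_sum[OF flag_fsub[OF F that], of n N r] R that by (simp add: jf_tab_iff[OF len])
  moreover have "\<forall>i<?k. mv n N ` (F ! Suc i) \<subseteq> F ! i"
    using R by (simp add: strict_compat_iff[OF len])
  ultimately show "F \<in> strict_flags ?k (mv n N) (Vn n) (tshape T)"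
    using F by (simp add: strict_flags_def flag_def)
qed

lemma card_strict_flags_ssyt:
  assumes lam: "is_partition n lam" and T: "ssyt \<alpha> lam T"
    and dk: "\<And>r. dim (kerp (mv n N) (Vn n) r) = (\<Sum>t<r. lam t)"
  shows "real (card (strict_flags (length \<alpha>) (mv n N) (Vn n) (tshape T))) * q ^ (\<Sum>r<n. lam r choose 2)
    = q ^ nstat \<alpha> * wtq q n (length \<alpha>) T"
proof -
  let ?k = "length \<alpha>"
  have top: "tshape T ?k r = lam r" for r using lam T by (rule tshape_top)
  have "real (card (strict_flags ?k (mv n N) (Vn n) (tshape T))) * q ^ (\<Sum>r<n. tshape T ?k r choose 2)
    = q ^ (\<Sum>j<?k. (\<Sum>r<n. tshape T (Suc j) r - tshape T j r) choose 2)
      * (\<Prod>j<?k. \<Prod>r<n. qbinom q (tshape T (Suc j) r - tshape T (Suc j) (Suc r))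
          (tshape T (Suc j) r - tshape T j r))"
  proof (rule card_strict_flags[OF lin_mv _ fsub_Vn])
    show "mv n N ` Vn n \<subseteq> Vn n" using mv_in_Vn by blast
    show "dim (kerp (mv n N) (Vn n) r) = (\<Sum>t<r. tshape T ?k t)" for r by (simp add: dk top)
    show "dim (Vn n) = (\<Sum>t<n. tshape T ?k t)"
      using lam by (simp add: dim_Vn top is_partition_def)
    show "tshape T j r \<le> tshape T (Suc j) r" for j r by (rule tshape_mono[OF lam T]) simp
    show "tshape T (Suc j) (Suc r) \<le> tshape T j r" for j r using lam T by (rule tshape_strip)
    show "tshape T j r = 0" if "n \<le> r" for j r using tshape_zero[OF lam T that] .
  qed simp
  moreover have "(\<Sum>j<?k. (\<Sum>r<n. tshape T (Suc j) r - tshape T j r) choose 2) = nstat \<alpha>"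
    unfolding nstat_def using tshape_content[OF lam T] by (intro sum.cong) auto
  ultimately show ?thesis by (simp add: top wtq_altdef)
qed

text \<open>For fixed \<open>N\<close> the two flags contribute the sum of
  \<open>lam r choose 2\<close> to the exponent once each. The number of \<open>N\<close> carries
  the sum of the squared parts, which is \<open>n\<close> plus twice that sum, so the dependence of
  the exponent on \<open>lam\<close> disappears.\<close>

lemma card_OmegaT:
  assumes lam: "is_partition n lam" and T: "ssyt \<alpha> lam T" and T': "ssyt \<beta> lam T'"
  shows "real (card (OmegaT n \<alpha> \<beta> T T' :: ((nat \<Rightarrow> 'a) set list \<times> _) set)) * q ^ n\<^sup>2
      * (\<Prod>r<n. qfact q (lam r - lam (Suc r)))
    = q ^ (n + nstat \<alpha> + nstat \<beta>) * (1 - q) ^ (n - lam 0) * qfact q n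
      * wtq q n (length \<alpha>) T * wtq q n (length \<beta>) T'"
proof -
  let ?k = "length \<alpha>" and ?l = "length \<beta>" and ?V = "Vn n :: (nat \<Rightarrow> 'a) set"
  let ?O = "OmegaT n \<alpha> \<beta> T T' :: ((nat \<Rightarrow> 'a) set list \<times> _) set"
  let ?Y = "{N \<in> gln n. mat_map n N \<in> nilp ?V lam}"
  let ?c = "q ^ (\<Sum>r<n. lam r choose 2)"
  let ?P = "\<Prod>r<n. qfact q (lam r - lam (Suc r))"
  define A B where "A = q ^ nstat \<alpha> * wtq q n ?k T" and "B = q ^ nstat \<beta> * wtq q n ?l T'"
  have Yk: "dim (kerp (mv n N) ?V r) = (\<Sum>t<r. lam t)" if "N \<in> ?Y" for N r
    using that by (simp add: nilp_def kerp_mat_map)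
  have O: "real (card ?O) * (?c * ?c) = real (card ?Y) * (A * B)"
  proof (rule card_by_fibers(2)[where f = "\<lambda>x. snd (snd x)"])
    show "finite ?Y" using finite_gln by simp
    show "(\<lambda>x. snd (snd x)) ` ?O \<subseteq> ?Y"
    proof clarify
      fix F F' N assume x: "(F, F', N) \<in> ?O"
      hence F: "flag n \<alpha> F" and N: "N \<in> gln n" and jf: "jf_tab n N F T"
        by (auto simp: OmegaT_def Omega_def)
      have len: "length F = Suc ?k" and Fk: "F ! ?k = ?V" using F by (auto simp: flag_def)
      \<comment> \<open>The top shape of \<open>T\<close> is \<open>lam\<close>, and the top member
        of \<open>F\<close> is the whole space.\<close>
      have "dim (kerp (mv n N) ?V r) = (\<Sum>t<r. lam t)" for r
        using dim_kerp_eq_sum[OF fsub_Vn[of n], of n N r] jf tshape_top[OF lam T] Fk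
        by (auto simp: jf_tab_iff[OF len])
      hence "mat_map n N \<in> nilp ?V lam"
        unfolding mat_map_def by (intro nilpI lin_mv) (use mv_in_Vn in auto)
      thus "snd (snd (F, F', N)) \<in> gln n \<and> mat_map n (snd (snd (F, F', N))) \<in> nilp ?V lam"
        using N by simp
    qed
    fix N assume N: "N \<in> ?Y"
    show "finite {x \<in> ?O. snd (snd x) = N}" using finite_OmegaT by simp
    let ?F = "strict_flags ?k (mv n N) ?V (tshape T)" and ?F' = "strict_flags ?l (mv n N) ?V (tshape T')"
    have "{x \<in> ?O. snd (snd x) = N} = (\<lambda>(F, F'). (F, F', N)) ` (?F \<times> ?F')"
      using strict_flags_iff[OF lam T Yk[OF N]] strict_flags_iff[OF lam T' Yk[OF N]] N
      by (auto simp: OmegaT_def Omega_def image_iff)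
    hence "card {x \<in> ?O. snd (snd x) = N} = card (?F \<times> ?F')"
      by (simp add: card_image inj_on_def)
    hence "real (card {x \<in> ?O. snd (snd x) = N}) * (?c * ?c)
        = (real (card ?F) * ?c) * (real (card ?F') * ?c)" by (simp add: card_cartesian_product)
    thus "real (card {x \<in> ?O. snd (snd x) = N}) * (?c * ?c) = A * B"
      using card_strict_flags_ssyt[OF lam T Yk[OF N]] card_strict_flags_ssyt[OF lam T' Yk[OF N]]
      by (simp only: A_def B_def)
  qed
  have "mat_map n ` ?Y = nilp ?V lam"
  proof (intro equalityI subsetI)
    fix g assume g: "g \<in> nilp ?V lam"
    hence "g \<in> mat_map n ` gln n" unfolding image_mat_map by (simp add: nilp_def)
    thus "g \<in> mat_map n ` ?Y" using g by auto
  qed auto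
  moreover have "inj_on (mat_map n) ?Y" by (rule inj_on_subset[OF inj_on_mat_map]) auto
  ultimately have cY: "card ?Y = card (nilp ?V lam)" using card_image[of "mat_map n" ?Y] by simp
  have z: "lam i = 0" if "n \<le> i" for i using partition_vanishes[OF lam that] .
  have sq: "(\<Sum>i\<le>n. (lam i)\<^sup>2) = n + 2 * (\<Sum>r<n. lam r choose 2)"
  proof -
    have "(\<Sum>i\<le>n. (lam i)\<^sup>2) = (\<Sum>i<n. lam i + 2 * (lam i choose 2))"
      by (simp add: z lessThan_Suc_atMost[symmetric] square_eq_choose_two)
    also have "\<dots> = n + 2 * (\<Sum>r<n. lam r choose 2)"
      using lam unfolding sum.distrib sum_distrib_left[symmetric] is_partition_def by simp
    finally show ?thesis .
  qed
  have "real (card (nilp ?V lam)) * q ^ (dim ?V)\<^sup>2 * (\<Prod>i\<le>n. qfact q (lam i - lam (Suc i)))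
    = q ^ (\<Sum>i\<le>n. (lam i)\<^sup>2) * (1 - q) ^ (dim ?V - lam 0) * qfact q (dim ?V)"
  proof (rule card_nilp[OF fsub_Vn])
    show "lam (Suc i) \<le> lam i" for i using lam unfolding is_partition_def by blast
    show "lam i = 0" if "n < i" for i using z that by simp
    show "dim ?V = (\<Sum>i\<le>n. lam i)"
      using lam unfolding is_partition_def by (simp add: dim_Vn z lessThan_Suc_atMost[symmetric])
  qed
  hence Y: "real (card ?Y) * q ^ n\<^sup>2 * ?P = q ^ n * ?c * ?c * (1 - q) ^ (n - lam 0) * qfact q n"
    unfolding sq cY dim_Vn by (simp add: z lessThan_Suc_atMost[symmetric] power_add mult_2)
  have "(real (card ?O) * q ^ n\<^sup>2 * ?P) * (?c * ?c) = (real (card ?O) * (?c * ?c)) * (q ^ n\<^sup>2 * ?P)"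
    by simp
  also have "\<dots> = (real (card ?Y) * q ^ n\<^sup>2 * ?P) * (A * B)" unfolding O by simp
  also have "\<dots> = (q ^ n * (1 - q) ^ (n - lam 0) * qfact q n * (A * B)) * (?c * ?c)" unfolding Y by simp
  finally have "real (card ?O) * q ^ n\<^sup>2 * ?P = q ^ n * (1 - q) ^ (n - lam 0) * qfact q n * (A * B)"
    using q_pos by simp
  thus ?thesis by (simp add: A_def B_def power_add)
qed

section \<open>Decomposition by pairs of tableaux\<close>

lemma Omega_ssyt_exists:
  fixes F :: "(nat \<Rightarrow> 'a) set list"
  assumes F: "flag n \<alpha> F" and N: "strict_compat n N F"
  defines "lam \<equiv> jfpart n N (Vn n)"
  obtains T where "is_partition n lam" "ssyt \<alpha> lam T" "jf_tab n N F T"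
proof -
  let ?k = "length \<alpha>" and ?g = "mv n N"
  define L where "L = (\<lambda>i. jfpart n N (F ! i))"
  have len: "length F = Suc ?k" and Fk: "F ! ?k = Vn n" and F0: "F ! 0 = {0}"
    using F by (auto simp: flag_def)
  have f: "fsub (F ! i)" if "i \<le> ?k" for i using flag_fsub[OF F that] .
  have fk: "fsub (kerp ?g (F ! i) r)" if "i \<le> ?k" for i r using fsub_kerp[OF lin_mv f[OF that]] .
  have dk: "dim (kerp ?g (F ! i) r) = (\<Sum>t<r. L i t)" if "i \<le> ?k" for i r
    unfolding L_def by (rule dim_kerp_eq_sum[OF f[OF that]])
  have g: "?g ` (F ! Suc i) \<subseteq> F ! i" if "i < ?k" for i
    using N that by (simp add: strict_compat_iff[OF len])
  have step: "F ! i \<subseteq> F ! Suc i" if "i < ?k" for i using F that by (simp add: flag_def)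
  have lamL: "lam = L ?k" by (simp add: lam_def L_def Fk)
  have L0: "L 0 r = 0" for r
  proof -
    have "kerp ?g {0} s = {0}" for s using lin_0[OF lin_funpow[OF lin_mv]] by (auto simp: kerp_def)
    thus ?thesis by (simp add: L_def F0 jfpart_eq)
  qed
  \<comment> \<open>The inclusion of \<open>F ! j\<close> in \<open>F ! Suc j\<close> induces an
    injection on the quotients of consecutive kernels.\<close>
  have mono: "L j r \<le> L (Suc j) r" if j: "j < ?k" for j r
  proof -
    have j': "j \<le> ?k" "Suc j \<le> ?k" using j by simp_all
    have "{a \<in> kerp ?g (F ! j) (Suc r). a \<in> kerp ?g (F ! Suc j) r} = kerp ?g (F ! j) r"
      using step[OF j] kerp_mono[OF lin_mv, of r "Suc r" n N "F ! j"] by (auto simp: kerp_def)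
    moreover have "dim (kerp ?g (F ! j) (Suc r)) + dim (kerp ?g (F ! Suc j) r)
        \<le> dim (kerp ?g (F ! Suc j) (Suc r)) + dim {a \<in> kerp ?g (F ! j) (Suc r). a \<in> kerp ?g (F ! Suc j) r}"
      by (rule dim_quotient_le[OF lin_id fk[OF j'(1)] fk[OF j'(2)] fsubD(1)[OF fk[OF j'(2)]]])
        (use step[OF j] kerp_mono[OF lin_mv, of r "Suc r" n N "F ! Suc j"] in \<open>auto simp: kerp_def\<close>)
    ultimately show ?thesis using dk[OF j'(1)] dk[OF j'(2)] by simp
  qed
  \<comment> \<open>\<open>N\<close> maps \<open>F ! Suc j\<close> into \<open>F ! j\<close> and
    lowers the power that kills a vector by one. It thus induces an injection from a quotient of
    consecutive kernels in the larger space to the preceding one in the smaller space.\<close>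
  have strip: "L (Suc j) (Suc r) \<le> L j r" if j: "j < ?k" for j r
  proof -
    have j': "j \<le> ?k" "Suc j \<le> ?k" using j by simp_all
    have gin: "?g a \<in> F ! j" if "a \<in> F ! Suc j" for a using g[OF j] that by blast
    have iff: "a \<in> kerp ?g (F ! Suc j) (Suc s) \<longleftrightarrow> ?g a \<in> kerp ?g (F ! j) s" if "a \<in> F ! Suc j" for a s
      using gin[OF that] that by (simp add: kerp_def funpow_Suc_right del: funpow.simps)
    have "{a \<in> kerp ?g (F ! Suc j) (Suc (Suc r)). ?g a \<in> kerp ?g (F ! j) r} = kerp ?g (F ! Suc j) (Suc r)"
    proof (intro equalityI subsetI)
      fix a assume "a \<in> {a \<in> kerp ?g (F ! Suc j) (Suc (Suc r)). ?g a \<in> kerp ?g (F ! j) r}"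
      thus "a \<in> kerp ?g (F ! Suc j) (Suc r)" using iff[of a r] kerp_subset by auto
    next
      fix a assume a: "a \<in> kerp ?g (F ! Suc j) (Suc r)"
      hence "a \<in> F ! Suc j" by (simp add: kerp_def)
      moreover have "a \<in> kerp ?g (F ! Suc j) (Suc (Suc r))"
        using a kerp_mono[OF lin_mv, of "Suc r" "Suc (Suc r)" n N "F ! Suc j"] by auto
      ultimately show "a \<in> {a \<in> kerp ?g (F ! Suc j) (Suc (Suc r)). ?g a \<in> kerp ?g (F ! j) r}"
        using a iff[of a r] by simp
    qed
    moreover have "dim (kerp ?g (F ! Suc j) (Suc (Suc r))) + dim (kerp ?g (F ! j) r)
        \<le> dim (kerp ?g (F ! j) (Suc r))
          + dim {a \<in> kerp ?g (F ! Suc j) (Suc (Suc r)). ?g a \<in> kerp ?g (F ! j) r}"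
    proof (rule dim_quotient_le[OF lin_mv fk[OF j'(2)] fk[OF j'(1)] fsubD(1)[OF fk[OF j'(1)]]])
      show "?g ` kerp ?g (F ! Suc j) (Suc (Suc r)) \<subseteq> kerp ?g (F ! j) (Suc r)"
      proof clarify
        fix a assume a: "a \<in> kerp ?g (F ! Suc j) (Suc (Suc r))"
        hence "a \<in> F ! Suc j" by (simp add: kerp_def)
        thus "?g a \<in> kerp ?g (F ! j) (Suc r)" using a iff[of a "Suc r"] by simp
      qed
      show "kerp ?g (F ! j) r \<subseteq> kerp ?g (F ! j) (Suc r)" by (rule kerp_mono[OF lin_mv]) simp
    qed
    ultimately show ?thesis using dk[OF j'(1)] dk[OF j'(2)] by simp
  qed
  have anti: "L i (Suc r) \<le> L i r" if "i \<le> ?k" for i r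
  proof (cases i)
    case (Suc j)
    thus ?thesis using strip[of j r] mono[of j r] that by simp
  qed (simp add: L0)
  have anti': "L i s \<le> L i r" if "i \<le> ?k" "r \<le> s" for i r s
    using that(2)
  proof (induction s rule: dec_induct)
    case (step s)
    thus ?case using anti[OF that(1), of s] by simp
  qed simp
  \<comment> \<open>A nonzero part at an index \<open>r \<ge> n\<close> would give at least
    \<open>n + 1\<close> nonzero parts, more than the dimension allows.\<close>
  have zero: "L i r = 0" if i: "i \<le> ?k" and r: "n \<le> r" for i r
  proof (rule ccontr)
    assume "L i r \<noteq> 0"
    hence "1 \<le> L i t" if "t < Suc n" for t using anti'[OF i, of t r] that r by simp
    hence "(\<Sum>t<Suc n. 1) \<le> (\<Sum>t<Suc n. L i t)" by (intro sum_mono) auto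
    also have "\<dots> = dim (kerp ?g (F ! i) (Suc n))" by (simp only: dk[OF i])
    also have "\<dots> \<le> dim (F ! i)" using f[OF i] fsubD[OF fk[OF i]] by (intro dim_mono) (auto simp: kerp_subset)
    also have "\<dots> \<le> dim (Vn n :: (nat \<Rightarrow> 'a) set)"
      using F i fsub_Vn by (intro dim_mono) (auto simp: flag_def)
    finally show False by (simp add: dim_Vn)
  qed
  have nil: "kerp ?g (F ! i) i = F ! i" if "i \<le> ?k" for i
    using that
  proof (induction i)
    case 0
    thus ?case using F0 by simp
  next
    case (Suc i)
    have "a \<in> kerp ?g (F ! Suc i) (Suc i)" if a: "a \<in> F ! Suc i" for a
    proof -
      have "?g a \<in> kerp ?g (F ! i) i" using g[of i] a Suc by auto
      thus ?thesis using a by (simp add: kerp_def funpow_Suc_right del: funpow.simps)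
    qed
    thus ?case using kerp_subset[of ?g "F ! Suc i" "Suc i"] by blast
  qed
  have size: "(\<Sum>r<n. L i r) = dim (F ! i)" if i: "i \<le> ?k" for i
  proof -
    \<comment> \<open>Strict compatibility kills \<open>F ! i\<close> by the \<open>i\<close>-th
      power, whereas the parts vanish from \<open>n\<close> on. In a weak composition
      \<open>i\<close> may exceed \<open>n\<close>, hence the maximum.\<close>
    have "(\<Sum>r<n. L i r) = (\<Sum>r<max n i. L i r)"
      by (rule sum_support[symmetric]) (use zero[OF i] in auto)
    also have "\<dots> = dim (kerp ?g (F ! i) (max n i))" by (simp only: dk[OF i])
    also have "kerp ?g (F ! i) (max n i) = F ! i"
      using nil[OF i] kerp_mono[OF lin_mv, of i "max n i" n N "F ! i"] kerp_subset[of ?g "F ! i" "max n i"] by auto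
    finally show ?thesis .
  qed
  have content: "(\<Sum>r<n. L (Suc j) r - L j r) = \<alpha> ! j" if j: "j < ?k" for j
  proof -
    have "(\<Sum>r<n. L (Suc j) r - L j r) = (\<Sum>r<n. L (Suc j) r) - (\<Sum>r<n. L j r)"
      using mono[OF j] by (intro sum_subtractf_nat) auto
    thus ?thesis using size[of j] size[of "Suc j"] F j by (simp add: flag_def)
  qed
  obtain T where T: "ssyt \<alpha> (L ?k) T" "\<And>i r. i \<le> ?k \<Longrightarrow> tshape T i r = L i r"
    using ssyt_of_chain[of L \<alpha> n] L0 mono strip zero[OF order_refl] content by blast
  show thesis
  proof (rule that)
    show "is_partition n lam"
      unfolding is_partition_def lamL using anti zero size[OF order_refl] Fk by (simp add: dim_Vn)
    show "ssyt \<alpha> lam T" using T(1) by (simp add: lamL)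
    show "jf_tab n N F T" using T(2) by (simp add: jf_tab_iff[OF len] L_def)
  qed
qed

lemma OmegaT_shape:
  assumes "is_partition n lam" "ssyt \<alpha> lam T" "(F, F', N) \<in> (OmegaT n \<alpha> \<beta> T T' :: ((nat \<Rightarrow> 'a) set list \<times> _) set)"
  shows "lam = jfpart n N (Vn n)"
proof
  fix r
  have F: "flag n \<alpha> F" "jf_tab n N F T" using assms(3) by (auto simp: OmegaT_def Omega_def)
  have len: "length F = Suc (length \<alpha>)" "F ! length \<alpha> = Vn n" using F(1) by (auto simp: flag_def)
  show "lam r = jfpart n N (Vn n) r"
    using tshape_top[OF assms(1,2), of r] F(2) len(2) by (auto simp: jf_tab_iff[OF len(1)])
qed

lemma jf_tab_unique:
  assumes "flag n \<alpha> F" "ssyt \<alpha> lam T1" "ssyt \<alpha> lam T2" "jf_tab n N F T1" "jf_tab n N F T2"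
  shows "T1 = T2"
proof (rule ssyt_unique[OF assms(2,3)])
  have len: "length F = Suc (length \<alpha>)" using assms(1) by (simp add: flag_def)
  show "tshape T1 i r = tshape T2 i r" if "i \<le> length \<alpha>" for i r
    using assms(4,5) that by (simp add: jf_tab_iff[OF len])
qed

definition tableau_pairs where
  "tableau_pairs n \<alpha> \<beta> = (SIGMA lam:{lam. is_partition n lam}. {(T, T'). ssyt \<alpha> lam T \<and> ssyt \<beta> lam T'})"

lemma finite_tableau_pairs:
  "finite {lam. is_partition n lam}" "is_partition n lam \<Longrightarrow> finite {(T, T'). ssyt \<alpha> lam T \<and> ssyt \<beta> lam T'}"
proof -
  show "finite {lam. is_partition n lam}" by (rule finite_partitions)
  assume "is_partition n lam"
  moreover have "{(T, T'). ssyt \<alpha> lam T \<and> ssyt \<beta> lam T'} = {T. ssyt \<alpha> lam T} \<times> {T. ssyt \<beta> lam T}" by auto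
  ultimately show "finite {(T, T'). ssyt \<alpha> lam T \<and> ssyt \<beta> lam T'}" by (simp add: finite_ssyt)
qed

lemma card_Omega_by_tableaux:
  "card (Omega n \<alpha> \<beta> :: ((nat \<Rightarrow> 'a) set list \<times> _) set)
    = (\<Sum>(lam, T, T')\<in>tableau_pairs n \<alpha> \<beta>. card (OmegaT n \<alpha> \<beta> T T' :: ((nat \<Rightarrow> 'a) set list \<times> _) set))"
proof -
  let ?O = "\<lambda>(lam, T, T'). OmegaT n \<alpha> \<beta> T T' :: ((nat \<Rightarrow> 'a) set list \<times> _) set"
  have "Omega n \<alpha> \<beta> = (\<Union>p\<in>tableau_pairs n \<alpha> \<beta>. ?O p)"
  proof (intro equalityI subsetI)
    fix x :: "(nat \<Rightarrow> 'a) set list \<times> (nat \<Rightarrow> 'a) set list \<times> _"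
    assume x: "x \<in> Omega n \<alpha> \<beta>"
    obtain F F' N where FN: "x = (F, F', N)" by (cases x)
    have F: "flag n \<alpha> F" "strict_compat n N F" "flag n \<beta> F'" "strict_compat n N F'"
      using x FN by (auto simp: Omega_def)
    \<comment> \<open>Both tableaux have the same shape because it is read off from \<open>N\<close>
      on the whole space, at the end of either flag.\<close>
    obtain T where T: "is_partition n (jfpart n N (Vn n))" "ssyt \<alpha> (jfpart n N (Vn n)) T" "jf_tab n N F T"
      using Omega_ssyt_exists[OF F(1,2)] .
    obtain T' where T': "ssyt \<beta> (jfpart n N (Vn n)) T'" "jf_tab n N F' T'"
      using Omega_ssyt_exists[OF F(3,4)] .
    have "x \<in> ?O (jfpart n N (Vn n), T, T')" using x FN T(3) T'(2) by (simp add: OmegaT_def)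
    moreover have "(jfpart n N (Vn n), T, T') \<in> tableau_pairs n \<alpha> \<beta>"
      using T T' by (simp add: tableau_pairs_def)
    ultimately show "x \<in> (\<Union>p\<in>tableau_pairs n \<alpha> \<beta>. ?O p)" by blast
  qed (auto simp: OmegaT_def)
  moreover have "card (\<Union>p\<in>tableau_pairs n \<alpha> \<beta>. ?O p) = (\<Sum>p\<in>tableau_pairs n \<alpha> \<beta>. card (?O p))"
  proof (rule card_UN_disjoint)
    show "finite (tableau_pairs n \<alpha> \<beta>)"
      unfolding tableau_pairs_def using finite_tableau_pairs by (intro finite_SigmaI) auto
    show "\<forall>p\<in>tableau_pairs n \<alpha> \<beta>. finite (?O p)" using finite_OmegaT by auto
    show "\<forall>p\<in>tableau_pairs n \<alpha> \<beta>. \<forall>p'\<in>tableau_pairs n \<alpha> \<beta>. p \<noteq> p' \<longrightarrow> ?O p \<inter> ?O p' = {}"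
    proof (intro ballI impI, rule ccontr)
      fix p p' assume p: "p \<in> tableau_pairs n \<alpha> \<beta>" "p' \<in> tableau_pairs n \<alpha> \<beta>" and ne: "p \<noteq> p'"
        and "?O p \<inter> ?O p' \<noteq> {}"
      then obtain x where x: "x \<in> ?O p" "x \<in> ?O p'" by blast
      obtain lam T T' where q1: "p = (lam, T, T')" by (cases p)
      obtain lam2 T2 T2' where q2: "p' = (lam2, T2, T2')" by (cases p')
      obtain F F' N where FN: "x = (F, F', N)" by (cases x)
      have s: "is_partition n lam" "ssyt \<alpha> lam T" "ssyt \<beta> lam T'"
          "is_partition n lam2" "ssyt \<alpha> lam2 T2" "ssyt \<beta> lam2 T2'"
        using p q1 q2 by (auto simp: tableau_pairs_def)
      have y: "(F, F', N) \<in> OmegaT n \<alpha> \<beta> T T'" "(F, F', N) \<in> OmegaT n \<alpha> \<beta> T2 T2'"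
        using x q1 q2 FN by auto
      have l: "lam2 = lam" using OmegaT_shape[OF s(1,2) y(1)] OmegaT_shape[OF s(4,5) y(2)] by simp
      have "T = T2" "T' = T2'"
        using jf_tab_unique[OF _ s(2) s(5)[unfolded l]] jf_tab_unique[OF _ s(3) s(6)[unfolded l]] y
        by (auto simp: OmegaT_def Omega_def)
      thus False using ne q1 q2 l by simp
    qed
  qed
  ultimately show ?thesis by (simp add: case_prod_unfold)
qed

section \<open>Decomposition by relative position\<close>

lemma relpos_unique:
  assumes "M \<in> contingency \<alpha> \<beta>" "M' \<in> contingency \<alpha> \<beta>" "relpos F F' M" "relpos F F' M'"
    and "length F = Suc (length \<alpha>)" "length F' = Suc (length \<beta>)"
  shows "M = M'"
proof (intro ext)
  fix i j
  let ?S = "\<lambda>M i j. \<Sum>i'<i. \<Sum>j'<j. M i' j'"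
  \<comment> \<open>Each entry is a second difference of the corner sums, and these are the
    prescribed dimensions.\<close>
  have corner: "K i j + ?S K i (Suc j) + ?S K (Suc i) j = ?S K (Suc i) (Suc j) + ?S K i j"
    for K :: "nat \<Rightarrow> nat \<Rightarrow> nat" by (simp add: sum.distrib)
  show "M i j = M' i j"
  proof (cases "i < length \<alpha> \<and> j < length \<beta>")
    case True
    have "?S M a b = ?S M' a b" if "a \<le> Suc i" "b \<le> Suc j" for a b
    proof -
      have "a < length F" "b < length F'" using that True assms(5,6) by auto
      thus ?thesis using assms(3,4) unfolding relpos_def by metis
    qed
    hence "?S M i (Suc j) = ?S M' i (Suc j)" "?S M (Suc i) j = ?S M' (Suc i) j"
      "?S M (Suc i) (Suc j) = ?S M' (Suc i) (Suc j)" "?S M i j = ?S M' i j" by (meson le_SucI order_refl)+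
    thus ?thesis using corner[of M] corner[of M'] by linarith
  next
    case False
    thus ?thesis using assms(1,2) by (auto simp: contingency_def not_less)
  qed
qed

lemma relpos_exists:
  fixes F F' :: "(nat \<Rightarrow> 'a) set list"
  assumes F: "flag n \<alpha> F" and F': "flag n \<beta> F'"
  obtains M where "M \<in> contingency \<alpha> \<beta>" "relpos F F' M"
proof -
  let ?k = "length \<alpha>" and ?l = "length \<beta>"
  define d where "d = (\<lambda>i j. dim (F ! i \<inter> F' ! j))"
  \<comment> \<open>The second difference of the intersection dimensions, arranged so that the
    subtraction in the naturals is exact by the inequality \<open>le\<close> below.\<close>
  define M where "M = (\<lambda>i j. if i < ?k \<and> j < ?l
    then d (Suc i) (Suc j) + d i j - (d (Suc i) j + d i (Suc j)) else 0)"
  have s: "subspace (F ! i)" if "i \<le> ?k" for i using F that by (simp add: flag_def)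
  have s': "fsub (F' ! j)" if "j \<le> ?l" for j using flag_fsub[OF F' that] .
  have f: "fsub (F ! i \<inter> F' ! j)" if "i \<le> ?k" "j \<le> ?l" for i j
    using fsub_Int[OF s'[OF that(2)] s[OF that(1)]] by (simp add: Int_commute)
  have stF: "F ! i \<subseteq> F ! Suc i" if "i < ?k" for i using F that by (simp add: flag_def)
  have stF': "F' ! j \<subseteq> F' ! Suc j" if "j < ?l" for j using F' that by (simp add: flag_def)
  \<comment> \<open>A step of \<open>F\<close> inside \<open>F' ! j\<close>, taken modulo
    \<open>F ! i\<close>, embeds into the corresponding step inside
    \<open>F' ! Suc j\<close>.\<close>
  have le: "d (Suc i) j + d i (Suc j) \<le> d (Suc i) (Suc j) + d i j" if ij: "i < ?k" "j < ?l" for i j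
  proof -
    have "{a \<in> F ! Suc i \<inter> F' ! j. a \<in> F ! i \<inter> F' ! Suc j} = F ! i \<inter> F' ! j"
      using stF[OF ij(1)] stF'[OF ij(2)] by auto
    moreover have "dim (F ! Suc i \<inter> F' ! j) + dim (F ! i \<inter> F' ! Suc j)
        \<le> dim (F ! Suc i \<inter> F' ! Suc j) + dim {a \<in> F ! Suc i \<inter> F' ! j. a \<in> F ! i \<inter> F' ! Suc j}"
      by (rule dim_quotient_le[OF lin_id f f fsubD(1)[OF f]]) (use ij stF stF' in auto)
    ultimately show ?thesis by (simp add: d_def)
  qed
  have d0: "d i 0 = 0" if "i \<le> ?k" for i
  proof -
    have "F ! i \<inter> F' ! 0 = {0}" using F' subspace_0[OF s[OF that]] by (auto simp: flag_def)
    thus ?thesis by (simp add: d_def)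
  qed
  have d0': "d 0 j = 0" if "j \<le> ?l" for j
  proof -
    have "F ! 0 \<inter> F' ! j = {0}" using F zero_in_fsub[OF s'[OF that]] by (auto simp: flag_def)
    thus ?thesis by (simp add: d_def)
  qed
  have row: "(\<Sum>j'<j. M i j') + d i j = d (Suc i) j" if "i < ?k" "j \<le> ?l" for i j
    using that
  proof (induction j)
    case (Suc j)
    thus ?case using le[of i j] by (simp add: M_def)
  qed (simp add: d0)
  have S: "(\<Sum>i'<i. \<Sum>j'<j. M i' j') = d i j" if "i \<le> ?k" "j \<le> ?l" for i j
    using that
  proof (induction i)
    case (Suc i)
    thus ?case using row[of i j] by simp
  qed (simp add: d0')
  have dk: "d ?k j = (\<Sum>t<j. \<beta> ! t)" if "j \<le> ?l" for j
  proof -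
    have "F ! ?k \<inter> F' ! j = F' ! j" using F F' that by (auto simp: flag_def)
    thus ?thesis using F' that by (simp add: d_def flag_def)
  qed
  have dl: "d i ?l = (\<Sum>t<i. \<alpha> ! t)" if "i \<le> ?k" for i
  proof -
    have "F ! i \<inter> F' ! ?l = F ! i" using F F' that by (auto simp: flag_def)
    thus ?thesis using F that by (simp add: d_def flag_def)
  qed
  have "M \<in> contingency \<alpha> \<beta>"
    unfolding contingency_def
  proof (intro CollectI conjI allI impI)
    show "M i j = 0" if "?k \<le> i \<or> ?l \<le> j" for i j using that by (auto simp: M_def)
    show "(\<Sum>j<?l. M i j) = \<alpha> ! i" if "i < ?k" for i
      using row[OF that order_refl] dl[of i] dl[of "Suc i"] that by simp
    show "(\<Sum>i<?k. M i j) = \<beta> ! j" if "j < ?l" for j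
      using S[of ?k j] S[of ?k "Suc j"] dk[of j] dk[of "Suc j"] that by (simp add: sum.distrib)
  qed
  moreover have "relpos F F' M"
    using F F' S by (auto simp: relpos_def flag_def d_def less_Suc_eq_le)
  ultimately show thesis by (rule that)
qed

lemma card_Omega_by_relpos:
  "card (Omega n \<alpha> \<beta> :: ((nat \<Rightarrow> 'a) set list \<times> _) set)
    = (\<Sum>M\<in>contingency \<alpha> \<beta>. card (OmegaM n \<alpha> \<beta> M :: ((nat \<Rightarrow> 'a) set list \<times> _) set))"
proof -
  let ?O = "\<lambda>M. OmegaM n \<alpha> \<beta> M :: ((nat \<Rightarrow> 'a) set list \<times> _) set"
  have "Omega n \<alpha> \<beta> = (\<Union>M\<in>contingency \<alpha> \<beta>. ?O M)"
  proof (intro equalityI subsetI)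
    fix x :: "(nat \<Rightarrow> 'a) set list \<times> (nat \<Rightarrow> 'a) set list \<times> _"
    assume x: "x \<in> Omega n \<alpha> \<beta>"
    obtain F F' N where FN: "x = (F, F', N)" by (cases x)
    have F: "flag n \<alpha> F" "flag n \<beta> F'" using x FN by (auto simp: Omega_def)
    obtain M where "M \<in> contingency \<alpha> \<beta>" "relpos F F' M" using relpos_exists[OF F] .
    thus "x \<in> (\<Union>M\<in>contingency \<alpha> \<beta>. ?O M)" using x FN by (auto simp: OmegaM_def)
  qed (auto simp: OmegaM_def)
  moreover have "card (\<Union>M\<in>contingency \<alpha> \<beta>. ?O M) = (\<Sum>M\<in>contingency \<alpha> \<beta>. card (?O M))"
  proof (rule card_UN_disjoint)
    show "finite (contingency \<alpha> \<beta>)" by (rule finite_contingency)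
    show "\<forall>M\<in>contingency \<alpha> \<beta>. finite (?O M)" using finite_OmegaM by blast
    show "\<forall>M\<in>contingency \<alpha> \<beta>. \<forall>M'\<in>contingency \<alpha> \<beta>. M \<noteq> M' \<longrightarrow> ?O M \<inter> ?O M' = {}"
    proof (intro ballI impI, rule ccontr)
      fix M M' assume M: "M \<in> contingency \<alpha> \<beta>" "M' \<in> contingency \<alpha> \<beta>" "M \<noteq> M'"
        and "?O M \<inter> ?O M' \<noteq> {}"
      then obtain F F' N where x: "(F, F', N) \<in> ?O M" "(F, F', N) \<in> ?O M'" by fast
      have "M = M'"
        by (rule relpos_unique[OF M(1,2), of F F']) (use x in \<open>auto simp: OmegaM_def Omega_def flag_def\<close>)
      thus False using M(3) by simp
    qed
  qed
  ultimately show ?thesis by simp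
qed

section \<open>Normalised weights\<close>

lemma power_int_exponent:
  "q powi (int (n ^ 2) - int n - int a - int b) * q ^ (n + a + b) = q ^ n\<^sup>2"
proof -
  have "q powi (int (n ^ 2) - int n - int a - int b) * q powi int (n + a + b)
      = q powi (int (n ^ 2) - int n - int a - int b + int (n + a + b))"
    using q_pos by (intro power_int_add[symmetric]) auto
  also have "int (n ^ 2) - int n - int a - int b + int (n + a + b) = int (n ^ 2)" by simp
  finally show ?thesis by (simp only: power_int_of_nat)
qed

text \<open>The constant \<open>c\<close> does not depend on \<open>M\<close>, and it is the one in
  \<open>weight_OmegaT\<close>. That the cardinality is nonzero makes \<open>pM\<close> a genuine
  quotient, so that its denominator cancels.\<close>

lemma weight_OmegaM:
  assumes "sum_list \<alpha> = n" "M \<in> contingency \<alpha> \<beta>"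
  defines "c \<equiv> q powi (int (n ^ 2) - int n - int (nstat \<alpha>) - int (nstat \<beta>)) * (1 - q) powi (- int n) / qfact q n"
    and "Om \<equiv> OmegaM n \<alpha> \<beta> M :: ((nat \<Rightarrow> 'a) set list \<times> _) set"
  shows "(1 - q) powi (- int n) / (\<Prod>i<length \<alpha>. \<Prod>j<length \<beta>. qfact q (M i j)) = c * real (card Om)"
    and "card Om \<noteq> 0"
proof -
  let ?P = "\<Prod>i<length \<alpha>. \<Prod>j<length \<beta>. qfact q (M i j)" and ?e = "n + nstat \<alpha> + nstat \<beta>"
  define E where "E = q powi (int (n ^ 2) - int n - int (nstat \<alpha>) - int (nstat \<beta>))"
  have E: "E * q ^ ?e = q ^ n\<^sup>2" unfolding E_def by (rule power_int_exponent)
  have P: "?P \<noteq> 0" using qfact_nonzero[OF q_pos] by simp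
  have c: "real (card Om) * q ^ n\<^sup>2 * ?P = q ^ ?e * qfact q n"
    unfolding Om_def by (rule card_OmegaM[OF assms(1,2)])
  have "(E * real (card Om) * ?P) * q ^ ?e = qfact q n * q ^ ?e"
    using c unfolding E[symmetric] by (simp add: mult_ac)
  hence *: "E * real (card Om) * ?P = qfact q n" using q_pos by simp
  show "(1 - q) powi (- int n) / ?P = c * real (card Om)"
    unfolding c_def E_def[symmetric] *[symmetric] using * qfact_nonzero[OF q_pos, of n] P by (auto simp: field_simps)
  show "card Om \<noteq> 0"
  proof
    assume "card Om = 0"
    hence "qfact q n = 0" unfolding *[symmetric] by simp
    thus False using qfact_nonzero[OF q_pos, of n] by simp
  qed
qed

lemma weight_OmegaT:
  assumes lam: "is_partition n lam" "ssyt \<alpha> lam T" "ssyt \<beta> lam T'"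
  defines "c \<equiv> q powi (int (n ^ 2) - int n - int (nstat \<alpha>) - int (nstat \<beta>)) * (1 - q) powi (- int n) / qfact q n"
    and "Om \<equiv> OmegaT n \<alpha> \<beta> T T' :: ((nat \<Rightarrow> 'a) set list \<times> _) set"
  shows "(1 - q) powi (- int (lam 0)) / (\<Prod>r<n. qfact q (lam r - lam (Suc r)))
      * wtq q n (length \<alpha>) T * wtq q n (length \<beta>) T' = c * real (card Om)"
    and "card Om \<noteq> 0"
proof -
  let ?P = "\<Prod>r<n. qfact q (lam r - lam (Suc r))" and ?e = "n + nstat \<alpha> + nstat \<beta>"
  define w where "w = wtq q n (length \<alpha>) T * wtq q n (length \<beta>) T'"
  define E where "E = q powi (int (n ^ 2) - int n - int (nstat \<alpha>) - int (nstat \<beta>))"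
  have E: "E * q ^ ?e = q ^ n\<^sup>2" unfolding E_def by (rule power_int_exponent)
  have P: "?P \<noteq> 0" using qfact_nonzero[OF q_pos] by simp
  have w: "w \<noteq> 0" using wtq_pos[OF q_pos] by (metis w_def mult_eq_0_iff less_irrefl)
  have q1: "1 - q \<noteq> 0" using q_less_1 by simp
  have le: "lam 0 \<le> n" using partition_le[OF lam(1)] .
  have c: "real (card Om) * q ^ n\<^sup>2 * ?P = q ^ ?e * (1 - q) ^ (n - lam 0) * qfact q n * w"
    unfolding Om_def w_def mult.assoc[symmetric] by (rule card_OmegaT[OF lam])
  have "(E * real (card Om) * ?P) * q ^ ?e = ((1 - q) ^ (n - lam 0) * qfact q n * w) * q ^ ?e"
    using c unfolding E[symmetric] by (simp add: mult_ac)
  hence *: "E * real (card Om) * ?P = (1 - q) ^ (n - lam 0) * qfact q n * w" using q_pos by simp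
  \<comment> \<open>The count of nilpotent maps leaves the exponent \<open>n - lam 0\<close>, which
    turns the common power of \<open>1 - q\<close> in \<open>c\<close> into the one depending on
    \<open>lam\<close>.\<close>
  have pw: "(1 - q) powi (- int (lam 0)) = (1 - q) powi (- int n) * (1 - q) ^ (n - lam 0)"
  proof -
    have "- int (lam 0) = - int n + int (n - lam 0)" using le by simp
    hence "(1 - q) powi (- int (lam 0)) = (1 - q) powi (- int n + int (n - lam 0))" by (simp only:)
    also have "\<dots> = (1 - q) powi (- int n) * (1 - q) powi int (n - lam 0)"
      using q1 by (intro power_int_add) auto
    finally show ?thesis by (simp only: power_int_of_nat)
  qed
  have "(1 - q) powi (- int (lam 0)) / ?P * w = (1 - q) powi (- int n) * ((1 - q) ^ (n - lam 0) * qfact q n * w) / (qfact q n * ?P)"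
    unfolding pw using qfact_nonzero[OF q_pos, of n] by simp
  also have "\<dots> = c * real (card Om)"
    unfolding *[symmetric] c_def E_def[symmetric] using P by simp
  finally show "(1 - q) powi (- int (lam 0)) / ?P
      * wtq q n (length \<alpha>) T * wtq q n (length \<beta>) T' = c * real (card Om)" by (simp add: w_def)
  show "card Om \<noteq> 0"
  proof
    assume "card Om = 0"
    hence "(1 - q) ^ (n - lam 0) * qfact q n * w = 0" unfolding *[symmetric] by simp
    thus False using qfact_nonzero[OF q_pos, of n] w q1 by simp
  qed
qed

end

theorem theorem6p19:
  fixes \<alpha> \<beta> :: "nat list" and n :: nat and q :: real
    and fld :: "'a::{field,finite} itself"
  assumes "q = 1 / real (card (UNIV :: 'a set))"
    and "sum_list \<alpha> = n" and "sum_list \<beta> = n"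
  shows "(\<forall>M \<in> contingency \<alpha> \<beta>. \<forall>lam T T'.
            is_partition n lam \<and> ssyt \<alpha> lam T \<and> ssyt \<beta> lam T' \<longrightarrow>
            (1 - q) powi (- int n) / (\<Prod>i<length \<alpha>. \<Prod>j<length \<beta>. qfact q (M i j))
              * pM fld n \<alpha> \<beta> M T T'
            = q powi (int (n ^ 2) - int n - int (nstat \<alpha>) - int (nstat \<beta>)) * (1 - q) powi (- int n)
              / qfact q n * real (card (OmegaMT n \<alpha> \<beta> M T T' :: (_ \<times> _ \<times> (nat \<Rightarrow> nat \<Rightarrow> 'a)) set))
          \<and> q powi (int (n ^ 2) - int n - int (nstat \<alpha>) - int (nstat \<beta>)) * (1 - q) powi (- int n)
              / qfact q n * real (card (OmegaMT n \<alpha> \<beta> M T T' :: (_ \<times> _ \<times> (nat \<Rightarrow> nat \<Rightarrow> 'a)) set))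
            = (1 - q) powi (- int (lam 0)) / (\<Prod>r<n. qfact q (lam r - lam (Suc r)))
              * wtq q n (length \<alpha>) T * wtq q n (length \<beta>) T' * ptM fld n \<alpha> \<beta> M T T')
       \<and> (\<Sum>M \<in> contingency \<alpha> \<beta>.
            (1 - q) powi (- int n) / (\<Prod>i<length \<alpha>. \<Prod>j<length \<beta>. qfact q (M i j)))
         = (\<Sum>lam \<in> {lam. is_partition n lam}.
             \<Sum>(T, T') \<in> {(T, T'). ssyt \<alpha> lam T \<and> ssyt \<beta> lam T'}.
               (1 - q) powi (- int (lam 0)) / (\<Prod>r<n. qfact q (lam r - lam (Suc r)))
               * wtq q n (length \<alpha>) T * wtq q n (length \<beta>) T')"
proof -
  interpret matrix_space q
    by unfold_locales (rule assms(1))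
  define c where "c = q powi (int (n ^ 2) - int n - int (nstat \<alpha>) - int (nstat \<beta>)) * (1 - q) powi (- int n) / qfact q n"
  let ?wM = "\<lambda>M. (1 - q) powi (- int n) / (\<Prod>i<length \<alpha>. \<Prod>j<length \<beta>. qfact q (M i j))"
  let ?wT = "\<lambda>lam T T'. (1 - q) powi (- int (lam 0)) / (\<Prod>r<n. qfact q (lam r - lam (Suc r)))
      * wtq q n (length \<alpha>) T * wtq q n (length \<beta>) T'"
  let ?OM = "\<lambda>M. OmegaM n \<alpha> \<beta> M :: (_ \<times> _ \<times> (nat \<Rightarrow> nat \<Rightarrow> 'a)) set"
  let ?OT = "\<lambda>T T'. OmegaT n \<alpha> \<beta> T T' :: (_ \<times> _ \<times> (nat \<Rightarrow> nat \<Rightarrow> 'a)) set"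
  let ?OMT = "\<lambda>M T T'. OmegaMT n \<alpha> \<beta> M T T' :: (_ \<times> _ \<times> (nat \<Rightarrow> nat \<Rightarrow> 'a)) set"
  note wM = weight_OmegaM[OF assms(2), where \<beta> = \<beta>, folded c_def]
  note wT = weight_OmegaT[where n = n and \<alpha> = \<alpha> and \<beta> = \<beta>, folded c_def]
  \<comment> \<open>The denominator of \<open>pM\<close> is the cardinality in the weight; in the
    next fact the same happens with \<open>ptM\<close>. Both sides of the theorem therefore meet in
    the same multiple of \<open>card (?OMT M T T')\<close>.\<close>
  have 1: "?wM M * pM fld n \<alpha> \<beta> M T T' = c * real (card (?OMT M T T'))"
    if "M \<in> contingency \<alpha> \<beta>" for M T T'
    unfolding wM(1)[OF that] pM_def using wM(2)[OF that] by simp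
  have 2: "c * real (card (?OMT M T T')) = ?wT lam T T' * ptM fld n \<alpha> \<beta> M T T'"
    if "is_partition n lam" "ssyt \<alpha> lam T" "ssyt \<beta> lam T'" for M lam T T'
    unfolding wT(1)[OF that] ptM_def using wT(2)[OF that] by simp
  have "(\<Sum>M\<in>contingency \<alpha> \<beta>. ?wM M) = (\<Sum>M\<in>contingency \<alpha> \<beta>. c * real (card (?OM M)))"
    using wM(1) by simp
  also have "\<dots> = c * real (card (Omega n \<alpha> \<beta> :: (_ \<times> _ \<times> (nat \<Rightarrow> nat \<Rightarrow> 'a)) set))"
    by (simp add: card_Omega_by_relpos sum_distrib_left)
  also have "\<dots> = (\<Sum>(lam, T, T')\<in>tableau_pairs n \<alpha> \<beta>. c * real (card (?OT T T')))"
    by (simp add: card_Omega_by_tableaux sum_distrib_left case_prod_unfold)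
  also have "\<dots> = (\<Sum>lam\<in>{lam. is_partition n lam}. \<Sum>(T, T')\<in>{(T, T'). ssyt \<alpha> lam T \<and> ssyt \<beta> lam T'}.
      c * real (card (?OT T T')))"
    unfolding tableau_pairs_def
    by (rule sum.Sigma[symmetric]) (use finite_tableau_pairs in auto)
  also have "\<dots> = (\<Sum>lam\<in>{lam. is_partition n lam}. \<Sum>(T, T')\<in>{(T, T'). ssyt \<alpha> lam T \<and> ssyt \<beta> lam T'}. ?wT lam T T')"
    by (intro sum.cong refl) (use wT(1) in auto)
  finally have 3: "(\<Sum>M\<in>contingency \<alpha> \<beta>. ?wM M) = (\<Sum>lam\<in>{lam. is_partition n lam}.
      \<Sum>(T, T')\<in>{(T, T'). ssyt \<alpha> lam T \<and> ssyt \<beta> lam T'}. ?wT lam T T')" .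
  show ?thesis
    using 1 2 3 unfolding c_def[symmetric] by blast
qed

end
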